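(* Let $X^N_{\mu,\sigma}$ be a normal form family in coordinates $(u,v,Y)$, with $\sigma$ near $\sigma_0>0$ and $\mu$ near $\mu_0$, as described in the context, and let $T_{\mu,\sigma}(u,v,Y)=(\widetilde Y_{\mu,\sigma}(u,v,Y),\nu=uv)$ be the transition map along the trajectories from $W\cap\{u>0\}$ to the section $\Pi\subset\{u=u_0\}$. Put $\bar\sigma=\bar\sigma(\sigma,\nu)=\sigma+\varphi_{\mu,\sigma}(\nu)$ and $\alpha=\alpha(\sigma,\nu)=\bar\sigma(\sigma,\nu)-\sigma_0$. Then on $W\cap\{u>0\}$: 1. If $\sigma_0\notin\mathbb Q$: $\ \widetilde Y_{\mu,\sigma}(u,v,Y)=\left(\frac u{u_0}\right)^{\bar\sigma}Y.$ 2. If $\sigma_0=\frac pq\in\mathbb Q$, with $(p,q)=1$ when $\sigma_0\notin\mathbb N$: $$\widetilde Y_{\mu,\sigma}(u,v,Y)=\eta_{\mu,\sigma}(\nu)\,v^p\left(\frac u{u_0}\right)^{\bar\sigma}\omega\left(\frac u{u_0},\alpha\right)+\left(\frac u{u_0}\right)^{\bar\sigma}\bigl(Y+\phi_{\mu,\sigma}(Y,u,v)\bigr),$$ where $\eta_{\mu,\sigma}$ is the same as in the normal form (in particular $\eta_{\mu,\sigma}\equiv0$ when $\sigma_0\notin\mathbb N$). The function family $\phi_{\mu,\sigma}$ is of order $O\left(u^{p+q\alpha}\,\omega^{q+1}\left(\frac u{u_0},\alpha\right)|\ln u|\right)$ and, for any integer $l\ge2$, it is of class $C^{l-2}$ in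 $\left(Y,u^{1/l},u^{1/l}\omega\left(\frac u{u_0},\alpha\right),v,\mu,\sigma\right)$.
   Context: **Normal form family.** $\nu=uv$, and $X^N_{\mu,\sigma}$ is - if $\sigma_0\notin\mathbb Q$: $\dot u=u,\ \dot v=-v,\ \dot Y=-(\sigma+\varphi_{\mu,\sigma}(\nu))Y$; - if $\sigma_0=p/q\in\mathbb Q$ (with $(p,q)=1$ when $q\ne1$): $\dot u=u,\ \dot v=-v,\ \dot Y=-(\sigma+\varphi_{\mu,\sigma}(\nu))Y+\Phi_{\mu,\sigma}(\nu,u^pY^q)Y+v^p\eta_{\mu,\sigma}(\nu)$, with $\eta_{\mu,\sigma}\equiv0$ when $\sigma_0\notin\mathbb N$. Here $\varphi_{\mu,\sigma},\Phi_{\mu,\sigma},\eta_{\mu,\sigma}$ are polynomials with $C^\infty$ coefficients in $(\mu,\sigma)$, and $\Phi_{\mu,\sigma}(\nu,0)\equiv0$. This is the normal form of a family $\dot u=u,\ \dot v=-v,\ \dot y=-\sigma y+F_\mu(u,v,y)$ with $F_\mu=O(|(u,v,y)|^2)$, under a change of coordinates tangent to the identity; in particular $\varphi_{\mu,\sigma}(0)=0$. **Compensator.** $\omega(\xi,\alpha)=\frac{\xi^{-\alpha}-1}{\alpha}$ if $\alpha\ne0$, and $\omega(\xi,0)=-\ln\xi$. **Transition.** One works in the region $\{u\ge0,v\ge0\}$ near the origin. $\Pi=\{(u,v,Y): u=u_0,\ v\in[0,v_0],\ Y\in[-Y_0,Y_0]\}$ with $u_0,v_0,Y_0>0$, parametrized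 by $(Y,\nu=u_0v)$. $W$ is a sufficiently small neighborhood of the origin in that region, so that the trajectory of every point of $W\cap\{u>0\}$ reaches $\Pi$ after a finite positive time; $(\mu,\sigma)$ is close to $(\mu_0,\sigma_0)$.
   Formalization: The neighbourhood of (μ0,σ0) on which φ is of class C^{l-2} (up to u=0) may depend on l; with one neighbourhood for all l the claim fails, e.g. for σ0=p=q=1, φ_{μ,σ}(ν)=η=0 and Φ(ν,s)=s. *)

theory Defs
  imports "HOL-Analysis.Analysis" "HOL-Computational_Algebra.Polynomial"
begin

text \<open>
  Class \<open>C\<^sup>k\<close> on an open subset of a finite-dimensional space. Order \<open>k + 1\<close> asks for
  differentiability and for all directional derivatives \<open>x \<mapsto> Df(x) h\<close> to be of class \<open>C\<^sup>k\<close>.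
\<close>

fun Ck_on :: "nat \<Rightarrow> 'a::euclidean_space set \<Rightarrow> ('a \<Rightarrow> real) \<Rightarrow> bool" where
  "Ck_on 0 S f \<longleftrightarrow> continuous_on S f"
| "Ck_on (Suc k) S f \<longleftrightarrow> (\<forall>x\<in>S. f differentiable (at x)) \<and>
     (\<forall>h. Ck_on k S (\<lambda>x. frechet_derivative f (at x) h))"

definition smooth_on :: "'a::euclidean_space set \<Rightarrow> ('a \<Rightarrow> real) \<Rightarrow> bool" where
  "smooth_on S f \<longleftrightarrow> (\<forall>k. Ck_on k S f)"

text \<open>
  Polynomials whose coefficients are smooth functions of the parameter; the degree is bounded
  uniformly in the parameter. A polynomial \<open>\<Phi>(\<nu>,s)\<close> in two variables is represented as a
  polynomial in \<open>s\<close> whose coefficients are polynomials in \<open>\<nu>\<close>.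
\<close>

definition smooth_poly_family :: "'a::euclidean_space set \<Rightarrow> ('a \<Rightarrow> real poly) \<Rightarrow> bool" where
  "smooth_poly_family S f \<longleftrightarrow> (\<exists>d. \<forall>x\<in>S. degree (f x) \<le> d) \<and>
     (\<forall>i. smooth_on S (\<lambda>x. coeff (f x) i))"

definition smooth_poly2_family :: "'a::euclidean_space set \<Rightarrow> ('a \<Rightarrow> real poly poly) \<Rightarrow> bool" where
  "smooth_poly2_family S f \<longleftrightarrow>
     (\<exists>d. \<forall>x\<in>S. degree (f x) \<le> d \<and> (\<forall>j. degree (coeff (f x) j) \<le> d)) \<and>
     (\<forall>i j. smooth_on S (\<lambda>x. coeff (coeff (f x) j) i))"

definition poly2 :: "real poly poly \<Rightarrow> real \<Rightarrow> real \<Rightarrow> real" where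
  "poly2 P \<nu> s = poly (poly P [:s:]) \<nu>"

text \<open>
  The normal form vector fields in the coordinates \<open>(u, v, Y)\<close>. A parameter is a pair
  \<open>x = (\<mu>, \<sigma>)\<close>.
\<close>

definition sigma_bar :: "('m \<times> real \<Rightarrow> real poly) \<Rightarrow> 'm \<times> real \<Rightarrow> real \<Rightarrow> real" where
  "sigma_bar \<phi> x \<nu> = snd x + poly (\<phi> x) \<nu>"

definition normal_form_irrational ::
  "('m \<times> real \<Rightarrow> real poly) \<Rightarrow> 'm \<times> real \<Rightarrow> real \<times> real \<times> real \<Rightarrow> real \<times> real \<times> real" where
  "normal_form_irrational \<phi> x = (\<lambda>(u, v, Y). (u, - v, - sigma_bar \<phi> x (u * v) * Y))"

definition normal_form_rational ::
  "nat \<Rightarrow> nat \<Rightarrow> ('m \<times> real \<Rightarrow> real poly) \<Rightarrow> ('m \<times> real \<Rightarrow> real poly poly) \<Rightarrow>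
   ('m \<times> real \<Rightarrow> real poly) \<Rightarrow> 'm \<times> real \<Rightarrow> real \<times> real \<times> real \<Rightarrow> real \<times> real \<times> real" where
  "normal_form_rational p q \<phi> \<Phi> \<eta> x = (\<lambda>(u, v, Y).
     (u, - v, - sigma_bar \<phi> x (u * v) * Y + poly2 (\<Phi> x) (u * v) (u ^ p * Y ^ q) * Y
              + v ^ p * poly (\<eta> x) (u * v)))"

definition compensator :: "real \<Rightarrow> real \<Rightarrow> real" where
  "compensator \<xi> \<alpha> = (if \<alpha> = 0 then - ln \<xi> else (\<xi> powr (- \<alpha>) - 1) / \<alpha>)"

definition quadrant :: "(real \<times> real \<times> real) set" where
  "quadrant = {(u, v, Y). 0 \<le> u \<and> 0 \<le> v}"

definition exit_section :: "real \<Rightarrow> real \<Rightarrow> real \<Rightarrow> (real \<times> real \<times> real) set" where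
  "exit_section u0 v0 Y0 = {(u, v, Y). u = u0 \<and> v \<in> {0..v0} \<and> Y \<in> {- Y0..Y0}}"

text \<open>
  \<open>hits X S a b\<close>: the trajectory of \<open>X\<close> starting at \<open>a\<close> reaches \<open>S\<close> after a finite positive time,
  for the first time at the point \<open>b\<close>.
\<close>

definition hits :: "('b::real_normed_vector \<Rightarrow> 'b) \<Rightarrow> 'b set \<Rightarrow> 'b \<Rightarrow> 'b \<Rightarrow> bool" where
  "hits X S a b \<longleftrightarrow> (\<exists>\<gamma> \<tau>. 0 < \<tau> \<and> \<gamma> 0 = a \<and> \<gamma> \<tau> = b \<and> b \<in> S \<and>
     (\<forall>t\<in>{0..\<tau>}. (\<gamma> has_vector_derivative X (\<gamma> t)) (at t within {0..\<tau>})) \<and>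
     (\<forall>t\<in>{0..<\<tau>}. \<gamma> t \<notin> S))"

text \<open>
  The transition map, with a point \<open>(u, v, Y)\<close> of the section given by its coordinates
  \<open>(Y, \<nu>) = (Y, u * v)\<close>. It is meaningful at \<open>a\<close> only if \<open>\<exists>!b. hits X S a b\<close>.
\<close>

definition transition_map ::
  "(real \<times> real \<times> real \<Rightarrow> real \<times> real \<times> real) \<Rightarrow> (real \<times> real \<times> real) set \<Rightarrow>
   real \<times> real \<times> real \<Rightarrow> real \<times> real" where
  "transition_map X S a = (case (THE b. hits X S a b) of (u, v, Y) \<Rightarrow> (Y, u * v))"

end

theory Submission
  imports Defs
begin

text \<open>
  Along a trajectory \<open>\<nu> = u v\<close> is constant and \<open>u\<close> grows like \<open>e\<^sup>t\<close>, so the exit time is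
  \<open>\<tau> = ln (u0 / u)\<close>. In terms of \<open>Z = exp (\<sigma>_bar t) Y\<close> the third equation of a resonant family is
  \<open>Z' = \<Phi>(\<nu>, u^p exp (- q \<alpha> t) Z^q) Z + \<eta>(\<nu>) v^p exp (\<alpha> t)\<close>: the powers of \<open>e\<^sup>t\<close> combine because
  \<open>p - q \<sigma>_bar = - q \<alpha>\<close>, and because \<open>\<eta>\<close> vanishes unless \<open>\<sigma>0 = p\<close>. Without the term in \<open>\<Phi>\<close> the solution
  is \<open>Y\<close> plus \<open>\<eta> v^p\<close> times the integral of \<open>exp (\<alpha> t)\<close>, and this integral over \<open>[0, \<tau>]\<close> is the
  compensator. The function \<open>\<psi>\<close> of the theorem is what \<open>\<Phi>\<close> adds: the value at \<open>y = 1\<close> of the solution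
  \<open>z\<close>, with \<open>z(0) = 0\<close>, of a scalar equation (\<open>remainder_rhs\<close>) on the fixed interval \<open>0 \<le> y \<le> 1\<close>,
  \<open>t = \<tau> y\<close>. The formula for the transition map is then a computation (\<open>normal_form_transition\<close>).

  Smoothness comes from flatness. Put \<open>u = r^l\<close>. The right hand side is made of powers of \<open>r\<close>, of
  \<open>ln r\<close>, of exponentials of \<open>\<alpha> \<tau> y\<close>, which for \<open>\<sigma>\<close> near \<open>\<sigma>0\<close> are at most a small negative power of
  \<open>r\<close>, and of functions that are smooth up to \<open>r = 0\<close>. Every derivative in the parameters
  costs a factor of at most \<open>1 / r^(1 + e)\<close>, while the right hand side is of size \<open>r^(l p)\<close> up to a small
  loss (\<open>remainder_rhs_graded\<close>). Since \<open>p \<ge> 1\<close>, a positive power of \<open>r\<close> survives \<open>l - 2\<close>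
  derivatives, so that the right hand side, extended by zero to \<open>r \<le> 0\<close>, is of class \<open>C^(l - 2)\<close>
  (\<open>extend_by_zero\<close>), and so is the solution (\<open>solution_param_Ck\<close>). Solutions
  are unique, so for different \<open>l\<close> this is the same function \<open>\<psi>\<close>, written in terms of different roots of \<open>u\<close>.

  For the order of \<open>\<psi>\<close>, \<open>|Z|\<close> and \<open>exp (- \<alpha> t) |Z|\<close> are bounded, up to constant factors, by the integrals of
  \<open>exp (\<alpha> s)\<close> and \<open>exp (- \<alpha> s)\<close> over \<open>[0, \<tau>]\<close>, which are the compensator \<open>\<omega>\<close> and
  \<open>exp (- \<alpha> \<tau>) \<omega>\<close>. Inserting this into the
  equation, of which the right hand side is at most a multiple of \<open>\<tau> u^p (exp (- \<alpha> t) |Z|)^q |Z|\<close>, gives the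
  estimate (\<open>remainder_estimate\<close>).
\<close>

section \<open>Functions with graded bounds on their parameter derivatives\<close>

text \<open>
  A function depends on a time \<open>y\<close> in the unit interval and on a parameter \<open>z\<close>, and only the
  parameter is differentiated. \<open>B m f\<close> says that \<open>f\<close> is of order \<open>m\<close> in some sense, and every
  derivative may lower the order by \<open>c\<close>. With a vacuous \<open>B\<close> this is class \<open>C\<^sup>k\<close> in the
  parameter, jointly continuous in time and parameter; with powers of a weight it is a class of
  symbols. Both are needed, and both are closed under the same operations for the same reasons.
\<close>

fun graded_Ck :: "(real \<Rightarrow> (real \<Rightarrow> 'b::euclidean_space \<Rightarrow> real) \<Rightarrow> bool) \<Rightarrow> real \<Rightarrow> 'b set \<Rightarrow>
    nat \<Rightarrow> real \<Rightarrow> (real \<Rightarrow> 'b \<Rightarrow> real) \<Rightarrow> bool" where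
  "graded_Ck B c D 0 m f \<longleftrightarrow> continuous_on ({0..1} \<times> D) (\<lambda>p. f (fst p) (snd p)) \<and> B m f"
| "graded_Ck B c D (Suc k) m f \<longleftrightarrow> continuous_on ({0..1} \<times> D) (\<lambda>p. f (fst p) (snd p)) \<and> B m f \<and>
     (\<exists>f'. (\<forall>y\<in>{0..1}. \<forall>z\<in>D. (f y has_derivative f' y z) (at z)) \<and>
       (\<forall>h. graded_Ck B c D k (m - c) (\<lambda>y z. f' y z h)))"

text \<open>
  What a notion of order has to satisfy for the resulting class to be an algebra filtered by the order.
\<close>

locale graded_bound =
  fixes D :: "'b::euclidean_space set" and B :: "real \<Rightarrow> (real \<Rightarrow> 'b \<Rightarrow> real) \<Rightarrow> bool" and c :: real
  assumes open_D: "open D" and loss_nonneg: "0 \<le> c"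
    and bound_cong: "\<And>m f g. B m f \<Longrightarrow> (\<And>y z. y \<in> {0..1} \<Longrightarrow> z \<in> D \<Longrightarrow> f y z = g y z) \<Longrightarrow> B m g"
    and bound_bounded: "\<And>f C. (\<And>y z. y \<in> {0..1} \<Longrightarrow> z \<in> D \<Longrightarrow> \<bar>f y z\<bar> \<le> C) \<Longrightarrow> B 0 f"
    and bound_add: "\<And>m f g. B m f \<Longrightarrow> B m g \<Longrightarrow> B m (\<lambda>y z. f y z + g y z)"
    and bound_mult: "\<And>m m' f g. B m f \<Longrightarrow> B m' g \<Longrightarrow> B (m + m') (\<lambda>y z. f y z * g y z)"
    and bound_mono: "\<And>m m' f. B m f \<Longrightarrow> m' \<le> m \<Longrightarrow> B m' f"
begin

abbreviation "Cg \<equiv> graded_Ck B c D"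

lemma Cg_continuous: "Cg k m f \<Longrightarrow> continuous_on ({0..1} \<times> D) (\<lambda>p. f (fst p) (snd p))"
  by (cases k) auto

lemma Cg_bound: "Cg k m f \<Longrightarrow> B m f"
  by (cases k) auto

lemma Cg_SucI:
  assumes "continuous_on ({0..1} \<times> D) (\<lambda>p. f (fst p) (snd p))" "B m f"
    "\<And>y z. y \<in> {0..1} \<Longrightarrow> z \<in> D \<Longrightarrow> (f y has_derivative f' y z) (at z)"
    "\<And>h. Cg k (m - c) (\<lambda>y z. f' y z h)"
  shows "Cg (Suc k) m f"
  unfolding graded_Ck.simps using assms by blast

lemma Cg_SucE:
  assumes "Cg (Suc k) m f"
  obtains f' where "\<And>y z. y \<in> {0..1} \<Longrightarrow> z \<in> D \<Longrightarrow> (f y has_derivative f' y z) (at z)"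
    "\<And>h. Cg k (m - c) (\<lambda>y z. f' y z h)"
  using assms unfolding graded_Ck.simps by blast

declare graded_Ck.simps(2) [simp del]

lemma Cg_cong:
  assumes "Cg k m f" "\<And>y z. y \<in> {0..1} \<Longrightarrow> z \<in> D \<Longrightarrow> f y z = g y z"
  shows "Cg k m g"
  using assms
proof (induction k arbitrary: m f g)
  case 0
  have "continuous_on ({0..1} \<times> D) (\<lambda>p. g (fst p) (snd p)) \<longleftrightarrow>
      continuous_on ({0..1} \<times> D) (\<lambda>p. f (fst p) (snd p))"
    using 0(2) by (intro continuous_on_cong) auto
  then show ?case using 0 bound_cong[of m f g] by auto
next
  case (Suc k)
  obtain f' where f': "\<And>y z. y \<in> {0..1} \<Longrightarrow> z \<in> D \<Longrightarrow> (f y has_derivative f' y z) (at z)"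
    "\<And>h. Cg k (m - c) (\<lambda>y z. f' y z h)"
    using Cg_SucE[OF Suc.prems(1)] by metis
  have "continuous_on ({0..1} \<times> D) (\<lambda>p. g (fst p) (snd p)) \<longleftrightarrow>
      continuous_on ({0..1} \<times> D) (\<lambda>p. f (fst p) (snd p))"
    using Suc.prems(2) by (intro continuous_on_cong) auto
  moreover have "(g y has_derivative f' y z) (at z)" if "y \<in> {0..1}" "z \<in> D" for y z
    using has_derivative_transform_within_open[OF f'(1)[OF that] open_D that(2), of "g y"] Suc.prems(2) that
    by auto
  moreover have "B m g" using Suc.prems bound_cong[of m f g] Cg_bound by blast
  moreover have "continuous_on ({0..1} \<times> D) (\<lambda>p. f (fst p) (snd p))"
    using Cg_continuous[OF Suc.prems(1)] .
  ultimately show ?case using f'(2) by (intro Cg_SucI[of g m f']) auto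
qed

lemma Cg_mono: "Cg k m f \<Longrightarrow> m' \<le> m \<Longrightarrow> Cg k m' f"
proof (induction k arbitrary: m m' f)
  case 0 then show ?case using bound_mono by auto
next
  case (Suc k)
  obtain f' where f': "\<And>y z. y \<in> {0..1} \<Longrightarrow> z \<in> D \<Longrightarrow> (f y has_derivative f' y z) (at z)"
    "\<And>h. Cg k (m - c) (\<lambda>y z. f' y z h)"
    using Cg_SucE[OF Suc.prems(1)] by metis
  have "Cg k (m' - c) (\<lambda>y z. f' y z h)" for h
    by (rule Suc.IH[OF f'(2)]) (use Suc.prems in auto)
  then show ?case
    using f'(1) Cg_continuous[OF Suc.prems(1)] bound_mono[OF Cg_bound[OF Suc.prems(1)] Suc.prems(2)]
    by (intro Cg_SucI[of f m' f']) auto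
qed

lemma Cg_Suc: "Cg (Suc k) m f \<Longrightarrow> Cg k m f"
proof (induction k arbitrary: m f)
  case 0 then show ?case using Cg_continuous Cg_bound by auto
next
  case (Suc k)
  obtain f' where f': "\<And>y z. y \<in> {0..1} \<Longrightarrow> z \<in> D \<Longrightarrow> (f y has_derivative f' y z) (at z)"
    "\<And>h. Cg (Suc k) (m - c) (\<lambda>y z. f' y z h)"
    using Cg_SucE[OF Suc.prems(1)] by metis
  show ?case
    by (rule Cg_SucI[of f m f']) (use f' Suc Cg_continuous Cg_bound in auto)
qed

lemma Cg_le: "Cg n m f \<Longrightarrow> k \<le> n \<Longrightarrow> Cg k m f"
  by (induction n) (auto simp: le_Suc_eq dest: Cg_Suc)

lemma Cg_const: "Cg k 0 (\<lambda>_ _. a)"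
proof (induction k arbitrary: a)
  case 0 then show ?case using bound_bounded[of "\<lambda>_ _. a" "\<bar>a\<bar>"] by auto
next
  case (Suc k)
  show ?case
    by (rule Cg_SucI[of _ _ "\<lambda>_ _ _. 0"])
      (use bound_bounded[of "\<lambda>_ _. a" "\<bar>a\<bar>"] Cg_mono[OF Suc.IH[of 0], of "- c"] loss_nonneg in auto)
qed

lemma Cg_time: "Cg k 0 (\<lambda>y _. y)"
proof -
  have b: "B 0 (\<lambda>y _. y)" by (rule bound_bounded[of _ 1]) auto
  show ?thesis
  proof (cases k)
    case 0 then show ?thesis using b by (auto intro!: continuous_intros)
  next
    case (Suc k')
    show ?thesis unfolding Suc
      by (rule Cg_SucI[of _ _ "\<lambda>_ _ _. 0"])
        (use b Cg_mono[OF Cg_const[of k' 0], of "- c"] loss_nonneg in \<open>auto intro!: continuous_intros\<close>)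
  qed
qed

text \<open>
  The derivative of a linear function is constant, of order \<open>0\<close>; this is admissible if \<open>m - c \<le> 0\<close>.
\<close>

lemma Cg_linear:
  assumes "bounded_linear g" "B m (\<lambda>_. g)" "m \<le> c"
  shows "Cg k m (\<lambda>_ z. g z)"
proof -
  have cont: "continuous_on ({0..1} \<times> D) (\<lambda>p. g (snd p))"
    by (intro bounded_linear.continuous_on[OF assms(1)] continuous_intros)
  show ?thesis
  proof (cases k)
    case 0 then show ?thesis using assms(2) cont by simp
  next
    case (Suc k')
    show ?thesis unfolding Suc
    proof (rule Cg_SucI[of _ _ "\<lambda>_ _. g"])
      show "Cg k' (m - c) (\<lambda>y z. g h)" for h
        by (rule Cg_mono[OF Cg_const]) (use assms(3) in simp)
    qed (use assms cont bounded_linear_imp_has_derivative in auto)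
  qed
qed

lemma Cg_add: "Cg k m f \<Longrightarrow> Cg k m g \<Longrightarrow> Cg k m (\<lambda>y z. f y z + g y z)"
proof (induction k arbitrary: m f g)
  case 0 then show ?case using bound_add[of m f g] by (auto intro!: continuous_intros)
next
  case (Suc k)
  obtain f' where f': "\<And>y z. y \<in> {0..1} \<Longrightarrow> z \<in> D \<Longrightarrow> (f y has_derivative f' y z) (at z)"
    "\<And>h. Cg k (m - c) (\<lambda>y z. f' y z h)"
    using Cg_SucE[OF Suc.prems(1)] by metis
  obtain g' where g': "\<And>y z. y \<in> {0..1} \<Longrightarrow> z \<in> D \<Longrightarrow> (g y has_derivative g' y z) (at z)"
    "\<And>h. Cg k (m - c) (\<lambda>y z. g' y z h)"
    using Cg_SucE[OF Suc.prems(2)] by metis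
  show ?case
    by (rule Cg_SucI[of _ _ "\<lambda>y z h. f' y z h + g' y z h"])
     (use f' g' Suc.prems[THEN Cg_continuous] Suc.prems[THEN Cg_bound] bound_add[of m f g] Suc.IH in \<open>auto intro!: continuous_intros has_derivative_add\<close>)
qed

lemma Cg_mult: "Cg k m f \<Longrightarrow> Cg k m' g \<Longrightarrow> Cg k (m + m') (\<lambda>y z. f y z * g y z)"
proof (induction k arbitrary: m m' f g)
  case 0 then show ?case using bound_mult[of m f m' g] by (auto intro!: continuous_intros)
next
  case (Suc k)
  obtain f' where f': "\<And>y z. y \<in> {0..1} \<Longrightarrow> z \<in> D \<Longrightarrow> (f y has_derivative f' y z) (at z)"
    "\<And>h. Cg k (m - c) (\<lambda>y z. f' y z h)"
    using Cg_SucE[OF Suc.prems(1)] by metis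
  obtain g' where g': "\<And>y z. y \<in> {0..1} \<Longrightarrow> z \<in> D \<Longrightarrow> (g y has_derivative g' y z) (at z)"
    "\<And>h. Cg k (m' - c) (\<lambda>y z. g' y z h)"
    using Cg_SucE[OF Suc.prems(2)] by metis
  have "Cg k (m + m' - c) (\<lambda>y z. f y z * g' y z h + f' y z h * g y z)" for h
  proof (rule Cg_add)
    have "Cg k (m + (m' - c)) (\<lambda>y z. f y z * g' y z h)"
      by (rule Suc.IH[OF Cg_Suc[OF Suc.prems(1)] g'(2)])
    then show "Cg k (m + m' - c) (\<lambda>y z. f y z * g' y z h)" by (simp add: algebra_simps)
    have "Cg k ((m - c) + m') (\<lambda>y z. f' y z h * g y z)"
      by (rule Suc.IH[OF f'(2) Cg_Suc[OF Suc.prems(2)]])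
    then show "Cg k (m + m' - c) (\<lambda>y z. f' y z h * g y z)" by (simp add: algebra_simps)
  qed
  then show ?case
    by (intro Cg_SucI[of _ _ "\<lambda>y z h. f y z * g' y z h + f' y z h * g y z"])
     (use f'(1) g'(1) Suc.prems[THEN Cg_continuous] Suc.prems[THEN Cg_bound] bound_mult[of m f m' g] in \<open>auto intro!: continuous_intros has_derivative_mult\<close>)
qed

lemma Cg_cmult: "Cg k m f \<Longrightarrow> Cg k m (\<lambda>y z. a * f y z)"
  using Cg_mult[OF Cg_const[of k a]] by simp

lemma Cg_power: "Cg k m f \<Longrightarrow> Cg k (real n * m) (\<lambda>y z. f y z ^ n)"
proof (induction n)
  case 0 then show ?case using Cg_const[of k 1] by simp
next
  case (Suc n)
  show ?case using Cg_mult[OF Suc.prems Suc.IH[OF Suc.prems]] by (simp add: algebra_simps)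
qed

lemma Cg_sum:
  assumes "finite I" "m \<le> 0 \<or> I \<noteq> {}" "\<And>i. i \<in> I \<Longrightarrow> Cg k m (f i)"
  shows "Cg k m (\<lambda>y z. \<Sum>i\<in>I. f i y z)"
proof (cases "I = {}")
  case True then show ?thesis using assms(2) Cg_mono[OF Cg_const[of k 0]] by auto
next
  case False
  show ?thesis using assms(1) False assms(3)
  proof (induction rule: finite_ne_induct)
    case (insert i I)
    then show ?case using Cg_add[of k m "f i"] by simp
  qed auto
qed

text \<open>
  The outer function is one of a sequence in which each is the derivative of the previous one, so
  that the induction on \<open>k\<close> stays within the sequence. The inner derivative must have the order
  \<open>- c\<close>: then differentiating the composite lowers the order by exactly the admissible loss,
  however often it is repeated. That is stronger than what membership of \<open>g\<close> in the class provides.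
\<close>

lemma Cg_chain:
  fixes e :: "nat \<Rightarrow> real \<Rightarrow> real"
  assumes e: "\<And>n x. (e n has_real_derivative e (Suc n) x) (at x)"
    and g: "continuous_on ({0..1} \<times> D) (\<lambda>p. g (fst p) (snd p))"
    and g': "\<And>y z. y \<in> {0..1} \<Longrightarrow> z \<in> D \<Longrightarrow> (g y has_derivative g' y z) (at z)"
      "\<And>h. Cg k (- c) (\<lambda>y z. g' y z h)"
    and b: "\<And>n. B m (\<lambda>y z. e n (g y z))"
  shows "Cg (Suc k) m (\<lambda>y z. e n (g y z))"
proof -
  have e_cont: "continuous_on ({0..1} \<times> D) (\<lambda>p. e n (g (fst p) (snd p)))" for n
    by (rule continuous_on_compose2[of UNIV "e n", OF _ g])
      (auto intro!: continuous_at_imp_continuous_on DERIV_isCont e)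
  have e_der: "((\<lambda>z. e n (g y z)) has_derivative (\<lambda>h. e (Suc n) (g y z) * g' y z h)) (at z)"
    if "y \<in> {0..1}" "z \<in> D" for y z n
    using has_derivative_compose[OF g'(1)[OF that] e[unfolded has_field_derivative_def], of n] by simp
  have "j \<le> Suc k \<Longrightarrow> Cg j m (\<lambda>y z. e n (g y z))" for j
  proof (induction j arbitrary: n)
    case 0 then show ?case using e_cont b by auto
  next
    case (Suc j)
    show ?case
    proof (rule Cg_SucI[OF e_cont b e_der])
      fix h
      have "Cg j (- c) (\<lambda>y z. g' y z h)" using Cg_le[OF g'(2)] Suc.prems by auto
      then show "Cg j (m - c) (\<lambda>y z. e (Suc n) (g y z) * g' y z h)"
        using Cg_mult[OF Suc.IH[of "Suc n"], of "- c"] Suc.prems by simp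
    qed
  qed
  then show ?thesis by auto
qed

end

lemma graded_Ck_loss_mono:
  assumes gb: "graded_bound D B c'" and "c \<le> c'"
  shows "graded_Ck B c D k m f \<Longrightarrow> graded_Ck B c' D k m f"
proof (induction k arbitrary: m f)
  case (Suc k)
  then obtain f' where f': "\<And>y z. y \<in> {0..1} \<Longrightarrow> z \<in> D \<Longrightarrow> (f y has_derivative f' y z) (at z)"
    "\<And>h. graded_Ck B c D k (m - c) (\<lambda>y z. f' y z h)"
    unfolding graded_Ck.simps by blast
  have "graded_Ck B c' D k (m - c') (\<lambda>y z. f' y z h)" for h
    using graded_bound.Cg_mono[OF gb Suc.IH[OF f'(2)], of "m - c'"] assms(2) by auto
  then show ?case using Suc.prems f'(1) unfolding graded_Ck.simps by blast
qed auto

section \<open>Parameter dependence of class \<open>C\<^sup>k\<close>\<close>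

abbreviation param_Ck :: "'b::euclidean_space set \<Rightarrow> nat \<Rightarrow> (real \<Rightarrow> 'b \<Rightarrow> real) \<Rightarrow> bool" where
  "param_Ck D k f \<equiv> graded_Ck (\<lambda>_ _. True) 0 D k 0 f"

lemma graded_bound_trivial: "open D \<Longrightarrow> graded_bound D (\<lambda>_ _. True) 0"
  by unfold_locales auto

lemma param_Ck_0: "param_Ck D 0 f \<longleftrightarrow> continuous_on ({0..1} \<times> D) (\<lambda>p. f (fst p) (snd p))"
  by simp

lemma param_Ck_SucE:
  assumes "param_Ck D (Suc k) f"
  obtains f' where "\<And>y z. y \<in> {0..1} \<Longrightarrow> z \<in> D \<Longrightarrow> (f y has_derivative f' y z) (at z)"
    "\<And>h. param_Ck D k (\<lambda>y z. f' y z h)"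
  using assms unfolding graded_Ck.simps diff_zero by blast

lemma param_Ck_SucI:
  assumes "continuous_on ({0..1} \<times> D) (\<lambda>p. f (fst p) (snd p))"
    "\<And>y z. y \<in> {0..1} \<Longrightarrow> z \<in> D \<Longrightarrow> (f y has_derivative f' y z) (at z)"
    "\<And>h. param_Ck D k (\<lambda>y z. f' y z h)"
  shows "param_Ck D (Suc k) f"
  unfolding graded_Ck.simps diff_zero using assms by blast

lemma param_Ck_continuous: "param_Ck D k f \<Longrightarrow> continuous_on ({0..1} \<times> D) (\<lambda>p. f (fst p) (snd p))"
  by (cases k) auto

lemma param_Ck_continuous_time:
  assumes "param_Ck D k f" "z \<in> D" "S \<subseteq> {0..1}"
  shows "continuous_on S (\<lambda>y. f y z)"
  by (rule continuous_on_compose2[OF param_Ck_continuous[OF assms(1)], of S "\<lambda>y. (y, z)", simplified])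
    (use assms in \<open>auto intro!: continuous_intros\<close>)

lemma param_Ck_Suc: "open D \<Longrightarrow> param_Ck D (Suc k) f \<Longrightarrow> param_Ck D k f"
  using graded_bound.Cg_Suc[OF graded_bound_trivial] by blast

lemma param_Ck_mult: "open D \<Longrightarrow> param_Ck D k f \<Longrightarrow> param_Ck D k g \<Longrightarrow> param_Ck D k (\<lambda>y z. f y z * g y z)"
  using graded_bound.Cg_mult[OF graded_bound_trivial, of D k 0 f 0 g] by simp

lemma param_Ck_add: "open D \<Longrightarrow> param_Ck D k f \<Longrightarrow> param_Ck D k g \<Longrightarrow> param_Ck D k (\<lambda>y z. f y z + g y z)"
  using graded_bound.Cg_add[OF graded_bound_trivial] by blast

lemma param_Ck_exp:
  assumes "open D" "param_Ck D k f"
  shows "param_Ck D k (\<lambda>y z. exp (f y z))"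
proof (cases k)
  case 0
  then show ?thesis using assms by (auto intro!: continuous_intros)
next
  case (Suc j)
  obtain f' where f': "\<And>y z. y \<in> {0..1} \<Longrightarrow> z \<in> D \<Longrightarrow> (f y has_derivative f' y z) (at z)"
    "\<And>h. param_Ck D j (\<lambda>y z. f' y z h)"
    using param_Ck_SucE[OF assms(2)[unfolded Suc]] by metis
  show ?thesis unfolding Suc
    by (rule graded_bound.Cg_chain[OF graded_bound_trivial[OF assms(1)], of "\<lambda>_. exp" f f'])
      (use f' param_Ck_continuous[OF assms(2)] in \<open>auto intro!: DERIV_exp\<close>)
qed

text \<open>
  The inner derivative splits along the two directions \<open>(1, 0)\<close> and \<open>(0, h)\<close>, and the partial
  derivatives of \<open>H\<close> along the curve are again compositions of this form.
\<close>

lemma param_Ck_compose: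
  fixes H :: "real \<Rightarrow> real \<times> 'b::euclidean_space \<Rightarrow> real"
  assumes "open D" "param_Ck D k \<phi>" "\<And>y z. y \<in> {0..1} \<Longrightarrow> z \<in> D \<Longrightarrow> (\<phi> y z, z) \<in> U"
    and "param_Ck U k H"
  shows "param_Ck D k (\<lambda>y z. H y (\<phi> y z, z))"
  using assms(2,4)
proof (induction k arbitrary: H)
  case 0
  have "continuous_on ({0..1} \<times> D) (\<lambda>p. H (fst (fst p, (\<phi> (fst p) (snd p), snd p))) (snd (fst p, (\<phi> (fst p) (snd p), snd p))))"
    by (rule continuous_on_compose2[OF param_Ck_continuous[OF 0(2)]])
     (use 0 assms(3) in \<open>auto intro!: continuous_intros\<close>)
  then show ?case by simp
next
  case (Suc k)
  note Suc' = param_Ck_Suc[OF assms(1) Suc.prems(1)]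
  obtain H' where H': "\<And>y z. y \<in> {0..1} \<Longrightarrow> z \<in> U \<Longrightarrow> (H y has_derivative H' y z) (at z)"
    "\<And>h. param_Ck U k (\<lambda>y z. H' y z h)"
    using param_Ck_SucE[OF Suc.prems(2)] by metis
  obtain p' where p': "\<And>y z. y \<in> {0..1} \<Longrightarrow> z \<in> D \<Longrightarrow> (\<phi> y has_derivative p' y z) (at z)"
    "\<And>h. param_Ck D k (\<lambda>y z. p' y z h)"
    using param_Ck_SucE[OF Suc.prems(1)] by metis
  have "continuous_on ({0..1} \<times> D) (\<lambda>p. H (fst (fst p, (\<phi> (fst p) (snd p), snd p))) (snd (fst p, (\<phi> (fst p) (snd p), snd p))))"
    by (rule continuous_on_compose2[OF param_Ck_continuous[OF Suc.prems(2)]])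
     (use param_Ck_continuous[OF Suc.prems(1)] assms(3) in \<open>auto intro!: continuous_intros\<close>)
  then have cont: "continuous_on ({0..1} \<times> D) (\<lambda>p. H (fst p) (\<phi> (fst p) (snd p), snd p))" by simp
  show ?case
  proof (rule param_Ck_SucI[OF cont])
    fix y z assume yz: "y \<in> {0..(1::real)}" "z \<in> D"
    have H1: "(H y has_derivative H' y (\<phi> y z, z)) (at (\<phi> y z, z))"
      using H'(1) assms(3) yz by blast
    then have lin: "linear (H' y (\<phi> y z, z))" using has_derivative_linear by blast
    have der: "((\<lambda>w. H y (\<phi> y w, w)) has_derivative (\<lambda>h. H' y (\<phi> y z, z) (p' y z h, h))) (at z)"
      by (rule has_derivative_compose[where f = "\<lambda>w. (\<phi> y w, w)" and g = "H y", OF _ H1]) (intro has_derivative_Pair p'(1) yz has_derivative_ident)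
    have "H' y (\<phi> y z, z) (a, h) = a * H' y (\<phi> y z, z) (1, 0) + H' y (\<phi> y z, z) (0, h)" for a h
      using linear_add[OF lin, of "a *\<^sub>R (1, 0)" "(0, h)"] linear_scale[OF lin, of a "(1,0)"] by simp
    then have eq: "(\<lambda>h. H' y (\<phi> y z, z) (p' y z h, h)) =
        (\<lambda>h. p' y z h * H' y (\<phi> y z, z) (1, 0) + H' y (\<phi> y z, z) (0, h))" by (intro ext)
    show "((\<lambda>w. H y (\<phi> y w, w)) has_derivative
        (\<lambda>h. p' y z h * H' y (\<phi> y z, z) (1, 0) + H' y (\<phi> y z, z) (0, h))) (at z)"
      using der unfolding eq .
  next
    fix h
    show "param_Ck D k (\<lambda>y z. p' y z h * H' y (\<phi> y z, z) (1, 0) + H' y (\<phi> y z, z) (0, h))"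
      by (intro param_Ck_add param_Ck_mult assms(1) p' Suc.IH H' Suc')
  qed
qed

text \<open>
  On the fixed interval the integral depends continuously on its upper limit and on parameters together.
\<close>

lemma integral_initial_stretch:
  fixes f :: "real \<Rightarrow> real"
  assumes "0 \<le> y" "continuous_on {0..y} f"
  shows "integral {0..y} f = y * integral {0..1} (\<lambda>s. f (y * s))"
proof (cases "y = 0")
  case False
  then have y: "y > 0" using assms by simp
  have "(f has_integral integral {0..y} f) (cbox 0 y)"
    using integrable_integral[OF integrable_continuous_interval[OF assms(2)]] by simp
  from has_integral_affinity'[OF this, of y 0] y
  have "((\<lambda>s. f (y * s)) has_integral (integral {0..y} f / y)) {0..1}"
    by (simp add: divide_inverse mult.commute)
  then show ?thesis using y by (simp add: integral_unique)
qed auto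

lemma param_Ck_integral:
  assumes "open D" "param_Ck D k f"
  shows "param_Ck D k (\<lambda>y z. integral {0..y} (\<lambda>t. f t z))"
  using assms(2)
proof (induction k arbitrary: f)
  case 0
  have "continuous_on (({0..1} \<times> D) \<times> cbox 0 1)
      (\<lambda>q. f (fst (fst (fst q) * snd q, snd (fst q))) (snd (fst (fst q) * snd q, snd (fst q))))"
    by (rule continuous_on_compose2[OF param_Ck_continuous[OF 0]])
      (auto intro!: continuous_intros simp: mult_le_one)
  then have "continuous_on ({0..1} \<times> D) (\<lambda>p. integral (cbox 0 1) (\<lambda>s. f (fst p * s) (snd p)))"
    by (intro integral_continuous_on_param) (simp add: case_prod_beta)
  then have *: "continuous_on ({0..1} \<times> D) (\<lambda>p. fst p * integral {0..1} (\<lambda>s. f (fst p * s) (snd p)))"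
    by (auto intro!: continuous_intros)
  have "continuous_on ({0..1} \<times> D) (\<lambda>p. integral {0..fst p} (\<lambda>t. f t (snd p)))"
    by (rule continuous_on_cong[THEN iffD1, OF refl _ *], rule integral_initial_stretch[symmetric])
     (use param_Ck_continuous_time[OF 0] in auto)
  then show ?case by simp
next
  case (Suc k)
  obtain f' where f': "\<And>y z. y \<in> {0..1} \<Longrightarrow> z \<in> D \<Longrightarrow> (f y has_derivative f' y z) (at z)"
    "\<And>h. param_Ck D k (\<lambda>y z. f' y z h)"
    using param_Ck_SucE[OF Suc.prems(1)] by metis
  have bl: "bounded_linear (f' y z)" if "y \<in> {0..1}" "z \<in> D" for y z
    using f'(1)[OF that] has_derivative_bounded_linear by blast
  have cont: "continuous_on ({0..1} \<times> D) (\<lambda>p. integral {0..fst p} (\<lambda>t. f t (snd p)))"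
    using Suc.IH[OF param_Ck_Suc[OF assms(1) Suc.prems]] param_Ck_continuous by blast
  show ?case
  proof (rule param_Ck_SucI[OF cont])
    fix y z assume y: "y \<in> {0..(1::real)}" and z: "z \<in> D"
    obtain e where e: "e > 0" "ball z e \<subseteq> D" using assms(1) z open_contains_ball by blast
    define fx where "fx = (\<lambda>x t. Blinfun (f' t x))"
    have fx: "blinfun_apply (fx x t) = f' t x" if "x \<in> ball z e" "t \<in> {0..y}" for x t
      unfolding fx_def by (rule bounded_linear_Blinfun_apply, rule bl) (use that y e in auto)
    have cfx: "continuous_on (ball z e \<times> cbox 0 y) (\<lambda>(x, t). fx x t)"
    proof (rule continuous_on_blinfun_componentwise)
      fix i :: 'a
      have "continuous_on (ball z e \<times> cbox 0 y) (\<lambda>p. f' (fst (snd p, fst p)) (snd (snd p, fst p)) i)"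
        by (rule continuous_on_compose2[OF param_Ck_continuous[OF f'(2)]])
          (use y e in \<open>auto intro!: continuous_intros\<close>)
      then show "continuous_on (ball z e \<times> cbox 0 y) (\<lambda>p. (case p of (x, t) \<Rightarrow> fx x t) i)"
      proof (rule continuous_on_eq)
        fix p assume "p \<in> ball z e \<times> cbox 0 y"
        then have "fst p \<in> ball z e" "snd p \<in> {0..y}" by (auto simp: mem_Times_iff)
        from fx[OF this] show "f' (fst (snd p, fst p)) (snd (snd p, fst p)) i = (case p of (x, t) \<Rightarrow> fx x t) i"
          by (simp only: case_prod_beta fst_conv snd_conv)
      qed
    qed
    have "((\<lambda>x. integral (cbox 0 y) (\<lambda>t. f t x)) has_derivative integral (cbox 0 y) (fx z)) (at z within ball z e)"
    proof (rule leibniz_rule[OF _ _ cfx])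
      fix x t assume x: "x \<in> ball z e" and t: "t \<in> cbox 0 y"
      have "(f t has_derivative f' t x) (at x)"
        by (rule f'(1)) (use x t y e in auto)
      moreover have "t \<in> {0..y}" using t by simp
      ultimately show "((\<lambda>x. f t x) has_derivative blinfun_apply (fx x t)) (at x within ball z e)"
        by (simp only: fx[OF x] has_derivative_at_withinI)
    next
      fix x assume "x \<in> ball z e"
      then show "(\<lambda>t. f t x) integrable_on cbox 0 y"
        unfolding cbox_interval
        by (intro integrable_continuous_interval param_Ck_continuous_time[OF Suc.prems]) (use e y in auto)
    qed (use e in auto)
    moreover
    have "integral (cbox 0 y) (fx z) h = integral {0..y} (\<lambda>t. f' t z h)" for h
    proof -
      have "continuous_on (cbox 0 y) (\<lambda>t. case (z, t) of (x, t) \<Rightarrow> fx x t)"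
        by (rule continuous_on_compose2[OF cfx]) (use e in \<open>auto intro!: continuous_intros\<close>)
      then have "fx z integrable_on cbox 0 y" by (intro integrable_continuous) simp
      then have "integral (cbox 0 y) (fx z) h = integral (cbox 0 y) (\<lambda>t. fx z t h)"
        by (rule blinfun_apply_integral)
      also have "\<dots> = integral {0..y} (\<lambda>t. f' t z h)"
        unfolding cbox_interval by (rule integral_cong) (use e fx in auto)
      finally show ?thesis .
    qed
    then have "blinfun_apply (integral (cbox 0 y) (fx z)) = (\<lambda>h. integral {0..y} (\<lambda>t. f' t z h))" by blast
    ultimately show "((\<lambda>z. integral {0..y} (\<lambda>t. f t z)) has_derivative (\<lambda>h. integral {0..y} (\<lambda>t. f' t z h))) (at z)"
      using e(1) by (simp add: at_within_open[of z "ball z e"])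
  next
    fix h
    show "param_Ck D k (\<lambda>y z. integral {0..y} (\<lambda>t. f' t z h))"
      by (rule Suc.IH[OF f'(2)])
  qed
qed

text \<open>
  The square of \<open>e\<close> is differentiable, unlike its absolute value, and
  \<open>2 e e' \<le> (2 L + 1) e\<^sup>2 + R\<^sup>2\<close>; so \<open>e\<^sup>2 exp (- (2 L + 1) t) - R\<^sup>2 t\<close> is decreasing.
\<close>

lemma gronwall:
  fixes e e' :: "real \<Rightarrow> real"
  assumes der: "\<And>s. s \<in> {0..T} \<Longrightarrow> (e has_real_derivative e' s) (at s within {0..T})"
    and bnd: "\<And>s. s \<in> {0..T} \<Longrightarrow> \<bar>e' s\<bar> \<le> L * \<bar>e s\<bar> + R"
    and "0 \<le> L" "0 \<le> R" "e 0 = 0" "t \<in> {0..T}"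
  shows "(e t)\<^sup>2 \<le> R\<^sup>2 * t * exp ((2 * L + 1) * t)"
proof -
  define K where "K = 2 * L + 1"
  define g where "g = (\<lambda>s. (e s)\<^sup>2 * exp (- K * s) - R\<^sup>2 * s)"
  define g' where "g' = (\<lambda>s. (2 * e s * e' s - K * (e s)\<^sup>2) * exp (- K * s) - R\<^sup>2)"
  have "(g has_real_derivative g' s) (at s within {0..t})" if "s \<in> {0..t}" for s
  proof -
    have "(e has_real_derivative e' s) (at s within {0..t})"
      using der[of s] that assms(6) by (auto intro: has_field_derivative_subset)
    then show ?thesis unfolding g_def g'_def
      by (auto intro!: derivative_eq_intros simp: algebra_simps power2_eq_square)
  qed
  then have "\<exists>x\<in>{0..t}. g t - g 0 = g' x * (t - 0)"
    using mvt_very_simple[of 0 t g "\<lambda>s h. g' s * h"] assms(6) by (auto simp: has_field_derivative_def)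
  then obtain x where x: "x \<in> {0..t}" "g t - g 0 = g' x * t" by auto
  have "\<bar>2 * e x * e' x\<bar> \<le> 2 * \<bar>e x\<bar> * (L * \<bar>e x\<bar> + R)"
    using mult_left_mono[OF bnd[of x], of "2 * \<bar>e x\<bar>"] x assms(6) by (auto simp: abs_mult)
  also have "\<dots> = 2 * L * (e x)\<^sup>2 + 2 * \<bar>e x\<bar> * R" by (simp add: algebra_simps power2_eq_square)
  also have "\<dots> \<le> 2 * L * (e x)\<^sup>2 + ((e x)\<^sup>2 + R\<^sup>2)"
    using sum_squares_bound[of "\<bar>e x\<bar>" R] by simp
  finally have "2 * e x * e' x - K * (e x)\<^sup>2 \<le> R\<^sup>2" by (simp add: K_def algebra_simps)
  moreover have "0 \<le> K * x" using x assms by (auto simp: K_def)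
  ultimately have "(2 * e x * e' x - K * (e x)\<^sup>2) * exp (- K * x) \<le> R\<^sup>2 * 1"
    by (intro mult_mono'[of _ "R\<^sup>2"] order.trans[OF mult_right_mono mult_left_mono]) auto
  then have "g' x * t \<le> 0" using x by (auto simp: g'_def intro!: mult_nonpos_nonneg)
  then have "g t \<le> 0" using x assms by (simp add: g_def)
  then have "(e t)\<^sup>2 * exp (- K * t) \<le> R\<^sup>2 * t" by (simp add: g_def)
  then have "(e t)\<^sup>2 * exp (- K * t) * exp (K * t) \<le> R\<^sup>2 * t * exp (K * t)"
    by (intro mult_right_mono) auto
  moreover have "exp (- K * t) * exp (K * t) = 1" by (simp flip: exp_add)
  ultimately show ?thesis unfolding K_def[symmetric] by (simp only: mult.assoc mult_1_right)
qed

lemma gronwall_unit: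
  fixes e e' :: "real \<Rightarrow> real"
  assumes der: "\<And>s. s \<in> {0..1} \<Longrightarrow> (e has_real_derivative e' s) (at s within {0..1})"
    and bnd: "\<And>s. s \<in> {0..1} \<Longrightarrow> \<bar>e' s\<bar> \<le> L * \<bar>e s\<bar> + R"
    and "0 \<le> L" "0 \<le> R" "e 0 = 0" "t \<in> {0..1}"
  shows "\<bar>e t\<bar> \<le> R * exp (L + 1)"
proof -
  have "(2 * L + 1) * t \<le> (2 * L + 1) * 1" using assms by (intro mult_left_mono) auto
  then have "exp ((2 * L + 1) * t) \<le> exp (2 * (L + 1))" by simp
  then have "R\<^sup>2 * t * exp ((2 * L + 1) * t) \<le> R\<^sup>2 * 1 * exp (2 * (L + 1))"
    using assms by (intro mult_mono) auto
  also have "\<dots> = (R * exp (L + 1))\<^sup>2" by (simp only: power_mult_distrib exp_double mult_1_right)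
  finally have "(e t)\<^sup>2 \<le> (R * exp (L + 1))\<^sup>2"
    using gronwall[OF der bnd assms(3-6)] by auto
  then have "\<bar>e t\<bar> \<le> \<bar>R * exp (L + 1)\<bar>" by (simp only: abs_le_square_iff)
  then show ?thesis using assms(4) by (simp add: abs_mult)
qed

text \<open>
  Pointwise differentiability with continuous derivative becomes uniform near the compact graph of
  a curve: the mean value inequality bounds the error by the oscillation of the derivative.
\<close>

lemma uniformly_differentiable_along_curve:
  fixes H :: "real \<Rightarrow> 'c::euclidean_space \<Rightarrow> real"
  assumes "open U"
    and der: "\<And>y z. y \<in> {0..1} \<Longrightarrow> z \<in> U \<Longrightarrow> (H y has_derivative H' y z) (at z)"
    and cont: "\<And>h. continuous_on ({0..1} \<times> U) (\<lambda>p. H' (fst p) (snd p) h)"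
    and curve: "continuous_on {0..1} \<zeta>" "\<And>y. y \<in> {0..1} \<Longrightarrow> \<zeta> y \<in> U"
    and "0 < \<eta>"
  obtains \<delta> where "0 < \<delta>" "\<And>y z. y \<in> {0..1} \<Longrightarrow> norm (z - \<zeta> y) < \<delta> \<Longrightarrow>
      z \<in> U \<and> \<bar>H y z - H y (\<zeta> y) - H' y (\<zeta> y) (z - \<zeta> y)\<bar> \<le> \<eta> * norm (z - \<zeta> y)"
proof -
  have "compact (\<zeta> ` {0..1})" "\<zeta> ` {0..1} \<subseteq> U"
    using compact_continuous_image[OF curve(1)] curve(2) by auto
  from compact_subset_open_imp_ball_epsilon_subset[OF this(1) assms(1) this(2)]
  obtain d where d: "d > 0" "(\<Union>x\<in>\<zeta> ` {0..1}. ball x d) \<subseteq> U" .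
  \<comment> \<open>The operator norm is estimated by the sum over a basis, which has \<open>DIM('c)\<close> elements.\<close>
  define e where "e = \<eta> / real DIM('c)"
  have e: "e > 0" using \<open>0 < \<eta>\<close> by (simp add: e_def)
  have "\<exists>X. 0 \<in> X \<and> open X \<and> (\<forall>w\<in>X \<inter> ball 0 d. \<forall>y\<in>{0..1}. \<bar>H' y (\<zeta> y + w) b - H' y (\<zeta> y) b\<bar> \<le> e)" for b
  proof -
    have "continuous_on (ball 0 d \<times> {0..1}) (\<lambda>p. H' (fst (snd p, \<zeta> (snd p) + fst p)) (snd (snd p, \<zeta> (snd p) + fst p)) b)"
    proof (rule continuous_on_compose2[OF cont])
      show "continuous_on (ball 0 d \<times> {0..1}) (\<lambda>p. (snd p, \<zeta> (snd p) + fst p))"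
        by (intro continuous_intros continuous_on_compose2[OF curve(1)]) auto
      show "(\<lambda>p. (snd p, \<zeta> (snd p) + fst p)) ` (ball 0 d \<times> {0..1}) \<subseteq> {0..1} \<times> U"
        using d(2) by (force simp: dist_norm)
    qed
    from continuous_on_prod_compactE[OF this compact_Icc _ e, of 0] d(1)
    obtain X0 where "0 \<in> X0" "open X0"
      "\<forall>x\<in>X0 \<inter> ball 0 d. \<forall>t\<in>{0..1}. dist (H' t (\<zeta> t + x) b) (H' t (\<zeta> t + 0) b) \<le> e"
      unfolding fst_conv snd_conv by auto
    then show ?thesis by (intro exI[of _ X0]) (simp add: dist_real_def)
  qed
  then obtain X where X: "\<And>b. 0 \<in> X b" "\<And>b. open (X b)"
    "\<And>b w y. w \<in> X b \<Longrightarrow> w \<in> ball 0 d \<Longrightarrow> y \<in> {0..1} \<Longrightarrow> \<bar>H' y (\<zeta> y + w) b - H' y (\<zeta> y) b\<bar> \<le> e"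
    by (metis IntI)
  have "open (\<Inter>b\<in>Basis. X b)" "0 \<in> (\<Inter>b\<in>Basis. X b)" using X by auto
  then obtain r where r: "r > 0" "ball 0 r \<subseteq> (\<Inter>b\<in>Basis. X b)"
    using open_contains_ball by blast
  define \<delta> where "\<delta> = min d r"
  have "z \<in> U \<and> \<bar>H y z - H y (\<zeta> y) - H' y (\<zeta> y) (z - \<zeta> y)\<bar> \<le> \<eta> * norm (z - \<zeta> y)"
    if y: "y \<in> {0..1}" and z: "norm (z - \<zeta> y) < \<delta>" for y z
  proof -
    have ballU: "w \<in> U" if "w \<in> ball (\<zeta> y) \<delta>" for w
    proof -
      have "w \<in> ball (\<zeta> y) d" using that by (simp add: \<delta>_def)
      then show ?thesis using d(2) y by blast
    qed
    have lin: "bounded_linear (H' y w)" if "w \<in> U" for w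
      using der[OF y that] has_derivative_bounded_linear by blast
    define f where "f = (\<lambda>w. H y w - H' y (\<zeta> y) w)"
    define f' where "f' = (\<lambda>w h. H' y w h - H' y (\<zeta> y) h)"
    have "norm (f z - f (\<zeta> y)) \<le> \<eta> * norm (z - \<zeta> y)"
    proof (rule differentiable_bound[of "ball (\<zeta> y) \<delta>" f f'])
      fix w assume w: "w \<in> ball (\<zeta> y) \<delta>"
      show "(f has_derivative f' w) (at w within ball (\<zeta> y) \<delta>)"
        unfolding f_def f'_def
        by (rule has_derivative_diff[OF has_derivative_at_withinI[OF der[OF y ballU[OF w]]]
              bounded_linear_imp_has_derivative[OF lin[OF curve(2)[OF y]]]])
      have blf: "linear (f' w)"
        unfolding f'_def
        by (intro bounded_linear.linear bounded_linear_sub lin ballU w curve(2) y)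
      show "onorm (f' w) \<le> \<eta>"
      proof (rule onorm_le)
        fix h
        have "f' w h = f' w (\<Sum>b\<in>Basis. (h \<bullet> b) *\<^sub>R b)" by (simp add: euclidean_representation)
        also have "\<dots> = (\<Sum>b\<in>Basis. (h \<bullet> b) * f' w b)"
          unfolding linear_sum[OF blf] linear_scale[OF blf] by simp
        finally have "\<bar>f' w h\<bar> \<le> (\<Sum>b\<in>Basis. \<bar>(h \<bullet> b) * f' w b\<bar>)" by (simp only: sum_abs)
        also have "\<dots> \<le> (\<Sum>b\<in>(Basis :: 'c set). norm h * e)"
        proof (rule sum_mono)
          fix b :: 'c assume b: "b \<in> Basis"
          have "w - \<zeta> y \<in> X b" "w - \<zeta> y \<in> ball 0 d"
            using w r(2) b by (auto simp: \<delta>_def dist_norm norm_minus_commute)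
          from X(3)[OF this y] have "\<bar>f' w b\<bar> \<le> e" by (simp add: f'_def)
          then show "\<bar>(h \<bullet> b) * f' w b\<bar> \<le> norm h * e"
            unfolding abs_mult using Basis_le_norm[OF b, of h] by (intro mult_mono) auto
        qed
        also have "\<dots> = \<eta> * norm h" by (simp add: e_def)
        finally show "norm (f' w h) \<le> \<eta> * norm h" by simp
      qed
    qed (use z r(1) d(1) in \<open>simp_all add: \<delta>_def dist_norm norm_minus_commute\<close>)
    moreover have "f z - f (\<zeta> y) = H y z - H y (\<zeta> y) - H' y (\<zeta> y) (z - \<zeta> y)"
      using linear_diff[OF bounded_linear.linear[OF lin[OF curve(2)[OF y]]], of z "\<zeta> y"] by (simp add: f_def)
    moreover have "z \<in> U" using ballU[of z] z by (simp add: dist_norm norm_minus_commute)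
    ultimately show ?thesis by simp
  qed
  moreover have "\<delta> > 0" using d(1) r(1) by (simp add: \<delta>_def)
  ultimately show ?thesis using that by blast
qed

section \<open>A scalar differential equation with parameters\<close>

definition solves_on_unit :: "'b::euclidean_space set \<Rightarrow> (real \<Rightarrow> real \<times> 'b \<Rightarrow> real) \<Rightarrow> (real \<Rightarrow> 'b \<Rightarrow> real) \<Rightarrow> bool" where
  "solves_on_unit D H \<phi> \<longleftrightarrow> (\<forall>z\<in>D. \<phi> 0 z = 0 \<and> (\<forall>y\<in>{0..1}. \<bar>\<phi> y z\<bar> \<le> 1 / 2 \<and>
     ((\<lambda>t. \<phi> t z) has_real_derivative H y (\<phi> y z, z)) (at y within {0..1})))"

text \<open>
  The unit interval, values bounded by \<open>1/2\<close> and the Lipschitz constant \<open>1/2\<close> make the Picard operator a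
  contraction by \<open>1/2\<close> on functions bounded by \<open>1/2\<close>, and its iterates converge on the whole interval at once.
\<close>

definition half_contraction :: "'b::euclidean_space set \<Rightarrow> (real \<Rightarrow> real \<times> 'b \<Rightarrow> real) \<Rightarrow> bool" where
  "half_contraction D H \<longleftrightarrow> (\<forall>y\<in>{0..1}. \<forall>z\<in>D. \<forall>a\<in>{-1<..<1}. \<bar>H y (a, z)\<bar> \<le> 1 / 2 \<and>
     (\<forall>b\<in>{-1<..<1}. \<bar>H y (a, z) - H y (b, z)\<bar> \<le> \<bar>a - b\<bar> / 2))"

lemma integral_initial_abs_le:
  fixes f :: "real \<Rightarrow> real"
  assumes "continuous_on {0..y} f" "\<And>t. t \<in> {0..y} \<Longrightarrow> \<bar>f t\<bar> \<le> K" "y \<in> {0..1}" "0 \<le> K"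
  shows "\<bar>integral {0..y} f\<bar> \<le> K"
proof -
  have "norm (integral {0..y} f) \<le> K * (y - 0)"
    by (rule integral_bound) (use assms in auto)
  also have "\<dots> \<le> K * 1" using assms by (intro mult_left_mono) auto
  finally show ?thesis by simp
qed

text \<open>
  The Picard iterates are jointly continuous in time and parameter and converge geometrically, uniformly
  on the whole domain; hence so is the limit.
\<close>

lemma solution_exists:
  fixes H :: "real \<Rightarrow> real \<times> 'b::euclidean_space \<Rightarrow> real"
  assumes "open D" and H: "param_Ck ({-1<..<1} \<times> D) 0 H" and hc: "half_contraction D H"
  obtains \<phi> where "solves_on_unit D H \<phi>" "param_Ck D 0 \<phi>"
proof -
  define P where "P = rec_nat (\<lambda>_ _. 0 :: real) (\<lambda>_ g y z. integral {0..y} (\<lambda>t. H t (g t (z::'b), z)))"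
  have P0: "P 0 = (\<lambda>_ _. 0)" and PS: "P (Suc n) y z = integral {0..y} (\<lambda>t. H t (P n t z, z))" for n y z
    by (simp_all add: P_def)
  have small: "a \<in> {-1<..<1}" if "\<bar>a\<bar> \<le> 1 / 2" for a :: real using that by auto
  have bH: "\<bar>H y (a, z)\<bar> \<le> 1 / 2" if "y \<in> {0..1}" "z \<in> D" "\<bar>a\<bar> \<le> 1 / 2" for y z a
    using hc that(1,2) small[OF that(3)] unfolding half_contraction_def by blast
  have lH: "\<bar>H y (a, z) - H y (b, z)\<bar> \<le> \<bar>a - b\<bar> / 2" if "y \<in> {0..1}" "z \<in> D" "\<bar>a\<bar> \<le> 1 / 2" "\<bar>b\<bar> \<le> 1 / 2" for y z a b
    using hc that(1,2) small[OF that(3)] small[OF that(4)] unfolding half_contraction_def by blast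
  have cH: "continuous_on {0..y} (\<lambda>t. H t (g t z, z))"
    if "param_Ck D 0 g" "\<And>y z. y \<in> {0..1} \<Longrightarrow> z \<in> D \<Longrightarrow> \<bar>g y z\<bar> \<le> 1 / 2" "y \<in> {0..1}" "z \<in> D" for g y z
    by (rule param_Ck_continuous_time[OF param_Ck_compose[OF assms(1) that(1) _ H]])
      (use that in \<open>fastforce simp: abs_le_iff\<close>)+
  have P: "param_Ck D 0 (P n) \<and> (\<forall>y\<in>{0..1}. \<forall>z\<in>D. \<bar>P n y z\<bar> \<le> 1 / 2)" for n
  proof (induction n)
    case (Suc n)
    have "param_Ck D 0 (\<lambda>y z. integral {0..y} (\<lambda>t. H t (P n t z, z)))"
      by (rule param_Ck_integral[OF assms(1)], rule param_Ck_compose[OF assms(1) _ _ H])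
        (use Suc in \<open>fastforce simp: abs_le_iff\<close>)+
    moreover have "\<bar>P (Suc n) y z\<bar> \<le> 1 / 2" if "y \<in> {0..1}" "z \<in> D" for y z
      unfolding PS by (rule integral_initial_abs_le) (use Suc cH[of "P n" y z] bH that in auto)
    ultimately show ?case by (simp only: PS[abs_def]) (auto simp: PS)
  qed (simp add: P0)
  have cP: "continuous_on {0..y} (\<lambda>t. H t (P n t z, z))" if "y \<in> {0..1}" "z \<in> D" for n y z
    using cH P that by blast
  have step: "\<bar>P (Suc n) y z - integral {0..y} (\<lambda>t. H t (g t z, z))\<bar> \<le> K"
    if g: "param_Ck D 0 g" "\<And>y z. y \<in> {0..1} \<Longrightarrow> z \<in> D \<Longrightarrow> \<bar>g y z\<bar> \<le> 1 / 2" and yz: "y \<in> {0..1}" "z \<in> D"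
      and K: "\<And>t. t \<in> {0..1} \<Longrightarrow> \<bar>P n t z - g t z\<bar> \<le> 2 * K" for n g y z K
  proof -
    have "P (Suc n) y z - integral {0..y} (\<lambda>t. H t (g t z, z))
        = integral {0..y} (\<lambda>t. H t (P n t z, z) - H t (g t z, z))"
      unfolding PS by (rule integral_diff[symmetric])
        (use cP[OF yz] cH[OF g yz] in \<open>auto intro!: integrable_continuous_interval\<close>)
    also have "\<bar>\<dots>\<bar> \<le> K"
    proof (rule integral_initial_abs_le)
      show "continuous_on {0..y} (\<lambda>t. H t (P n t z, z) - H t (g t z, z))"
        using cP[OF yz] cH[OF g yz] by (auto intro!: continuous_intros)
      show "\<bar>H t (P n t z, z) - H t (g t z, z)\<bar> \<le> K" if t: "t \<in> {0..y}" for t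
        
      proof -
        have t1: "t \<in> {0..1}" using t yz by auto
        have "\<bar>P n t z\<bar> \<le> 1 / 2" using P t1 yz by blast
        note lH[OF t1 yz(2) this g(2)[OF t1 yz(2)]]
        also have "\<bar>P n t z - g t z\<bar> / 2 \<le> 2 * K / 2" by (intro divide_right_mono K[OF t1]) simp
        finally show ?thesis by simp
      qed
      show "0 \<le> K" using K[of 0] by auto
    qed (use yz in auto)
    finally show ?thesis .
  qed
  have diff: "y \<in> {0..1} \<Longrightarrow> z \<in> D \<Longrightarrow> \<bar>P (Suc n) y z - P n y z\<bar> \<le> (1 / 2) ^ Suc n" for n y z
  proof (induction n arbitrary: y)
    case 0 then show ?case using P[of 1] by (simp add: P0)
  next
    case (Suc n)
    have "\<bar>P (Suc (Suc n)) y z - integral {0..y} (\<lambda>t. H t (P n t z, z))\<bar> \<le> (1 / 2) ^ Suc (Suc n)"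
      by (rule step) (use P Suc in auto)
    then show ?case by (simp only: PS[of n])
  qed
  define \<phi> where "\<phi> = (\<lambda>y z. \<Sum>i. P (Suc i) y z - P i y z)"
  have tele: "(\<Sum>i<n. P (Suc i) y z - P i y z) = P n y z" for n y z
    using sum_lessThan_telescope[of "\<lambda>i. P i y z" n] by (simp add: P0)
  have "uniform_limit ({0..1} \<times> D) (\<lambda>n p. \<Sum>i<n. P (Suc i) (fst p) (snd p) - P i (fst p) (snd p))
      (\<lambda>p. \<Sum>i. P (Suc i) (fst p) (snd p) - P i (fst p) (snd p)) sequentially"
    by (rule Weierstrass_m_test[of _ _ "\<lambda>n. (1 / 2) ^ Suc n"])
      (use diff in \<open>auto intro!: summable_mult summable_geometric\<close>)
  then have ul: "uniform_limit ({0..1} \<times> D) (\<lambda>n p. P n (fst p) (snd p)) (\<lambda>p. \<phi> (fst p) (snd p)) sequentially"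
    by (simp only: tele \<phi>_def)
  have ul': "\<forall>\<^sub>F n in sequentially. \<forall>y\<in>{0..1}. \<forall>z\<in>D. \<bar>P n y z - \<phi> y z\<bar> < e" if "e > 0" for e
    using uniform_limitD[OF ul that] by (auto simp: dist_real_def)
  have lim: "(\<lambda>n. P n y z) \<longlonglongrightarrow> \<phi> y z" if "y \<in> {0..1}" "z \<in> D" for y z
    using tendsto_uniform_limitI[OF ul, of "(y, z)"] that by simp
  have c\<phi>: "param_Ck D 0 \<phi>"
    unfolding param_Ck_0 by (rule uniform_limit_theorem[OF _ ul]) (use P in auto)
  have b\<phi>: "\<bar>\<phi> y z\<bar> \<le> 1 / 2" if "y \<in> {0..1}" "z \<in> D" for y z
    by (rule LIMSEQ_le_const2[OF tendsto_rabs[OF lim[OF that]]]) (use P that in auto)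
  have eq: "\<phi> y z = integral {0..y} (\<lambda>t. H t (\<phi> t z, z))" if yz: "y \<in> {0..1}" "z \<in> D" for y z
  proof (rule LIMSEQ_unique)
    show "(\<lambda>n. P (Suc n) y z) \<longlonglongrightarrow> \<phi> y z" by (rule LIMSEQ_Suc[OF lim[OF yz]])
    show "(\<lambda>n. P (Suc n) y z) \<longlonglongrightarrow> integral {0..y} (\<lambda>t. H t (\<phi> t z, z))"
    proof (rule tendstoI)
      fix e :: real assume "e > 0"
      from ul'[OF this] show "\<forall>\<^sub>F n in sequentially. dist (P (Suc n) y z) (integral {0..y} (\<lambda>t. H t (\<phi> t z, z))) < e"
      proof eventually_elim
        case (elim n)
        have "\<bar>P (Suc n) y z - integral {0..y} (\<lambda>t. H t (\<phi> t z, z))\<bar> \<le> e / 2"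
          by (rule step[OF c\<phi> b\<phi> yz]) (use elim yz in \<open>auto intro: less_imp_le\<close>)
        then show ?case using \<open>e > 0\<close> by (simp add: dist_real_def)
      qed
    qed
  qed
  have "solves_on_unit D H \<phi>"
    unfolding solves_on_unit_def
  proof (intro ballI conjI)
    fix z assume z: "z \<in> D"
    show "\<phi> 0 z = 0" using eq[of 0 z] z by simp
    fix y :: real assume y: "y \<in> {0..1}"
    show "\<bar>\<phi> y z\<bar> \<le> 1 / 2" using b\<phi> y z by blast
    have "((\<lambda>u. integral {0..u} (\<lambda>t. H t (\<phi> t z, z))) has_real_derivative H y (\<phi> y z, z)) (at y within {0..1})"
      by (rule integral_has_real_derivative[OF _ y]) (use cH[OF c\<phi> b\<phi>, of 1 z] z in auto)
    then show "((\<lambda>t. \<phi> t z) has_real_derivative H y (\<phi> y z, z)) (at y within {0..1})"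
      by (rule has_field_derivative_transform_within[OF _ zero_less_one y]) (use eq z in auto)
  qed
  then show ?thesis using c\<phi> that by blast
qed

text \<open>
  The candidate \<open>\<psi>\<close> solves the linearised equation by variation of constants; this explicit formula is available
  because the equation is scalar. The difference quotient is compared with it in two steps. Gronwall first gives
  that solutions depend on the parameter in a Lipschitz way. Then \<open>\<phi>(z) - \<phi>(z0) - \<psi>(z - z0)\<close> solves
  the linearised equation with an inhomogeneity which, by uniform differentiability, is of smaller order than
  \<open>z - z0\<close>, and Gronwall applies again.
\<close>

lemma solution_has_parameter_derivative:
  fixes H :: "real \<Rightarrow> real \<times> 'b::euclidean_space \<Rightarrow> real"
  assumes "open D" and hc: "half_contraction D H" and sol: "solves_on_unit D H \<phi>"
    and c\<phi>: "param_Ck D 0 \<phi>"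
    and H': "\<And>y z. y \<in> {0..1} \<Longrightarrow> z \<in> {-1<..<1} \<times> D \<Longrightarrow> (H y has_derivative H' y z) (at z)"
      "\<And>h. param_Ck ({-1<..<1} \<times> D) 0 (\<lambda>y z. H' y z h)"
    and \<psi>: "\<psi> = (\<lambda>y z h. exp (integral {0..y} (\<lambda>t. H' t (\<phi> t z, z) (1, 0))) *
       integral {0..y} (\<lambda>t. exp (- 1 * integral {0..t} (\<lambda>t. H' t (\<phi> t z, z) (1, 0))) * H' t (\<phi> t z, z) (0, h)))"
    and y0: "y0 \<in> {0..1}" and z0: "z0 \<in> D"
  shows "(\<phi> y0 has_derivative \<psi> y0 z0) (at z0)"
proof -
  note op = assms(1)
  have b\<phi>: "\<bar>\<phi> y z\<bar> \<le> 1 / 2" if "y \<in> {0..1}" "z \<in> D" for y z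
    using sol that unfolding solves_on_unit_def by blast
  have in1: "\<phi> y z \<in> {-1<..<1}" if "y \<in> {0..1}" "z \<in> D" for y z
    using b\<phi>[OF that] by auto
  have \<phi>0: "\<phi> 0 z = 0" if "z \<in> D" for z
    using sol that unfolding solves_on_unit_def by blast
  have d\<phi>: "((\<lambda>t. \<phi> t z) has_real_derivative H y (\<phi> y z, z)) (at y within {0..1})"
    if "y \<in> {0..1}" "z \<in> D" for y z
    using sol that unfolding solves_on_unit_def by blast
  have lin: "linear (H' y (\<phi> y z, z))" if "y \<in> {0..1}" "z \<in> D" for y z
    using H'(1)[of y "(\<phi> y z, z)"] in1[OF that] that has_derivative_linear by blast
  have comp: "param_Ck D 0 (\<lambda>y z. H' y (\<phi> y z, z) h)" for h
    by (rule param_Ck_compose[OF op c\<phi> _ H'(2)]) (use in1 in auto)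
  define A where "A = (\<lambda>y. H' y (\<phi> y z0, z0) (1, 0))"
  define Bh where "Bh = (\<lambda>h y. H' y (\<phi> y z0, z0) (0, h))"
  have cA: "continuous_on {0..1} A" unfolding A_def by (rule param_Ck_continuous_time[OF comp z0]) simp
  have cB: "continuous_on {0..1} (Bh h)" for h unfolding Bh_def by (rule param_Ck_continuous_time[OF comp z0]) simp
  define E where "E = (\<lambda>y. integral {0..y} A)"
  have dE: "(E has_real_derivative A y) (at y within {0..1})" if "y \<in> {0..1}" for y
    unfolding E_def by (rule integral_has_real_derivative[OF cA that])
  have cE: "continuous_on {0..1} E" by (rule DERIV_continuous_on[OF dE])
  define G where "G = (\<lambda>h t. exp (- 1 * E t) * Bh h t)"
  have cG: "continuous_on {0..1} (G h)" for h unfolding G_def by (intro continuous_intros cE cB)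
  have \<psi>_eq: "\<psi> y z0 h = exp (E y) * integral {0..y} (G h)" for y h
    unfolding \<psi> E_def A_def G_def Bh_def ..
  have d\<psi>: "((\<lambda>t. \<psi> t z0 h) has_real_derivative A y * \<psi> y z0 h + Bh h y) (at y within {0..1})"
    if y: "y \<in> {0..1}" for y h
  proof -
    have "((\<lambda>t. exp (E t) * integral {0..t} (G h)) has_real_derivative
        exp (E y) * A y * integral {0..y} (G h) + G h y * exp (E y)) (at y within {0..1})"
      by (rule DERIV_mult[OF DERIV_chain'[OF dE[OF y] DERIV_exp] integral_has_real_derivative[OF cG y]])
    moreover have "exp (E y) * A y * integral {0..y} (G h) + G h y * exp (E y) = A y * \<psi> y z0 h + Bh h y"
      by (simp add: \<psi>_eq G_def exp_minus)
    ultimately show ?thesis unfolding \<psi>_eq by simp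
  qed
  have \<psi>0: "\<psi> 0 z0 h = 0" for h by (simp add: \<psi>_eq)
  have B_add: "Bh (a + b) t = Bh a t + Bh b t" and B_scale: "Bh (r *\<^sub>R a) t = r * Bh a t" if "t \<in> {0..1}" for a b r t
    using linear_add[OF lin[OF that z0], of "(0, a)" "(0, b)"] linear_scale[OF lin[OF that z0], of r "(0, a)"]
    by (simp_all add: Bh_def)
  have intG: "G h integrable_on {0..y0}" for h
    by (rule integrable_continuous_interval, rule continuous_on_subset[OF cG]) (use y0 in auto)
  have "linear (\<psi> y0 z0)"
  proof (rule linearI)
    fix a b :: 'b and r :: real
    have "integral {0..y0} (G (a + b)) = integral {0..y0} (\<lambda>t. G a t + G b t)"
      by (rule integral_cong) (use y0 in \<open>auto simp: G_def B_add algebra_simps\<close>)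
    then show "\<psi> y0 z0 (a + b) = \<psi> y0 z0 a + \<psi> y0 z0 b"
      by (simp add: \<psi>_eq integral_add[OF intG intG] algebra_simps)
    have "integral {0..y0} (G (r *\<^sub>R a)) = integral {0..y0} (\<lambda>t. r * G a t)"
      by (rule integral_cong) (use y0 in \<open>auto simp: G_def B_scale algebra_simps\<close>)
    then show "\<psi> y0 z0 (r *\<^sub>R a) = r *\<^sub>R \<psi> y0 z0 a"
      by (simp add: \<psi>_eq)
  qed
  then have bl: "bounded_linear (\<psi> y0 z0)" by (simp add: linear_conv_bounded_linear)
  define \<zeta> where "\<zeta> = (\<lambda>y. (\<phi> y z0, z0))"
  have opU: "open ({-1<..<(1::real)} \<times> D)" using op by (intro open_Times) auto
  have c\<zeta>: "continuous_on {0..1} \<zeta>"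
    unfolding \<zeta>_def by (intro continuous_intros param_Ck_continuous_time[OF c\<phi> z0]) simp
  have \<zeta>U: "\<zeta> y \<in> {-1<..<1} \<times> D" if "y \<in> {0..1}" for y
    using in1[OF that z0] z0 by (simp add: \<zeta>_def)
  define N where "N = (\<lambda>y. \<bar>A y\<bar> + (\<Sum>b\<in>Basis. \<bar>Bh b y\<bar>))"
  have "continuous_on {0..1} N" unfolding N_def by (intro continuous_intros cA cB)
  then have "bounded (N ` {0..1})"
    by (intro compact_imp_bounded compact_continuous_image) auto
  then obtain M where "\<forall>x\<in>N ` {0..1}. norm x \<le> M"
    unfolding bounded_iff by blast
  then have M: "\<bar>N y\<bar> \<le> M" if "y \<in> {0..1}" for y using that by auto
  have Mpos: "0 \<le> M" using M[of 0] by auto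
  have AM: "\<bar>A y\<bar> \<le> M" if "y \<in> {0..1}" for y
  proof -
    have "0 \<le> (\<Sum>b\<in>Basis. \<bar>Bh b y\<bar>)" by (intro sum_nonneg) auto
    then show ?thesis using M[OF that] unfolding N_def by linarith
  qed
  have BM: "\<bar>Bh h y\<bar> \<le> M * norm h" if y: "y \<in> {0..1}" for h y
  proof -
    have lB: "linear (\<lambda>h. Bh h y)" by (rule linearI) (use B_add B_scale y in auto)
    have "Bh h y = Bh (\<Sum>b\<in>Basis. (h \<bullet> b) *\<^sub>R b) y" by (simp add: euclidean_representation)
    also have "\<dots> = (\<Sum>b\<in>Basis. (h \<bullet> b) * Bh b y)"
      unfolding linear_sum[OF lB] linear_scale[OF lB] by simp
    finally have "\<bar>Bh h y\<bar> \<le> (\<Sum>b\<in>Basis. \<bar>(h \<bullet> b) * Bh b y\<bar>)" by (simp only: sum_abs)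
    also have "\<dots> \<le> (\<Sum>b\<in>Basis. norm h * \<bar>Bh b y\<bar>)"
      by (intro sum_mono) (auto simp: abs_mult Basis_le_norm intro!: mult_right_mono)
    also have "\<dots> = norm h * (\<Sum>b\<in>Basis. \<bar>Bh b y\<bar>)" by (simp add: sum_distrib_left)
    also have "\<dots> \<le> norm h * M"
      using M[OF y] by (intro mult_left_mono) (auto simp: N_def)
    finally show ?thesis by (simp add: mult.commute)
  qed
  have H'_split: "H' y (\<zeta> y) (a, h) = A y * a + Bh h y" if "y \<in> {0..1}" for y a h
    using linear_add[OF lin[OF that z0], of "a *\<^sub>R (1, 0)" "(0, h)"] linear_scale[OF lin[OF that z0], of a "(1,0)"]
    by (simp add: A_def Bh_def \<zeta>_def)
  note UD = uniformly_differentiable_along_curve[OF opU H'(1) H'(2)[unfolded param_Ck_0] c\<zeta> \<zeta>U]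
  obtain \<delta>1 where \<delta>1: "0 < \<delta>1" "\<And>y z. y \<in> {0..1} \<Longrightarrow> norm (z - \<zeta> y) < \<delta>1 \<Longrightarrow>
      z \<in> {-1<..<1} \<times> D \<and> \<bar>H y z - H y (\<zeta> y) - H' y (\<zeta> y) (z - \<zeta> y)\<bar> \<le> 1 * norm (z - \<zeta> y)"
    using UD[of 1] by auto
  define Cd where "Cd = (1 + M) * exp (1 / 2 + 1)"
  have Cd: "0 \<le> Cd" using Mpos by (simp add: Cd_def)
  have d_bound: "z \<in> D \<and> (\<forall>y\<in>{0..1}. \<bar>\<phi> y z - \<phi> y z0\<bar> \<le> Cd * norm (z - z0))" if z: "norm (z - z0) < \<delta>1" for z
  proof -
    have sub: "(\<phi> y z0, z) - \<zeta> y = (0, z - z0)" for y by (simp add: \<zeta>_def)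
    have nrm: "norm ((\<phi> y z0, z) - \<zeta> y) = norm (z - z0)" for y by (simp add: sub norm_Pair)
    have zD: "z \<in> D" using \<delta>1(2)[of 0 "(\<phi> 0 z0, z)"] z nrm by simp
    have "\<bar>\<phi> y z - \<phi> y z0\<bar> \<le> ((1 + M) * norm (z - z0)) * exp (1 / 2 + 1)" if y: "y \<in> {0..1}" for y
    proof (rule gronwall_unit[OF _ _ _ _ _ y, where e' = "\<lambda>y. H y (\<phi> y z, z) - H y (\<phi> y z0, z0)"])
      fix s :: real assume s: "s \<in> {0..1}"
      show "((\<lambda>t. \<phi> t z - \<phi> t z0) has_real_derivative H s (\<phi> s z, z) - H s (\<phi> s z0, z0)) (at s within {0..1})"
        by (intro DERIV_diff d\<phi> s zD z0)
      have 1: "\<bar>H s (\<phi> s z, z) - H s (\<phi> s z0, z)\<bar> \<le> \<bar>\<phi> s z - \<phi> s z0\<bar> / 2"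
        using hc s zD in1[OF s zD] in1[OF s z0] unfolding half_contraction_def by blast
      have "\<bar>H s (\<phi> s z0, z) - H s (\<zeta> s) - H' s (\<zeta> s) (0, z - z0)\<bar> \<le> norm (z - z0)"
        using \<delta>1(2)[OF s, of "(\<phi> s z0, z)"] z nrm sub by simp
      moreover have "\<bar>H' s (\<zeta> s) (0, z - z0)\<bar> \<le> M * norm (z - z0)"
        using BM[OF s, of "z - z0"] H'_split[OF s] by simp
      moreover have "(1 + M) * norm (z - z0) = norm (z - z0) + M * norm (z - z0)" by (simp add: algebra_simps)
      ultimately show "\<bar>H s (\<phi> s z, z) - H s (\<phi> s z0, z0)\<bar> \<le> 1 / 2 * \<bar>\<phi> s z - \<phi> s z0\<bar> + (1 + M) * norm (z - z0)"
        using 1 unfolding \<zeta>_def by linarith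
    qed (use Mpos \<phi>0 zD z0 in auto)
    then show ?thesis using zD by (simp add: Cd_def algebra_simps)
  qed
  show ?thesis
    unfolding has_derivative_at_alt
  proof (intro conjI bl allI impI)
    fix \<epsilon> :: real assume \<epsilon>: "0 < \<epsilon>"
    define \<eta> where "\<eta> = \<epsilon> / ((Cd + 1) * exp (M + 1))"
    have \<eta>: "\<eta> > 0" using \<epsilon> Cd by (simp add: \<eta>_def)
    obtain \<delta>2 where \<delta>2: "0 < \<delta>2" "\<And>y z. y \<in> {0..1} \<Longrightarrow> norm (z - \<zeta> y) < \<delta>2 \<Longrightarrow>
        z \<in> {-1<..<1} \<times> D \<and> \<bar>H y z - H y (\<zeta> y) - H' y (\<zeta> y) (z - \<zeta> y)\<bar> \<le> \<eta> * norm (z - \<zeta> y)"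
      using UD[of \<eta>] \<eta> by auto
    define \<delta> where "\<delta> = min \<delta>1 (\<delta>2 / (Cd + 1))"
    have "norm (\<phi> y0 z - \<phi> y0 z0 - \<psi> y0 z0 (z - z0)) \<le> \<epsilon> * norm (z - z0)" if z: "norm (z - z0) < \<delta>" for z
    proof -
      have zD: "z \<in> D" and db: "\<And>y. y \<in> {0..1} \<Longrightarrow> \<bar>\<phi> y z - \<phi> y z0\<bar> \<le> Cd * norm (z - z0)"
        using d_bound[of z] z by (auto simp: \<delta>_def)
      have "norm (z - z0) < \<delta>2 / (Cd + 1)" using z by (simp add: \<delta>_def)
      then have z2: "(Cd + 1) * norm (z - z0) < \<delta>2" using Cd by (simp add: field_simps)
      have "\<bar>\<phi> y0 z - \<phi> y0 z0 - \<psi> y0 z0 (z - z0)\<bar> \<le> (\<eta> * ((Cd + 1) * norm (z - z0))) * exp (M + 1)"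
      proof (rule gronwall_unit[OF _ _ _ _ _ y0, where e = "\<lambda>t. \<phi> t z - \<phi> t z0 - \<psi> t z0 (z - z0)"
            and e' = "\<lambda>y. H y (\<phi> y z, z) - H y (\<phi> y z0, z0) - (A y * \<psi> y z0 (z - z0) + Bh (z - z0) y)"])
        fix s :: real assume s: "s \<in> {0..1}"
        show "((\<lambda>t. \<phi> t z - \<phi> t z0 - \<psi> t z0 (z - z0)) has_real_derivative
          H s (\<phi> s z, z) - H s (\<phi> s z0, z0) - (A s * \<psi> s z0 (z - z0) + Bh (z - z0) s)) (at s within {0..1})"
          by (intro DERIV_diff d\<phi> d\<psi> s zD z0)
        have sub: "(\<phi> s z, z) - \<zeta> s = (\<phi> s z - \<phi> s z0, z - z0)" by (simp add: \<zeta>_def)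
        have n: "norm ((\<phi> s z, z) - \<zeta> s) \<le> (Cd + 1) * norm (z - z0)"
          unfolding sub using norm_Pair_le[of "\<phi> s z - \<phi> s z0" "z - z0"] db[OF s] by (simp add: algebra_simps)
        then have "\<bar>H s (\<phi> s z, z) - H s (\<zeta> s) - H' s (\<zeta> s) (\<phi> s z - \<phi> s z0, z - z0)\<bar> \<le> \<eta> * norm ((\<phi> s z, z) - \<zeta> s)"
          using \<delta>2(2)[OF s, of "(\<phi> s z, z)"] z2 by (simp only: sub)
        also have "\<dots> \<le> \<eta> * ((Cd + 1) * norm (z - z0))" using n \<eta> by simp
        finally have 1: "\<bar>H s (\<phi> s z, z) - H s (\<zeta> s) - (A s * (\<phi> s z - \<phi> s z0) + Bh (z - z0) s)\<bar> \<le> \<eta> * ((Cd + 1) * norm (z - z0))"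
          by (simp only: H'_split[OF s])
        have 2: "\<bar>A s * (\<phi> s z - \<phi> s z0 - \<psi> s z0 (z - z0))\<bar> \<le> M * \<bar>\<phi> s z - \<phi> s z0 - \<psi> s z0 (z - z0)\<bar>"
          unfolding abs_mult using AM[OF s] by (intro mult_right_mono) auto
        have 3: "H s (\<phi> s z, z) - H s (\<phi> s z0, z0) - (A s * \<psi> s z0 (z - z0) + Bh (z - z0) s) =
          (H s (\<phi> s z, z) - H s (\<zeta> s) - (A s * (\<phi> s z - \<phi> s z0) + Bh (z - z0) s)) +
          A s * (\<phi> s z - \<phi> s z0 - \<psi> s z0 (z - z0))"
          by (simp add: \<zeta>_def algebra_simps)
        show "\<bar>H s (\<phi> s z, z) - H s (\<phi> s z0, z0) - (A s * \<psi> s z0 (z - z0) + Bh (z - z0) s)\<bar> \<le>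
          M * \<bar>\<phi> s z - \<phi> s z0 - \<psi> s z0 (z - z0)\<bar> + \<eta> * ((Cd + 1) * norm (z - z0))"
          unfolding 3 using abs_triangle_ineq[of "H s (\<phi> s z, z) - H s (\<zeta> s) - (A s * (\<phi> s z - \<phi> s z0) + Bh (z - z0) s)" "A s * (\<phi> s z - \<phi> s z0 - \<psi> s z0 (z - z0))"]
            1 2 by linarith
      qed (use Mpos \<eta> Cd \<phi>0 \<psi>0 zD z0 in auto)
      also have "\<dots> = \<epsilon> * norm (z - z0)" using Cd by (simp add: \<eta>_def)
      finally show ?thesis by simp
    qed
    moreover have "\<delta> > 0" using \<delta>1 \<delta>2 Cd by (simp add: \<delta>_def)
    ultimately show "\<exists>d>0. \<forall>z. norm (z - z0) < d \<longrightarrow> norm (\<phi> y0 z - \<phi> y0 z0 - \<psi> y0 z0 (z - z0)) \<le> \<epsilon> * norm (z - z0)"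
      by blast
  qed
qed

text \<open>
  By induction: if the solution is of class \<open>C\<^sup>k\<close>, then so are the coefficients of the linearised
  equation along it, and hence the derivative of the solution, which is built from them by integrals,
  exponentials and products.
\<close>

lemma solution_param_Ck:
  fixes H :: "real \<Rightarrow> real \<times> 'b::euclidean_space \<Rightarrow> real"
  assumes "open D" and hc: "half_contraction D H" and sol: "solves_on_unit D H \<phi>"
    and c\<phi>: "param_Ck D 0 \<phi>" and "param_Ck ({-1<..<1} \<times> D) k H"
  shows "param_Ck D k \<phi>"
  using assms(5)
proof (induction k)
  case 0 then show ?case using c\<phi> by simp
next
  case (Suc k)
  have opU: "open ({-1<..<(1::real)} \<times> D)" using assms(1) by (intro open_Times) auto
  have IH: "param_Ck D k \<phi>" using Suc.IH param_Ck_Suc[OF opU Suc.prems] .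
  obtain H' where H': "\<And>y z. y \<in> {0..1} \<Longrightarrow> z \<in> {-1<..<1} \<times> D \<Longrightarrow> (H y has_derivative H' y z) (at z)"
    "\<And>h. param_Ck ({-1<..<1} \<times> D) k (\<lambda>y z. H' y z h)"
    using param_Ck_SucE[OF Suc.prems] by metis
  have H'0: "param_Ck ({-1<..<1} \<times> D) 0 (\<lambda>y z. H' y z h)" for h
    unfolding param_Ck_0 by (rule param_Ck_continuous[OF H'(2)])
  have comp: "param_Ck D k (\<lambda>y z. H' y (\<phi> y z, z) h)" for h
  proof (rule param_Ck_compose[OF assms(1) IH _ H'(2)])
    fix y :: real and z assume "y \<in> {0..1}" "z \<in> D"
    then have "\<bar>\<phi> y z\<bar> \<le> 1 / 2" using sol unfolding solves_on_unit_def by blast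
    then show "(\<phi> y z, z) \<in> {-1<..<1} \<times> D" using \<open>z \<in> D\<close> by auto
  qed
  define E where "E = (\<lambda>y z. integral {0..y} (\<lambda>t. H' t (\<phi> t z, z) (1, 0)))"
  have E: "param_Ck D k E" unfolding E_def by (rule param_Ck_integral[OF assms(1) comp])
  have mE: "param_Ck D k (\<lambda>y z. - 1 * E y z)"
    using graded_bound.Cg_cmult[OF graded_bound_trivial[OF assms(1)] E] .
  show ?case
  proof (rule param_Ck_SucI)
    show "continuous_on ({0..1} \<times> D) (\<lambda>p. \<phi> (fst p) (snd p))" using c\<phi> by simp
    show "(\<phi> y has_derivative (\<lambda>h. exp (E y z) * integral {0..y} (\<lambda>t. exp (- 1 * E t z) * H' t (\<phi> t z, z) (0, h)))) (at z)"
      if "y \<in> {0..1}" "z \<in> D" for y z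
      using solution_has_parameter_derivative[OF assms(1) hc sol c\<phi> H'(1) H'0 refl that] unfolding E_def by simp
    show "param_Ck D k (\<lambda>y z. exp (E y z) * integral {0..y} (\<lambda>t. exp (- 1 * E t z) * H' t (\<phi> t z, z) (0, h)))" for h
      by (intro param_Ck_mult param_Ck_exp param_Ck_integral assms(1) E mE comp)
  qed
qed

section \<open>Extension by zero of functions with graded bounds\<close>

lemma Ck_on_cong:
  assumes "open S"
  shows "Ck_on k S f \<Longrightarrow> (\<And>x. x \<in> S \<Longrightarrow> f x = g x) \<Longrightarrow> Ck_on k S g"
proof (induction k arbitrary: f g)
  case 0
  then show ?case using continuous_on_eq by auto
next
  case (Suc k)
  have der: "(g has_derivative frechet_derivative f (at x)) (at x)" if x: "x \<in> S" for x
  proof -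
    have "(f has_derivative frechet_derivative f (at x)) (at x)"
      using Suc.prems(1) x by (simp add: frechet_derivative_works[symmetric])
    then show ?thesis
      using has_derivative_transform_within_open[OF _ assms x] Suc.prems(2) by blast
  qed
  show ?case
    unfolding Ck_on.simps
  proof (intro conjI ballI allI)
    show "g differentiable at x" if "x \<in> S" for x using der[OF that] differentiable_def by blast
    fix h
    have "frechet_derivative f (at x) h = frechet_derivative g (at x) h" if "x \<in> S" for x
      using frechet_derivative_at[OF der[OF that]] by simp
    moreover have "Ck_on k S (\<lambda>x. frechet_derivative f (at x) h)" using Suc.prems(1) by simp
    ultimately show "Ck_on k S (\<lambda>x. frechet_derivative g (at x) h)" by (rule Suc.IH[rotated])
  qed
qed

lemma param_Ck_imp_Ck_on:
  assumes "open D" "y \<in> {0..1}"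
  shows "param_Ck D k f \<Longrightarrow> Ck_on k D (f y)"
proof (induction k arbitrary: f)
  case 0
  have "continuous_on D (\<lambda>z. f (fst (y, z)) (snd (y, z)))"
    by (rule continuous_on_compose2[OF param_Ck_continuous[OF 0]])
      (use assms(2) in \<open>auto intro!: continuous_intros\<close>)
  then show ?case by simp
next
  case (Suc k)
  obtain f' where f': "\<And>y z. y \<in> {0..1} \<Longrightarrow> z \<in> D \<Longrightarrow> (f y has_derivative f' y z) (at z)"
    "\<And>h. param_Ck D k (\<lambda>y z. f' y z h)"
    using param_Ck_SucE[OF Suc.prems] by metis
  show ?case
    unfolding Ck_on.simps
  proof (intro conjI ballI allI)
    show "f y differentiable at x" if "x \<in> D" for x using f'(1)[OF assms(2) that] differentiable_def by blast
    show "Ck_on k D (\<lambda>x. frechet_derivative (f y) (at x) h)" for h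
      by (rule Ck_on_cong[OF assms(1) Suc.IH[OF f'(2)[of h]]])
        (simp add: frechet_derivative_at[OF f'(1)[OF assms(2)], symmetric])
  qed
qed

lemma (in graded_bound) Cg_parameter:
  fixes X :: "'b \<Rightarrow> 'c::euclidean_space"
  assumes "compact K" "K \<subseteq> \<Lambda>" "bounded_linear X" "\<And>z. z \<in> D \<Longrightarrow> X z \<in> K"
  shows "Ck_on k \<Lambda> g \<Longrightarrow> Cg k 0 (\<lambda>_ z. g (X z))"
proof (induction k arbitrary: g)
  case (0 g)
  then have cont: "continuous_on \<Lambda> g" by simp
  have "bounded (g ` K)"
    using assms(1,2) cont by (intro compact_imp_bounded compact_continuous_image) (auto intro: continuous_on_subset)
  then obtain C where C: "\<forall>x\<in>g ` K. norm x \<le> C" unfolding bounded_iff by blast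
  have "continuous_on ({0..1} \<times> D) (\<lambda>p. g (X (snd p)))"
    by (rule continuous_on_compose2[OF cont bounded_linear.continuous_on[OF assms(3)]])
     (use assms in \<open>auto intro!: continuous_intros\<close>)
  then show ?case using bound_bounded[of "\<lambda>_ z. g (X z)" C] C assms(4) by auto
next
  case (Suc k g)
  then have der: "(g has_derivative frechet_derivative g (at x)) (at x)" if "x \<in> \<Lambda>" for x
    using that by (simp add: frechet_derivative_works[symmetric])
  have "continuous_on \<Lambda> g"
    by (rule continuous_at_imp_continuous_on) (use der has_derivative_continuous in blast)
  then have cont: "continuous_on K g" using assms(2) continuous_on_subset by blast
  then have "bounded (g ` K)"
    using assms(1) by (intro compact_imp_bounded compact_continuous_image) auto
  then obtain C where C: "\<forall>x\<in>g ` K. norm x \<le> C" unfolding bounded_iff by blast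
  show ?case
  proof (rule Cg_SucI[of _ _ "\<lambda>_ z h. frechet_derivative g (at (X z)) (X h)"])
    show "continuous_on ({0..1} \<times> D) (\<lambda>p. g (X (snd p)))"
      by (rule continuous_on_compose2[OF cont bounded_linear.continuous_on[OF assms(3)]])
       (use assms in \<open>auto intro!: continuous_intros\<close>)
    show "B 0 (\<lambda>_ z. g (X z))" by (rule bound_bounded[of _ C]) (use C assms(4) in auto)
    show "((\<lambda>z. g (X z)) has_derivative (\<lambda>h. frechet_derivative g (at (X z)) (X h))) (at z)" if "z \<in> D" for z
      by (rule has_derivative_compose[OF bounded_linear_imp_has_derivative[OF assms(3)] der])
        (use that assms(2,4) in auto)
    show "Cg k (0 - c) (\<lambda>_ z. frechet_derivative g (at (X z)) (X h))" for h
      using Cg_mono[OF Suc.IH[of "\<lambda>x. frechet_derivative g (at x) (X h)"], of "0 - c"] Suc.prems loss_nonneg by auto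
  qed
qed

text \<open>
  The order with respect to a positive weight \<open>\<rho>\<close>, which will be the distance to the boundary \<open>\<rho> = 0\<close>.
\<close>

definition weight_bound :: "'b set \<Rightarrow> ('b \<Rightarrow> real) \<Rightarrow> real \<Rightarrow> (real \<Rightarrow> 'b \<Rightarrow> real) \<Rightarrow> bool" where
  "weight_bound D \<rho> m f \<longleftrightarrow> (\<exists>C. \<forall>y\<in>{0..1}. \<forall>z\<in>D. \<bar>f y z\<bar> \<le> C * \<rho> z powr m)"

lemma weight_boundI:
  "(\<And>y z. y \<in> {0..1} \<Longrightarrow> z \<in> D \<Longrightarrow> \<bar>f y z\<bar> \<le> C * \<rho> z powr m) \<Longrightarrow> weight_bound D \<rho> m f"
  unfolding weight_bound_def by blast

lemma weight_bound_nonneg: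
  assumes "weight_bound D \<rho> m f"
  shows "\<exists>C\<ge>0. \<forall>y\<in>{0..1}. \<forall>z\<in>D. \<bar>f y z\<bar> \<le> C * \<rho> z powr m"
proof -
  obtain C where C: "\<forall>y\<in>{0..1}. \<forall>z\<in>D. \<bar>f y z\<bar> \<le> C * \<rho> z powr m"
    using assms unfolding weight_bound_def by blast
  have "C * \<rho> z powr m \<le> \<bar>C\<bar> * \<rho> z powr m" for z by (intro mult_right_mono) auto
  then have "\<bar>f y z\<bar> \<le> \<bar>C\<bar> * \<rho> z powr m" if "y \<in> {0..1}" "z \<in> D" for y z
    using C that order.trans by blast
  then show ?thesis by (intro exI[of _ "\<bar>C\<bar>"]) auto
qed

lemma graded_bound_weight:
  assumes "open D" "0 \<le> c" and \<rho>: "\<And>z. z \<in> D \<Longrightarrow> 0 < \<rho> z \<and> \<rho> z \<le> 1"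
  shows "graded_bound D (weight_bound D \<rho>) c"
proof
  show "weight_bound D \<rho> m g" if "weight_bound D \<rho> m f" "\<And>y z. y \<in> {0..1} \<Longrightarrow> z \<in> D \<Longrightarrow> f y z = g y z" for m f g
    using that unfolding weight_bound_def by auto
  show "weight_bound D \<rho> 0 f" if "\<And>y z. y \<in> {0..1} \<Longrightarrow> z \<in> D \<Longrightarrow> \<bar>f y z\<bar> \<le> C" for f C
    by (rule weight_boundI[of _ _ C]) (use that \<rho> in force)
  show "weight_bound D \<rho> m (\<lambda>y z. f y z + g y z)" if f: "weight_bound D \<rho> m f" and g: "weight_bound D \<rho> m g" for m f g
  proof -
    obtain C1 where C1: "\<And>y z. y \<in> {0..1} \<Longrightarrow> z \<in> D \<Longrightarrow> \<bar>f y z\<bar> \<le> C1 * \<rho> z powr m"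
      using weight_bound_nonneg[OF f] by metis
    obtain C2 where C2: "\<And>y z. y \<in> {0..1} \<Longrightarrow> z \<in> D \<Longrightarrow> \<bar>g y z\<bar> \<le> C2 * \<rho> z powr m"
      using weight_bound_nonneg[OF g] by metis
    show ?thesis
    proof (rule weight_boundI[of _ _ "C1 + C2"])
      fix y :: real and z assume "y \<in> {0..1}" "z \<in> D"
      from C1[OF this] C2[OF this] show "\<bar>f y z + g y z\<bar> \<le> (C1 + C2) * \<rho> z powr m"
        by (simp only: distrib_right)
    qed
  qed
  show "weight_bound D \<rho> (m + m') (\<lambda>y z. f y z * g y z)"
    if f: "weight_bound D \<rho> m f" and g: "weight_bound D \<rho> m' g" for m m' f g
  proof -
    obtain C1 where C1: "C1 \<ge> 0" "\<And>y z. y \<in> {0..1} \<Longrightarrow> z \<in> D \<Longrightarrow> \<bar>f y z\<bar> \<le> C1 * \<rho> z powr m"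
      using weight_bound_nonneg[OF f] by metis
    obtain C2 where C2: "C2 \<ge> 0" "\<And>y z. y \<in> {0..1} \<Longrightarrow> z \<in> D \<Longrightarrow> \<bar>g y z\<bar> \<le> C2 * \<rho> z powr m'"
      using weight_bound_nonneg[OF g] by metis
    show ?thesis
    proof (rule weight_boundI[of _ _ "C1 * C2"])
      fix y :: real and z assume yz: "y \<in> {0..1}" "z \<in> D"
      have "\<bar>f y z * g y z\<bar> \<le> (C1 * \<rho> z powr m) * (C2 * \<rho> z powr m')"
        unfolding abs_mult using C1 C2 yz by (intro mult_mono) auto
      then show "\<bar>f y z * g y z\<bar> \<le> C1 * C2 * \<rho> z powr (m + m')" by (simp add: powr_add mult_ac)
    qed
  qed
  show "weight_bound D \<rho> m' f" if f: "weight_bound D \<rho> m f" and "m' \<le> m" for m m' f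
  proof -
    obtain C where C: "C \<ge> 0" "\<And>y z. y \<in> {0..1} \<Longrightarrow> z \<in> D \<Longrightarrow> \<bar>f y z\<bar> \<le> C * \<rho> z powr m"
      using weight_bound_nonneg[OF f] by metis
    show ?thesis
    proof (rule weight_boundI[of _ _ C])
      fix y :: real and z assume yz: "y \<in> {0..1}" "z \<in> D"
      have "\<rho> z powr m \<le> \<rho> z powr m'" using \<rho>[OF yz(2)] that(2) by (intro powr_mono') auto
      from mult_left_mono[OF this C(1)] C(2)[OF yz] show "\<bar>f y z\<bar> \<le> C * \<rho> z powr m'" by linarith
    qed
  qed
qed (use assms in auto)

text \<open>
  On the boundary a function of order \<open>m > 1\<close> has derivative \<open>0\<close>, because the weight is at most the
  distance to the boundary point. As \<open>c \<ge> 1\<close>, the condition \<open>c k < m\<close> keeps the order of all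
  derivatives but the last above \<open>1\<close>, and that of the last positive, which is enough for continuity.
\<close>

lemma extend_by_zero:
  fixes \<rho> :: "'b::euclidean_space \<Rightarrow> real"
  assumes "open D" and \<rho>: "bounded_linear \<rho>" "\<And>z. \<bar>\<rho> z\<bar> \<le> norm z" and "1 \<le> c"
  defines "P \<equiv> {z \<in> D. 0 < \<rho> z}"
  shows "graded_Ck (weight_bound P \<rho>) c P k m f \<Longrightarrow> c * real k < m \<Longrightarrow>
    param_Ck D k (\<lambda>y z. if 0 < \<rho> z then f y z else 0)"
proof (induction k arbitrary: m f)
  have \<rho>_cont: "continuous_on S \<rho>" for S using \<rho>(1) by (simp add: linear_continuous_on)
  have opP: "open P"
  proof -
    have "P = D \<inter> \<rho> -` {0<..}" by (auto simp: P_def)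
    then show ?thesis using open_vimage[OF open_greaterThan \<rho>_cont] assms(1) by (simp add: open_Int)
  qed
  have op_neg: "open {z. \<rho> z < 0}"
    using open_vimage[OF open_lessThan[of 0] \<rho>_cont] by (simp add: vimage_def)
  have cont: "continuous_on ({0..1} \<times> D) (\<lambda>p. if 0 < \<rho> (snd p) then f (fst p) (snd p) else 0)"
    if cf: "continuous_on ({0..1} \<times> P) (\<lambda>p. f (fst p) (snd p))" and wb: "weight_bound P \<rho> m f" and m: "m > 0" for m f
    unfolding continuous_on_eq_continuous_within
  proof
    fix p :: "real \<times> 'b" assume p: "p \<in> {0..1} \<times> D"
    let ?F = "\<lambda>p. if 0 < \<rho> (snd p) then f (fst p) (snd p) else 0"
    show "continuous (at p within {0..1} \<times> D) ?F"
    proof (cases "0 < \<rho> (snd p)")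
      case True
      then have pP: "p \<in> {0..1} \<times> P" using p by (auto simp: P_def)
      have "continuous_on ({0..1} \<times> P) ?F"
        by (rule continuous_on_eq[OF cf]) (auto simp: P_def)
      then have "(?F \<longlongrightarrow> ?F p) (at p within {0..1} \<times> P)" 
        unfolding continuous_on_def using pP by (rule bspec)
      moreover have "at p within {0..1} \<times> P = at p within {0..1} \<times> D"
        by (rule at_within_nhd[of _ "UNIV \<times> P"]) (use pP opP in \<open>auto intro: open_Times simp: P_def\<close>)
      ultimately show ?thesis by (simp add: continuous_within)
    next
      case False
      obtain C where C: "C \<ge> 0" "\<And>y z. y \<in> {0..1} \<Longrightarrow> z \<in> P \<Longrightarrow> \<bar>f y z\<bar> \<le> C * \<rho> z powr m"
        using weight_bound_nonneg[OF wb] by metis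
      have "((\<lambda>p. C * max 0 (\<rho> (snd p)) powr m) \<longlongrightarrow> C * max 0 (\<rho> (snd p)) powr m) (at p within {0..1} \<times> D)"
      proof (intro tendsto_intros tendsto_powr')
        have "continuous_on UNIV (\<lambda>p::real \<times> 'b. \<rho> (snd p))"
          by (intro bounded_linear.continuous_on[OF \<rho>(1)] continuous_intros)
        then show "((\<lambda>p. \<rho> (snd p)) \<longlongrightarrow> \<rho> (snd p)) (at p within {0..1} \<times> D)"
          by (metis UNIV_I continuous_on_def subset_UNIV tendsto_within_subset)
      qed (use m in auto)
      then have 1: "((\<lambda>p. C * max 0 (\<rho> (snd p)) powr m) \<longlongrightarrow> 0) (at p within {0..1} \<times> D)"
        using False m by simp
      have "(?F \<longlongrightarrow> 0) (at p within {0..1} \<times> D)"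
      proof (rule Lim_null_comparison[OF _ 1])
        show "\<forall>\<^sub>F x in at p within {0..1} \<times> D. norm (?F x) \<le> C * max 0 (\<rho> (snd x)) powr m"
          unfolding eventually_at_filter
          by (rule always_eventually) (use C in \<open>auto simp: P_def\<close>)
      qed
      then show ?thesis using False by (simp add: continuous_within)
    qed
  qed
  {
    case 0
    then have "continuous_on ({0..1} \<times> P) (\<lambda>p. f (fst p) (snd p))" "weight_bound P \<rho> m f" "0 < m" by auto
    from cont[OF this] show ?case by simp
  next
    case (Suc k)
    obtain f' where cf: "continuous_on ({0..1} \<times> P) (\<lambda>p. f (fst p) (snd p))" and wb: "weight_bound P \<rho> m f"
      and f': "\<And>y z. y \<in> {0..1} \<Longrightarrow> z \<in> P \<Longrightarrow> (f y has_derivative f' y z) (at z)"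
      "\<And>h. graded_Ck (weight_bound P \<rho>) c P k (m - c) (\<lambda>y z. f' y z h)"
      using Suc.prems(1) unfolding graded_Ck.simps by blast
    have "1 * 1 \<le> c * real (Suc k)" using assms(4) by (intro mult_mono) auto
    then have m1: "m > 1" using Suc.prems(2) by simp
    show ?case
    proof (rule param_Ck_SucI[of _ _ "\<lambda>y z h. if 0 < \<rho> z then f' y z h else 0"])
      show "continuous_on ({0..1} \<times> D) (\<lambda>p. if 0 < \<rho> (snd p) then f (fst p) (snd p) else 0)"
        by (rule cont[OF cf wb]) (use m1 in simp)
      show "param_Ck D k (\<lambda>y z. if 0 < \<rho> z then f' y z h else 0)" for h
        by (rule Suc.IH[OF f'(2)]) (use Suc.prems(2) in \<open>simp add: algebra_simps\<close>)
      fix y :: real and z assume y: "y \<in> {0..1}" and z: "z \<in> D"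
      let ?F = "\<lambda>z. if 0 < \<rho> z then f y z else 0"
      consider "0 < \<rho> z" | "\<rho> z < 0" | "\<rho> z = 0" by linarith
      then show "(?F has_derivative (\<lambda>h. if 0 < \<rho> z then f' y z h else 0)) (at z)"
      proof cases
        case 1
        then have zP: "z \<in> P" using z by (simp add: P_def)
        have "(?F has_derivative f' y z) (at z)"
          by (rule has_derivative_transform_within_open[OF f'(1)[OF y zP] opP zP]) (simp add: P_def)
        then show ?thesis using 1 by simp
      next
        case 2
        have "(?F has_derivative (\<lambda>_. 0)) (at z)"
          by (rule has_derivative_transform_within_open[OF has_derivative_const[of 0] op_neg]) (use 2 in auto)
        then show ?thesis using 2 by simp
      next
        case 3
        obtain C where C: "C \<ge> 0" "\<And>y z. y \<in> {0..1} \<Longrightarrow> z \<in> P \<Longrightarrow> \<bar>f y z\<bar> \<le> C * \<rho> z powr m"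
          using weight_bound_nonneg[OF wb] by metis
        have bnd: "\<bar>?F w\<bar> \<le> C * norm (w - z) powr m" if w: "w \<in> D" for w
        proof (cases "0 < \<rho> w")
          case True
          have "\<rho> w = \<rho> (w - z)" using 3 bounded_linear.linear[OF \<rho>(1)] by (simp add: linear_diff)
          then have "\<rho> w \<le> norm (w - z)" using \<rho>(2)[of "w - z"] by simp
          then have "\<rho> w powr m \<le> norm (w - z) powr m" using True m1 by (intro powr_mono2) auto
          then have "C * \<rho> w powr m \<le> C * norm (w - z) powr m" using C(1) by (rule mult_left_mono)
          then show ?thesis using C(2)[OF y, of w] True w by (simp add: P_def)
        qed (use C(1) in auto)
        have "(?F has_derivative (\<lambda>_. 0)) (at z)"
          unfolding has_derivative_at_within
        proof (intro conjI)
          have lim: "((\<lambda>w. C * norm (w - z) powr (m - 1)) \<longlongrightarrow> C * norm (z - z) powr (m - 1)) (at z)"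
            by (intro tendsto_intros tendsto_powr') (use m1 in auto)
          then have lim: "((\<lambda>w. C * norm (w - z) powr (m - 1)) \<longlongrightarrow> 0) (at z)" using m1 by simp
          have ev: "\<forall>\<^sub>F w in at z. w \<in> D \<and> w \<noteq> z"
            using eventually_at_in_open[OF assms(1) z] by (auto elim: eventually_mono)
          show "((\<lambda>w. (?F w - ?F z - 0) /\<^sub>R norm (w - z)) \<longlongrightarrow> 0) (at z)"
          proof (rule Lim_null_comparison[OF _ lim])
            show "\<forall>\<^sub>F w in at z. norm ((?F w - ?F z - 0) /\<^sub>R norm (w - z)) \<le> C * norm (w - z) powr (m - 1)"
              using ev
            proof eventually_elim
              case (elim w)
              then have n: "norm (w - z) > 0" by simp
              have "norm ((?F w - ?F z - 0) /\<^sub>R norm (w - z)) = \<bar>?F w\<bar> / norm (w - z)"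
                using 3 by (simp add: divide_inverse abs_mult mult.commute)
              also have "\<dots> \<le> C * norm (w - z) powr m / norm (w - z)"
                using bnd elim by (intro divide_right_mono) auto
              also have "\<dots> = C * norm (w - z) powr (m - 1)"
                using n by (simp add: powr_diff)
              finally show ?case .
            qed
          qed
        qed (auto)
        then show ?thesis using 3 by simp
      qed
    qed
  }
qed

text \<open>
  The entire function \<open>(exp x - 1) / x\<close> and its derivatives, as integrals: in this form they have
  no apparent singularity at \<open>0\<close> and are obviously bounded by \<open>exp |x|\<close>.
\<close>

definition exp_moment :: "nat \<Rightarrow> real \<Rightarrow> real" where
  "exp_moment n x = integral {0..1} (\<lambda>t. t ^ n * exp (t * x))"

lemma exp_moment_deriv: "(exp_moment n has_real_derivative exp_moment (Suc n) x) (at x)"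
proof -
  have "((\<lambda>x. integral (cbox 0 1) (\<lambda>t. t ^ n * exp (t * x))) has_field_derivative
      integral (cbox 0 1) (\<lambda>t. t ^ Suc n * exp (t * x))) (at x within UNIV)"
    by (rule leibniz_rule_field_derivative)
      (auto intro!: derivative_eq_intros continuous_intros integrable_continuous_interval simp: case_prod_beta)
  then show ?thesis by (simp add: exp_moment_def[abs_def])
qed

lemma exp_moment_abs_le: "\<bar>exp_moment n x\<bar> \<le> exp \<bar>x\<bar>"
  unfolding exp_moment_def
proof (rule integral_initial_abs_le)
  fix t :: real assume t: "t \<in> {0..1}"
  have "t * x \<le> \<bar>t\<bar> * \<bar>x\<bar>" by (metis abs_ge_self abs_mult)
  also have "\<dots> \<le> 1 * \<bar>x\<bar>" using t by (intro mult_right_mono) auto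
  finally have "exp (t * x) \<le> exp \<bar>x\<bar>" by simp
  moreover have "t ^ n \<le> 1" using t by (auto intro: power_le_one)
  ultimately have "t ^ n * exp (t * x) \<le> 1 * exp \<bar>x\<bar>" using t by (intro mult_mono) auto
  then show "\<bar>t ^ n * exp (t * x)\<bar> \<le> exp \<bar>x\<bar>" using t by (simp add: abs_mult)
qed (auto intro!: continuous_intros)

lemma exp_moment_0: "exp_moment 0 x = (if x = 0 then 1 else (exp x - 1) / x)"
proof (cases "x = 0")
  case False
  have "((\<lambda>t. exp (t * x)) has_integral (exp (1 * x) / x - exp (0 * x) / x)) {0..1}"
    by (rule fundamental_theorem_of_calculus)
      (use False in \<open>auto intro!: derivative_eq_intros simp flip: has_real_derivative_iff_has_vector_derivative\<close>)
  then show ?thesis using False by (simp add: exp_moment_def integral_unique diff_divide_distrib)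
qed (simp add: exp_moment_def)

section \<open>Polynomial families and the corner domain\<close>

lemma smooth_on_imp_Ck_on: "smooth_on S f \<Longrightarrow> Ck_on k S f"
  by (simp add: smooth_on_def)

lemma smooth_on_bounded:
  assumes "smooth_on \<Lambda> g" "compact K" "K \<subseteq> \<Lambda>"
  shows "\<exists>C\<ge>0. \<forall>x\<in>K. \<bar>g x\<bar> \<le> C"
proof -
  have "continuous_on \<Lambda> g" using smooth_on_imp_Ck_on[OF assms(1), of 0] by simp
  then have "bounded (g ` K)"
    using assms(2,3) by (intro compact_imp_bounded compact_continuous_image) (auto intro: continuous_on_subset)
  then obtain C where "\<forall>x\<in>K. \<bar>g x\<bar> \<le> C" unfolding bounded_iff by auto
  then show ?thesis by (intro exI[of _ "\<bar>C\<bar>"]) (auto intro: order.trans)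
qed

lemma poly_as_sum_upto:
  fixes P :: "'a::comm_semiring_1 poly"
  assumes "degree P \<le> d"
  shows "poly P t = (\<Sum>i\<le>d. coeff P i * t ^ i)"
  unfolding poly_altdef
  by (rule sum.mono_neutral_left) (use assms in \<open>auto simp: coeff_eq_0\<close>)

lemma smooth_poly_family_expand:
  assumes "smooth_poly_family \<Lambda> f"
  obtains d where "\<And>x t. x \<in> \<Lambda> \<Longrightarrow> poly (f x) t = (\<Sum>i\<le>d. coeff (f x) i * t ^ i)"
    "\<And>i. smooth_on \<Lambda> (\<lambda>x. coeff (f x) i)"
  using assms poly_as_sum_upto unfolding smooth_poly_family_def by metis

lemma smooth_poly_family_bounded:
  assumes "smooth_poly_family \<Lambda> f" "compact K" "K \<subseteq> \<Lambda>"
  shows "\<exists>C\<ge>0. \<forall>x\<in>K. \<forall>t\<in>{-1..1}. \<bar>poly (f x) t\<bar> \<le> C"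
proof -
  obtain d where d: "\<And>x t. x \<in> \<Lambda> \<Longrightarrow> poly (f x) t = (\<Sum>i\<le>d. coeff (f x) i * t ^ i)"
    "\<And>i. smooth_on \<Lambda> (\<lambda>x. coeff (f x) i)"
    using smooth_poly_family_expand[OF assms(1)] by metis
  obtain C where C: "\<And>i. C i \<ge> 0" "\<And>i x. x \<in> K \<Longrightarrow> \<bar>coeff (f x) i\<bar> \<le> C i"
    using smooth_on_bounded[OF d(2) assms(2,3)] by metis
  have "\<bar>poly (f x) t\<bar> \<le> (\<Sum>i\<le>d. C i)" if x: "x \<in> K" and t: "t \<in> {-1..1}" for x t
  proof -
    have "\<bar>poly (f x) t\<bar> \<le> (\<Sum>i\<le>d. \<bar>coeff (f x) i * t ^ i\<bar>)"
      unfolding d(1)[OF subsetD[OF assms(3) x]] by (rule sum_abs)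
    also have "\<dots> \<le> (\<Sum>i\<le>d. C i)"
    proof (rule sum_mono)
      fix i
      have "\<bar>t\<bar> ^ i \<le> 1" using t by (intro power_le_one) auto
      then have "\<bar>coeff (f x) i\<bar> * \<bar>t\<bar> ^ i \<le> C i * 1" using C x by (intro mult_mono) auto
      then show "\<bar>coeff (f x) i * t ^ i\<bar> \<le> C i" by (simp add: abs_mult power_abs)
    qed
    finally show ?thesis .
  qed
  then show ?thesis using C(1) by (intro exI[of _ "\<Sum>i\<le>d. C i"]) (auto intro: sum_nonneg)
qed

lemma smooth_poly_family_bounded_linearly:
  assumes "smooth_poly_family \<Lambda> f" "compact K" "K \<subseteq> \<Lambda>" "\<And>x. x \<in> \<Lambda> \<Longrightarrow> poly (f x) 0 = 0"
  shows "\<exists>C\<ge>0. \<forall>x\<in>K. \<forall>t\<in>{-1..1}. \<bar>poly (f x) t\<bar> \<le> C * \<bar>t\<bar>"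
proof -
  obtain d where d: "\<And>x t. x \<in> \<Lambda> \<Longrightarrow> poly (f x) t = (\<Sum>i\<le>d. coeff (f x) i * t ^ i)"
    "\<And>i. smooth_on \<Lambda> (\<lambda>x. coeff (f x) i)"
    using smooth_poly_family_expand[OF assms(1)] by metis
  obtain C where C: "\<And>i. C i \<ge> 0" "\<And>i x. x \<in> K \<Longrightarrow> \<bar>coeff (f x) i\<bar> \<le> C i"
    using smooth_on_bounded[OF d(2) assms(2,3)] by metis
  have "\<bar>poly (f x) t\<bar> \<le> (\<Sum>i\<le>d. C i) * \<bar>t\<bar>" if x: "x \<in> K" and t: "t \<in> {-1..1}" for x t
  proof -
    have "\<bar>poly (f x) t\<bar> \<le> (\<Sum>i\<le>d. \<bar>coeff (f x) i * t ^ i\<bar>)"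
      unfolding d(1)[OF subsetD[OF assms(3) x]] by (rule sum_abs)
    also have "\<dots> \<le> (\<Sum>i\<le>d. C i * \<bar>t\<bar>)"
    proof (rule sum_mono)
      fix i
      show "\<bar>coeff (f x) i * t ^ i\<bar> \<le> C i * \<bar>t\<bar>"
      proof (cases i)
        case 0
        have "coeff (f x) 0 = 0" using assms(3,4) x by (metis poly_0_coeff_0 subsetD)
        then show ?thesis using 0 C(1) by simp
      next
        case (Suc j)
        have "\<bar>t\<bar> ^ j \<le> 1" using t by (intro power_le_one) auto
        then have "\<bar>t\<bar> ^ i \<le> \<bar>t\<bar>" unfolding Suc by (simp add: mult_left_le)
        then have "\<bar>coeff (f x) i\<bar> * \<bar>t\<bar> ^ i \<le> C i * \<bar>t\<bar>" using C x by (intro mult_mono) auto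
        then show ?thesis by (simp add: abs_mult power_abs)
      qed
    qed
    finally show ?thesis by (simp add: sum_distrib_right)
  qed
  then show ?thesis using C(1) by (intro exI[of _ "\<Sum>i\<le>d. C i"]) (auto intro: sum_nonneg)
qed

lemma smooth_poly2_family_expand:
  assumes "smooth_poly2_family \<Lambda> f" "\<forall>x\<in>\<Lambda>. \<forall>\<nu>. poly2 (f x) \<nu> 0 = 0"
  obtains d where "\<And>x \<nu> s. x \<in> \<Lambda> \<Longrightarrow> poly2 (f x) \<nu> s = (\<Sum>j=1..Suc d. poly (coeff (f x) j) \<nu> * s ^ j)"
    "\<And>j. smooth_poly_family \<Lambda> (\<lambda>x. coeff (f x) j)"
proof -
  obtain d where d: "\<And>x. x \<in> \<Lambda> \<Longrightarrow> degree (f x) \<le> d" "\<And>x j. x \<in> \<Lambda> \<Longrightarrow> degree (coeff (f x) j) \<le> d"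
    "\<And>i j. smooth_on \<Lambda> (\<lambda>x. coeff (coeff (f x) j) i)"
    using assms(1) unfolding smooth_poly2_family_def by blast
  have e: "poly2 (f x) \<nu> s = (\<Sum>j\<le>Suc d. poly (coeff (f x) j) \<nu> * s ^ j)" if "x \<in> \<Lambda>" for x \<nu> s
    using d(1)[OF that] by (simp add: poly2_def poly_as_sum_upto[of "f x" "Suc d"] poly_sum poly_power)
  have z: "poly (coeff (f x) 0) \<nu> = 0" if "x \<in> \<Lambda>" for x \<nu>
    using assms(2) that by (simp add: e power_0_left sum.delta if_distrib cong: if_cong)
  have "poly2 (f x) \<nu> s = (\<Sum>j=1..Suc d. poly (coeff (f x) j) \<nu> * s ^ j)" if "x \<in> \<Lambda>" for x \<nu> s
    unfolding e[OF that] using z[OF that]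
    by (intro sum.mono_neutral_right) (auto simp: Suc_le_eq)
  moreover have "smooth_poly_family \<Lambda> (\<lambda>x. coeff (f x) j)" for j
    using d(2,3) unfolding smooth_poly_family_def by blast
  ultimately show ?thesis using that by blast
qed

lemma smooth_poly2_family_bounded_linearly:
  assumes "smooth_poly2_family \<Lambda> f" "\<forall>x\<in>\<Lambda>. \<forall>\<nu>. poly2 (f x) \<nu> 0 = 0" "compact K" "K \<subseteq> \<Lambda>" "1 \<le> S"
  shows "\<exists>C\<ge>0. \<forall>x\<in>K. \<forall>\<nu>\<in>{-1..1}. \<forall>s\<in>{-S..S}. \<bar>poly2 (f x) \<nu> s\<bar> \<le> C * \<bar>s\<bar>"
proof -
  obtain d where d: "\<And>x \<nu> s. x \<in> \<Lambda> \<Longrightarrow> poly2 (f x) \<nu> s = (\<Sum>j=1..Suc d. poly (coeff (f x) j) \<nu> * s ^ j)"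
    "\<And>j. smooth_poly_family \<Lambda> (\<lambda>x. coeff (f x) j)"
    using smooth_poly2_family_expand[OF assms(1,2)] by metis
  obtain C where C: "\<And>j. C j \<ge> 0" "\<And>j x \<nu>. x \<in> K \<Longrightarrow> \<nu> \<in> {-1..1} \<Longrightarrow> \<bar>poly (coeff (f x) j) \<nu>\<bar> \<le> C j"
    using smooth_poly_family_bounded[OF d(2) assms(3,4)] by metis
  have "\<bar>poly2 (f x) \<nu> s\<bar> \<le> (\<Sum>j=1..Suc d. C j * S ^ j) * \<bar>s\<bar>"
    if x: "x \<in> K" and \<nu>: "\<nu> \<in> {-1..1}" and s: "s \<in> {-S..S}" for x \<nu> s
  proof -
    have "\<bar>poly2 (f x) \<nu> s\<bar> \<le> (\<Sum>j=1..Suc d. \<bar>poly (coeff (f x) j) \<nu> * s ^ j\<bar>)"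
      unfolding d(1)[OF subsetD[OF assms(4) x]] by (rule sum_abs)
    also have "\<dots> \<le> (\<Sum>j=1..Suc d. C j * S ^ j * \<bar>s\<bar>)"
    proof (rule sum_mono)
      fix j assume "j \<in> {1..Suc d}"
      then obtain i where i: "j = Suc i" by (cases j) auto
      have "\<bar>s\<bar> ^ i \<le> S ^ i" using s by (intro power_mono) auto
      also have "\<dots> \<le> S ^ j" unfolding i using assms(5) by (intro power_increasing) auto
      finally have "\<bar>s\<bar> ^ j \<le> S ^ j * \<bar>s\<bar>" unfolding i power_Suc2[of "\<bar>s\<bar>"] by (intro mult_right_mono) auto
      then have "\<bar>poly (coeff (f x) j) \<nu>\<bar> * \<bar>s\<bar> ^ j \<le> C j * (S ^ j * \<bar>s\<bar>)"
        using C x \<nu> by (intro mult_mono) auto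
      then show "\<bar>poly (coeff (f x) j) \<nu> * s ^ j\<bar> \<le> C j * S ^ j * \<bar>s\<bar>" by (simp add: abs_mult power_abs)
    qed
    finally show ?thesis by (simp only: sum_distrib_right)
  qed
  moreover have "0 \<le> (\<Sum>j=1..Suc d. C j * S ^ j)"
    using assms(5) by (intro sum_nonneg mult_nonneg_nonneg C(1) zero_le_power) simp
  ultimately show ?thesis by blast
qed

text \<open>
  Points \<open>(a, Y, r, w, v, \<mu>, \<sigma>)\<close>. The first entry is the unknown of the remainder equation and
  \<open>r\<close> is a root of \<open>u\<close>; \<open>w\<close> is the place of the product of that root with the compensator.
\<close>

type_synonym 'm corner_point = "real \<times> real \<times> real \<times> real \<times> real \<times> 'm \<times> real"

definition cA :: "'m corner_point \<Rightarrow> real" where "cA z = fst z"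
definition cY :: "'m corner_point \<Rightarrow> real" where "cY z = fst (snd z)"
definition cR :: "'m corner_point \<Rightarrow> real" where "cR z = fst (snd (snd z))"
definition cV :: "'m corner_point \<Rightarrow> real" where "cV z = fst (snd (snd (snd (snd z))))"
definition cX :: "'m corner_point \<Rightarrow> 'm \<times> real" where "cX z = snd (snd (snd (snd (snd z))))"

lemmas coord_defs = cA_def cY_def cR_def cV_def cX_def

lemma bounded_linear_coords:
  "bounded_linear (cA :: _ \<times> _ \<times> _ \<times> _ \<times> _ \<times> 'm::euclidean_space \<times> _ \<Rightarrow> _)"
  "bounded_linear (cY :: _ \<times> _ \<times> _ \<times> _ \<times> _ \<times> 'm::euclidean_space \<times> _ \<Rightarrow> _)"
  "bounded_linear (cR :: _ \<times> _ \<times> _ \<times> _ \<times> _ \<times> 'm::euclidean_space \<times> _ \<Rightarrow> _)"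
  "bounded_linear (cV :: _ \<times> _ \<times> _ \<times> _ \<times> _ \<times> 'm::euclidean_space \<times> _ \<Rightarrow> _)"
  "bounded_linear (cX :: _ \<times> _ \<times> _ \<times> _ \<times> _ \<times> 'm::euclidean_space \<times> _ \<Rightarrow> _)"
  unfolding linear_conv_bounded_linear[symmetric] by (rule linearI; simp add: coord_defs)+

lemma cR_le_norm: "\<bar>cR (z :: _ \<times> _ \<times> _ \<times> _ \<times> _ \<times> 'm::euclidean_space \<times> _)\<bar> \<le> norm z"
proof -
  have "norm (fst (snd (snd z))) \<le> norm (snd (snd z))"
    using norm_fst_le[of "fst (snd (snd z))" "snd (snd (snd z))"] by simp
  also have "\<dots> \<le> norm (snd z)" using norm_snd_le[of "snd (snd z)" "fst (snd z)"] by simp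
  also have "\<dots> \<le> norm z" using norm_snd_le[of "snd z" "fst z"] by simp
  finally show ?thesis by (simp add: cR_def)
qed

definition corner_box :: "('m::euclidean_space \<times> real) set \<Rightarrow> 'm corner_point set" where
  "corner_box N = {z. \<bar>cA z\<bar> < 1 \<and> \<bar>cY z\<bar> < 1 \<and> 0 < cR z \<and> cR z < 1 \<and> \<bar>cV z\<bar> < 1 \<and> cX z \<in> N}"

lemma open_corner_box: "open N \<Longrightarrow> open (corner_box N)"
proof -
  assume N: "open N"
  note c = bounded_linear_coords[THEN linear_continuous_on, of UNIV]
  have "open (cX -` N :: 'a corner_point set)"
    using open_vimage[OF N c(5)] .
  moreover have "corner_box N = {z. \<bar>cA z\<bar> < 1} \<inter> {z. \<bar>cY z\<bar> < 1} \<inter> {z. 0 < cR z} \<inter> {z. cR z < 1} \<inter> {z. \<bar>cV z\<bar> < 1} \<inter> (cX -` N)"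
    by (auto simp: corner_box_def)
  moreover have "open {z :: 'a corner_point. \<bar>cA z\<bar> < 1}" "open {z :: 'a corner_point. \<bar>cY z\<bar> < 1}"
    "open {z :: 'a corner_point. 0 < cR z}" "open {z :: 'a corner_point. cR z < 1}"
    "open {z :: 'a corner_point. \<bar>cV z\<bar> < 1}"
    by (intro open_Collect_less continuous_intros c)+
  ultimately show ?thesis by (simp add: open_Int)
qed

section \<open>The remainder equation of a resonant family\<close>

text \<open>
  The hypotheses of the rational case at \<open>\<sigma>0 = p / q\<close>; the parameter \<open>(\<mu>, \<sigma>)\<close> is written \<open>x\<close>.
\<close>

locale resonant_family =
  fixes \<Lambda> :: "('m::euclidean_space \<times> real) set" and \<phi> \<eta> :: "'m \<times> real \<Rightarrow> real poly"
    and \<Phi> :: "'m \<times> real \<Rightarrow> real poly poly" and p q :: nat and \<sigma>0 u0 :: real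
  assumes open_params: "open \<Lambda>" and u0_pos: "0 < u0" and p_pos: "0 < p" and q_pos: "0 < q"
    and coprime: "coprime p q" and \<sigma>0_eq: "\<sigma>0 = real p / real q"
    and smooth_\<phi>: "smooth_poly_family \<Lambda> \<phi>" and \<phi>_0: "\<And>x. x \<in> \<Lambda> \<Longrightarrow> poly (\<phi> x) 0 = 0"
    and smooth_\<Phi>: "smooth_poly2_family \<Lambda> \<Phi>" and \<Phi>_0: "\<forall>x\<in>\<Lambda>. \<forall>\<nu>. poly2 (\<Phi> x) \<nu> 0 = 0"
    and smooth_\<eta>: "smooth_poly_family \<Lambda> \<eta>" and \<eta>_0: "\<sigma>0 \<notin> \<nat> \<longrightarrow> (\<forall>x\<in>\<Lambda>. \<eta> x = 0)"
begin

definition "alpha x \<nu> = sigma_bar \<phi> x \<nu> - \<sigma>0"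

definition "transit_time u = ln u0 - ln u"

text \<open>
  The value of \<open>exp (\<sigma>_bar t) Y\<close> at \<open>t = \<tau> y\<close> for the equation without \<open>\<Phi>\<close>. The last factor is
  the integral of \<open>exp (\<alpha> s)\<close> over \<open>0 \<le> s \<le> t\<close>.
\<close>

definition "drift x u v Y y = Y + poly (\<eta> x) (u * v) * v ^ p *
   (transit_time u * y * exp_moment 0 (alpha x (u * v) * transit_time u * y))"

text \<open>
  The resonant monomial \<open>u^p Y^q\<close> along the trajectory, when \<open>exp (\<sigma>_bar t) Y\<close> is \<open>a\<close> more than the drift.
\<close>

definition "resonant_term x u v Y y a =
   u ^ p * exp (- real q * (alpha x (u * v) * transit_time u * y)) * (drift x u v Y y + a) ^ q"

definition "remainder_rhs x u v Y y a =
   transit_time u * poly2 (\<Phi> x) (u * v) (resonant_term x u v Y y a) * (drift x u v Y y + a)"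

lemma alpha_eq: "alpha x \<nu> = (snd x - \<sigma>0) + poly (\<phi> x) \<nu>"
  by (simp add: alpha_def sigma_bar_def)

text \<open>
  Only \<open>\<sigma> - \<sigma>0\<close> makes \<open>\<alpha> \<tau>\<close> unbounded: the rest of \<open>\<alpha>\<close> is \<open>O(\<nu>)\<close>, hence \<open>O(u)\<close>, and
  \<open>u ln u\<close> is bounded. So the neighbourhood of the corner need not shrink when that of \<open>\<sigma>0\<close> does.
\<close>

lemma alpha_transit_time_bound:
  assumes "compact K" "K \<subseteq> \<Lambda>"
  shows "\<exists>C\<ge>0. \<forall>x\<in>K. \<forall>u\<in>{0<..<1}. \<forall>v\<in>{-1..1}.
    \<bar>alpha x (u * v) * transit_time u\<bar> \<le> \<bar>snd x - \<sigma>0\<bar> * (- ln u) + C"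
proof -
  obtain M where M: "M \<ge> 0" "\<And>x t. x \<in> K \<Longrightarrow> t \<in> {-1..1} \<Longrightarrow> \<bar>poly (\<phi> x) t\<bar> \<le> M * \<bar>t\<bar>"
    using smooth_poly_family_bounded_linearly[OF smooth_\<phi> assms \<phi>_0] by metis
  have "bounded (snd ` K)" by (rule bounded_snd[OF compact_imp_bounded[OF assms(1)]])
  then obtain S where S: "\<And>x. x \<in> K \<Longrightarrow> \<bar>snd x\<bar> \<le> S" unfolding bounded_iff by auto
  have S': "\<bar>snd x - \<sigma>0\<bar> \<le> \<bar>S\<bar> + \<bar>\<sigma>0\<bar>" if "x \<in> K" for x using S[OF that] by linarith
  define C where "C = (\<bar>S\<bar> + \<bar>\<sigma>0\<bar>) * \<bar>ln u0\<bar> + M * (\<bar>ln u0\<bar> + 1)"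
  have "\<bar>alpha x (u * v) * transit_time u\<bar> \<le> \<bar>snd x - \<sigma>0\<bar> * (- ln u) + C"
    if x: "x \<in> K" and u: "u \<in> {0<..<1}" and v: "v \<in> {-1..1}" for x u v
  proof -
    have lnu: "ln u < 0" using u by simp
    have t: "\<bar>transit_time u\<bar> \<le> \<bar>ln u0\<bar> + (- ln u)" using lnu by (simp add: transit_time_def)
    have uv: "\<bar>u * v\<bar> \<le> u" using u v by (auto simp: abs_mult intro: mult_left_le)
    then have uv1: "u * v \<in> {-1..1}" using u by auto
    have "\<bar>poly (\<phi> x) (u * v)\<bar> \<le> M * u"
      using M(2)[OF x uv1] mult_left_mono[OF uv M(1)] by linarith
    then have "\<bar>poly (\<phi> x) (u * v) * transit_time u\<bar> \<le> (M * u) * (\<bar>ln u0\<bar> + (- ln u))"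
      unfolding abs_mult using t u M(1) by (intro mult_mono) auto
    also have "\<dots> = M * (u * \<bar>ln u0\<bar> + u * (- ln u))" by (simp add: algebra_simps)
    also have "\<dots> \<le> M * (\<bar>ln u0\<bar> + 1)"
    proof (intro mult_left_mono add_mono M(1))
      show "u * \<bar>ln u0\<bar> \<le> \<bar>ln u0\<bar>" using u by (intro mult_left_le_one_le) auto
      have "ln (1 / u) \<le> 1 / u" using ln_bound[of "1 / u"] u by simp
      then have "u * ln (1 / u) \<le> u * (1 / u)" using u by (intro mult_left_mono) auto
      then show "u * (- ln u) \<le> 1" using u by (simp add: ln_div)
    qed
    finally have 1: "\<bar>poly (\<phi> x) (u * v) * transit_time u\<bar> \<le> M * (\<bar>ln u0\<bar> + 1)" .
    have "\<bar>(snd x - \<sigma>0) * transit_time u\<bar> \<le> \<bar>snd x - \<sigma>0\<bar> * (\<bar>ln u0\<bar> + (- ln u))"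
      unfolding abs_mult using t by (intro mult_left_mono) auto
    also have "\<dots> = \<bar>snd x - \<sigma>0\<bar> * \<bar>ln u0\<bar> + \<bar>snd x - \<sigma>0\<bar> * (- ln u)" by (simp add: algebra_simps)
    also have "\<dots> \<le> (\<bar>S\<bar> + \<bar>\<sigma>0\<bar>) * \<bar>ln u0\<bar> + \<bar>snd x - \<sigma>0\<bar> * (- ln u)"
      using S'[OF x] by (intro add_right_mono mult_right_mono) auto
    finally have 2: "\<bar>(snd x - \<sigma>0) * transit_time u\<bar> \<le> (\<bar>S\<bar> + \<bar>\<sigma>0\<bar>) * \<bar>ln u0\<bar> + \<bar>snd x - \<sigma>0\<bar> * (- ln u)" .
    have "alpha x (u * v) * transit_time u = (snd x - \<sigma>0) * transit_time u + poly (\<phi> x) (u * v) * transit_time u"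
      by (simp add: alpha_eq algebra_simps)
    then show ?thesis using 1 2 unfolding C_def by linarith
  qed
  moreover have "C \<ge> 0" using M(1) by (simp add: C_def)
  ultimately show ?thesis by blast
qed

text \<open>
  The right hand side, written in terms of the root \<open>r\<close> of \<open>u\<close>, is put together from the following orders in
  \<open>r\<close>: \<open>1\<close> for \<open>r\<close>, \<open>- e\<close> for the transit time, which is logarithmic, and \<open>- e\<close> for the
  functions of \<open>\<alpha> \<tau> y\<close>, which by the choice of \<open>a0\<close> are at most \<open>r powr (- e)\<close> up to a constant.
  Hence \<open>- 2 e\<close> for the drift, \<open>l p - (2 q + 1) e\<close> for the resonant term and three
  times \<open>- e\<close> more for the right hand side. A derivative costs at most \<open>1 + e\<close>: one for a
  derivative in \<open>r\<close> and \<open>e\<close> for the logarithm that comes down from the exponentials.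
\<close>

lemma remainder_rhs_graded:
  fixes N K :: "('m \<times> real) set" and l k :: nat and e a0 :: real
  assumes N: "open N" "N \<subseteq> K" "compact K" "K \<subseteq> \<Lambda>"
    and a0: "\<And>x. x \<in> N \<Longrightarrow> \<bar>snd x - \<sigma>0\<bar> \<le> a0" and l: "0 < l"
    and e: "0 < e" "real l * real q * a0 \<le> e" "(2 * real q + 1) * e \<le> real l * real p"
  shows "graded_Ck (weight_bound (corner_box N) cR) (1 + e) (corner_box N) k (real l * real p - (2 * real q + 4) * e)
      (\<lambda>y z. remainder_rhs (cX z) (cR z ^ l) (cV z) (cY z) y (cA z))"
    and "weight_bound (corner_box N) cR 0 (\<lambda>y z. resonant_term (cX z) (cR z ^ l) (cV z) (cY z) y (cA z))"
proof -
  define D :: "'m corner_point set" where "D = corner_box N"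
  have D: "\<bar>cA z\<bar> < 1" "\<bar>cY z\<bar> < 1" "0 < cR z" "cR z < 1" "\<bar>cV z\<bar> < 1" "cX z \<in> N" if "z \<in> D" for z
    using that by (auto simp: D_def corner_box_def)
  have r01: "0 < cR z \<and> cR z \<le> 1" and abs1: "\<bar>cR z\<bar> \<le> 1" "\<bar>cV z\<bar> \<le> 1" "\<bar>cY z\<bar> \<le> 1" "\<bar>cA z\<bar> \<le> 1"
    and r0: "cR z \<noteq> 0" "0 \<le> cR z" if "z \<in> D" for z
    using D[OF that] by simp_all
  have opD: "open D" unfolding D_def by (rule open_corner_box[OF N(1)])
  define c where "c = 1 + e"
  have c: "1 \<le> c" using e(1) by (simp add: c_def)
  let ?B = "weight_bound D cR"
  have gb: "graded_bound D ?B c" by (rule graded_bound_weight[OF opD _ r01]) (use c in simp)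
  have gb0: "graded_bound D ?B 0" by (rule graded_bound_weight[OF opD _ r01]) simp
  interpret W: graded_bound D ?B c by (rule gb)
  \<comment> \<open>Without loss, for the functions that are smooth up to \<open>r = 0\<close>: the sharper class is
      needed for \<open>\<alpha>\<close>, whose derivatives occur as inner derivatives in the chain rule.\<close>
  interpret L: graded_bound D ?B 0 by (rule gb0)
  have LW: "L.Cg k m f \<Longrightarrow> W.Cg k m f" for k m f
    using graded_Ck_loss_mono[OF gb, of 0] c by simp
  have lin0: "L.Cg k 0 (\<lambda>_. f)" if "bounded_linear f" "\<And>z. z \<in> D \<Longrightarrow> \<bar>f z\<bar> \<le> 1" for f k
    by (rule L.Cg_linear[OF that(1) L.bound_bounded[of _ 1]]) (use that(2) in auto)
  have rL: "L.Cg k 0 (\<lambda>_. cR)" and vL: "L.Cg k 0 (\<lambda>_. cV)" and YL: "L.Cg k 0 (\<lambda>_. cY)" and aL: "L.Cg k 0 (\<lambda>_. cA)" for k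
    by (rule lin0[OF bounded_linear_coords(3) abs1(1)] lin0[OF bounded_linear_coords(4) abs1(2)]
        lin0[OF bounded_linear_coords(2) abs1(3)] lin0[OF bounded_linear_coords(1) abs1(4)], assumption)+
  have r_bound: "?B 1 (\<lambda>_. cR)" by (rule weight_boundI[of _ _ 1]) (use r01 in simp)
  have rW: "W.Cg k 1 (\<lambda>_. cR)" for k
    by (rule W.Cg_linear[OF bounded_linear_coords(3) r_bound]) (use c in simp)
  have uW: "W.Cg k (real l) (\<lambda>_ z. cR z ^ l)" for k
    using W.Cg_power[OF rW, of k l] by simp
  have \<nu>L: "L.Cg k 0 (\<lambda>_ z. cR z ^ l * cV z)" for k
    using L.Cg_mult[OF L.Cg_power[OF rL, of k l] vL] by simp
  have polyL: "L.Cg k 0 (\<lambda>_ z. poly (f (cX z)) (cR z ^ l * cV z))" if f: "smooth_poly_family \<Lambda> f" for f k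
  proof -
    obtain d where d: "\<And>x t. x \<in> \<Lambda> \<Longrightarrow> poly (f x) t = (\<Sum>i\<le>d. coeff (f x) i * t ^ i)"
      "\<And>i. smooth_on \<Lambda> (\<lambda>x. coeff (f x) i)"
      using smooth_poly_family_expand[OF f] by metis
    have "L.Cg k 0 (\<lambda>_ z. coeff (f (cX z)) i * (cR z ^ l * cV z) ^ i)" for i
    proof -
      have "L.Cg k 0 (\<lambda>_ z. (\<lambda>x. coeff (f x) i) (cX z))"
        by (rule L.Cg_parameter[OF N(3,4) bounded_linear_coords(5) _ smooth_on_imp_Ck_on[OF d(2)]])
          (use D N in blast)
      from L.Cg_mult[OF this L.Cg_power[OF \<nu>L, of k i]] show ?thesis by simp
    qed
    then have "L.Cg k 0 (\<lambda>_ z. \<Sum>i\<le>d. coeff (f (cX z)) i * (cR z ^ l * cV z) ^ i)"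
      by (intro L.Cg_sum) auto
    then show ?thesis
      by (rule L.Cg_cong) (metis D(6) N(2,4) d(1) subsetD)
  qed
  have \<alpha>L: "L.Cg k 0 (\<lambda>_ z. alpha (cX z) (cR z ^ l * cV z))" for k
  proof -
    have "L.Cg k 0 (\<lambda>_ z. (\<lambda>z. snd (cX z)) z)"
    proof (rule L.Cg_linear)
      show "bounded_linear (\<lambda>z::'m corner_point. snd (cX z))"
        unfolding linear_conv_bounded_linear[symmetric] by (rule linearI) (simp_all add: cX_def)
      have "\<bar>snd (cX z)\<bar> \<le> a0 + \<bar>\<sigma>0\<bar>" if "z \<in> D" for z using a0[OF D(6)[OF that]] by linarith
      then show "?B 0 (\<lambda>_ z. snd (cX z))" by (intro L.bound_bounded) auto
    qed simp
    then have "L.Cg k 0 (\<lambda>_ z. (snd (cX z) + (- \<sigma>0)) + poly (\<phi> (cX z)) (cR z ^ l * cV z))"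
      by (intro L.Cg_add L.Cg_const polyL smooth_\<phi>)
    then show ?thesis by (simp add: alpha_eq)
  qed
  have inv: "W.Cg k (- 1) (\<lambda>_ z. 1 / cR z)" for k
  proof (induction k)
    case 0
    have "?B (- 1) (\<lambda>_ z. 1 / cR z)"
      by (rule weight_boundI[of _ _ 1]) (use r01 in \<open>simp add: powr_minus divide_inverse\<close>)
    moreover have "continuous_on ({0..1::real} \<times> D) (\<lambda>p. 1 / cR (snd p))"
      by (intro continuous_intros bounded_linear.continuous_on[OF bounded_linear_coords(3)]) (use r0 in auto)
    ultimately show ?case by simp
  next
    case (Suc k)
    show ?case
    proof (rule W.Cg_SucI[of _ _ "\<lambda>_ z h. (- cR h) * ((1 / cR z) * (1 / cR z))"])
      show "continuous_on ({0..1::real} \<times> D) (\<lambda>p. 1 / cR (snd p))" using W.Cg_continuous[OF Suc] .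
      show "?B (- 1) (\<lambda>_ z. 1 / cR z)" using W.Cg_bound[OF Suc] .
      show "((\<lambda>z. 1 / cR z) has_derivative (\<lambda>h. (- cR h) * ((1 / cR z) * (1 / cR z)))) (at z)" if "z \<in> D" for z
        using D(3)[OF that]
        by (auto intro!: derivative_eq_intros bounded_linear_imp_has_derivative[OF bounded_linear_coords(3)]
            simp: divide_inverse)
      show "W.Cg k (- 1 - c) (\<lambda>_ z. (- cR h) * ((1 / cR z) * (1 / cR z)))" for h
        by (rule W.Cg_mono[OF W.Cg_cmult[OF W.Cg_mult[OF Suc Suc]]]) (use c in simp)
    qed
  qed
  \<comment> \<open>The bound \<open>ln x \<le> x\<close> at \<open>x = r powr (- e)\<close>.\<close>
  have ln_bound_r: "- ln r \<le> (1 / e) * r powr (- e)" if "0 < r" "r < 1" for r :: real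
  proof -
    have "ln (r powr (- e)) \<le> r powr (- e)" by (rule ln_bound) (use that in simp)
    then have "e * (- ln r) \<le> r powr (- e)" using that by (simp add: ln_powr)
    then show ?thesis using e(1) by (simp add: field_simps)
  qed
  have lnB: "?B (- e) (\<lambda>_ z. ln (cR z))"
  proof (rule weight_boundI)
    fix z assume z: "z \<in> D"
    have "ln (cR z) \<le> 0" using D(3,4)[OF z] by simp
    then show "\<bar>ln (cR z)\<bar> \<le> (1 / e) * cR z powr (- e)" using ln_bound_r[OF D(3)[OF z] D(4)[OF z]] by linarith
  qed
  have lnder: "((\<lambda>z. ln (cR z)) has_derivative (\<lambda>h. cR h * (1 / cR z))) (at z)" if "z \<in> D" for z
    using D(3)[OF that]
    by (auto intro!: derivative_eq_intros bounded_linear_imp_has_derivative[OF bounded_linear_coords(3)]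
          simp: divide_inverse)
  have lncont: "continuous_on ({0..1::real} \<times> D) (\<lambda>p. ln (cR (snd p)))"
    by (intro continuous_intros bounded_linear.continuous_on[OF bounded_linear_coords(3)]) (use r0 in auto)
  have lnW: "W.Cg k (- e) (\<lambda>_ z. ln (cR z))" for k
  proof (cases k)
    case 0 then show ?thesis using lncont lnB by simp
  next
    case (Suc k')
    show ?thesis unfolding Suc
      by (rule W.Cg_SucI[OF lncont lnB lnder W.Cg_mono[OF W.Cg_cmult[OF inv]]]) (auto simp: c_def e(1) less_imp_le)
  qed
  define T where "T = (\<lambda>z :: 'm corner_point. transit_time (cR z ^ l))"
  have T_eq: "T z = ln u0 + (- real l) * ln (cR z)" if "z \<in> D" for z
    using D(3)[OF that] by (simp add: T_def transit_time_def ln_realpow)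
  have TW: "W.Cg k (- e) (\<lambda>_. T)" for k
  proof -
    have "W.Cg k (- e) (\<lambda>_ z. ln u0 + (- real l) * ln (cR z))"
      by (intro W.Cg_add W.Cg_cmult lnW W.Cg_mono[OF W.Cg_const]) (use e(1) in simp)
    then show ?thesis by (rule W.Cg_cong) (simp add: T_eq)
  qed
  have Tder: "(T has_derivative (\<lambda>h. (- real l) * (cR h * (1 / cR z)))) (at z)" if "z \<in> D" for z
  proof -
    have "((\<lambda>z. ln u0 + (- real l) * ln (cR z)) has_derivative (\<lambda>h. 0 + (- real l) * (cR h * (1 / cR z)))) (at z)"
      by (intro has_derivative_add has_derivative_const has_derivative_mult_right lnder that)
    then have "((\<lambda>z. ln u0 + (- real l) * ln (cR z)) has_derivative (\<lambda>h. (- real l) * (cR h * (1 / cR z)))) (at z)" by simp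
    then show ?thesis by (rule has_derivative_transform_within_open[OF _ opD that]) (simp add: T_eq)
  qed
  define al where "al = (\<lambda>z :: 'm corner_point. alpha (cX z) (cR z ^ l * cV z))"
  have alL: "L.Cg k 0 (\<lambda>_. al)" for k using \<alpha>L by (simp add: al_def)
  define g where "g = (\<lambda>y z. al z * T z * y)"
  obtain C0 where C0: "C0 \<ge> 0" "\<And>x u v. x \<in> K \<Longrightarrow> u \<in> {0<..<1} \<Longrightarrow> v \<in> {-1..1} \<Longrightarrow>
    \<bar>alpha x (u * v) * transit_time u\<bar> \<le> \<bar>snd x - \<sigma>0\<bar> * (- ln u) + C0"
    using alpha_transit_time_bound[OF N(3,4)] by metis
  have g_bound: "exp (real q * \<bar>g y z\<bar>) \<le> exp (real q * C0) * cR z powr (- e)" if y: "y \<in> {0..1}" and z: "z \<in> D" for y z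
  proof -
    have u: "cR z ^ l \<in> {0<..<1}" using D[OF z] l by (auto simp: power_less_one_iff)
    have lnr: "- ln (cR z) \<ge> 0" using D[OF z] by simp
    have "\<bar>g y z\<bar> = \<bar>al z * T z\<bar> * y" using y by (simp add: g_def abs_mult)
    also have "\<dots> \<le> \<bar>al z * T z\<bar>" using y by (intro mult_left_le) auto
    also have "\<dots> \<le> \<bar>snd (cX z) - \<sigma>0\<bar> * (- ln (cR z ^ l)) + C0"
      unfolding al_def T_def by (rule C0(2)) (use D[OF z] N(2) u in auto)
    also have "\<dots> \<le> a0 * (real l * (- ln (cR z))) + C0"
      using a0[OF D(6)[OF z]] D(3)[OF z] lnr
      by (intro add_right_mono mult_mono) (auto simp: ln_realpow mult_le_0_iff)
    finally have "real q * \<bar>g y z\<bar> \<le> real q * (a0 * (real l * (- ln (cR z))) + C0)" by (intro mult_left_mono) auto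
    also have "\<dots> = (real l * real q * a0) * (- ln (cR z)) + real q * C0" by (simp add: algebra_simps)
    also have "\<dots> \<le> e * (- ln (cR z)) + real q * C0"
      by (intro add_right_mono mult_right_mono e(2) lnr)
    finally have "exp (real q * \<bar>g y z\<bar>) \<le> exp (real q * C0) * exp (- e * ln (cR z))"
      by (simp flip: exp_add add: add.commute)
    then show ?thesis using D(3)[OF z] by (simp add: powr_def)
  qed
  have gW: "W.Cg k (- e) g" for k
    using W.Cg_mult[OF W.Cg_mult[OF LW[OF alL] TW] W.Cg_time] by (simp add: g_def)
  have chain: "W.Cg k (- e) (\<lambda>y z. f n (s * g y z))"
    if f: "\<And>n x. (f n has_real_derivative f (Suc n) x) (at x)" and fb: "\<And>n x. \<bar>f n x\<bar> \<le> exp \<bar>x\<bar>"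
      and s: "\<bar>s\<bar> \<le> real q" for f :: "nat \<Rightarrow> real \<Rightarrow> real" and n s k
  proof -
    obtain al' where al': "\<And>y z. y \<in> {0..1::real} \<Longrightarrow> z \<in> D \<Longrightarrow> (al has_derivative al' y z) (at z)"
      "\<And>h. L.Cg k 0 (\<lambda>y z. al' y z h)"
      using L.Cg_SucE[OF alL[of "Suc k"]] by (metis diff_zero)
    have "W.Cg (Suc k) (- e) (\<lambda>y z. f n (s * g y z))"
    proof (rule W.Cg_chain[of f, OF f, where g' = "\<lambda>y z h. s * ((al z * ((- real l) * (cR h * (1 / cR z))) + al' y z h * T z) * y)"])
      show "continuous_on ({0..1} \<times> D) (\<lambda>p. s * g (fst p) (snd p))"
        by (intro continuous_intros W.Cg_continuous[OF gW])
      fix y :: real and z assume yz: "y \<in> {0..1}" "z \<in> D"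
      show "((\<lambda>z. s * g y z) has_derivative (\<lambda>h. s * ((al z * ((- real l) * (cR h * (1 / cR z))) + al' y z h * T z) * y))) (at z)"
        unfolding g_def
        by (intro has_derivative_mult_right has_derivative_mult_left has_derivative_mult al'(1) Tder yz)
    next
      fix h
      show "W.Cg k (- c) (\<lambda>y z. s * ((al z * ((- real l) * (cR h * (1 / cR z))) + al' y z h * T z) * y))"
      proof (rule W.Cg_cmult)
        have "W.Cg k (- c) (\<lambda>y z. al z * ((- real l) * (cR h * (1 / cR z))))"
          by (rule W.Cg_mono[OF W.Cg_mult[OF LW[OF alL] W.Cg_cmult[OF W.Cg_cmult[OF inv]]]]) (use c in simp)
        moreover have "W.Cg k (- c) (\<lambda>y z. al' y z h * T z)"
          by (rule W.Cg_mono[OF W.Cg_mult[OF LW[OF al'(2)] TW]]) (simp add: c_def)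
        ultimately have "W.Cg k (- c) (\<lambda>y z. al z * ((- real l) * (cR h * (1 / cR z))) + al' y z h * T z)"
          by (rule W.Cg_add)
        from W.Cg_mult[OF this W.Cg_time]
        show "W.Cg k (- c) (\<lambda>y z. (al z * ((- real l) * (cR h * (1 / cR z))) + al' y z h * T z) * y)" by simp
      qed
    next
      fix n
      show "?B (- e) (\<lambda>y z. f n (s * g y z))"
      proof (rule weight_boundI)
        fix y :: real and z assume yz: "y \<in> {0..1}" "z \<in> D"
        have "\<bar>f n (s * g y z)\<bar> \<le> exp \<bar>s * g y z\<bar>" by (rule fb)
        also have "\<bar>s * g y z\<bar> \<le> real q * \<bar>g y z\<bar>" unfolding abs_mult using s by (rule mult_right_mono) simp
        then have "exp \<bar>s * g y z\<bar> \<le> exp (real q * \<bar>g y z\<bar>)" by simp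
        also note g_bound[OF yz]
        finally show "\<bar>f n (s * g y z)\<bar> \<le> exp (real q * C0) * cR z powr (- e)" .
      qed
    qed
    then show ?thesis by (rule W.Cg_Suc)
  qed
  have expW: "W.Cg k (- e) (\<lambda>y z. exp (- real q * g y z))" for k
    using chain[of "\<lambda>_. exp" "- real q" k] by (auto intro: DERIV_exp)
  have momW: "W.Cg k (- e) (\<lambda>y z. exp_moment 0 (g y z))" for k
    using chain[of exp_moment 1 k 0] exp_moment_deriv exp_moment_abs_le q_pos by auto
  define dr where "dr = (\<lambda>y z. drift (cX z) (cR z ^ l) (cV z) (cY z) y + cA z)"
  have drW: "W.Cg k (- (2 * e)) dr" for k
  proof -
    have "W.Cg k (0 + real p * 0 + (- e + 0 + - e)) (\<lambda>y z. poly (\<eta> (cX z)) (cR z ^ l * cV z) * cV z ^ p * (T z * y * exp_moment 0 (g y z)))"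
      by (intro W.Cg_mult W.Cg_power LW[OF polyL[OF smooth_\<eta>]] LW[OF vL] TW W.Cg_time momW)
    then have "W.Cg k (- (2 * e)) (\<lambda>y z. poly (\<eta> (cX z)) (cR z ^ l * cV z) * cV z ^ p * (T z * y * exp_moment 0 (g y z)))"
      by simp
    then have "W.Cg k (- (2 * e)) (\<lambda>y z. cY z + poly (\<eta> (cX z)) (cR z ^ l * cV z) * cV z ^ p * (T z * y * exp_moment 0 (g y z)) + cA z)"
      by (intro W.Cg_add W.Cg_mono[OF LW[OF YL]] W.Cg_mono[OF LW[OF aL]]) (use e(1) in simp_all)
    then show ?thesis by (simp add: dr_def drift_def g_def al_def T_def)
  qed
  define ms where "ms = real l * real p - (2 * real q + 1) * e"
  define rt where "rt = (\<lambda>y z. resonant_term (cX z) (cR z ^ l) (cV z) (cY z) y (cA z))"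
  have rtW: "W.Cg k ms rt" for k
  proof -
    have "W.Cg k (real p * real l + (- e) + real q * (- (2 * e))) (\<lambda>y z. (cR z ^ l) ^ p * exp (- real q * g y z) * dr y z ^ q)"
      by (intro W.Cg_mult W.Cg_power uW expW drW)
    then show ?thesis
      by (simp add: rt_def resonant_term_def ms_def g_def al_def T_def dr_def algebra_simps)
  qed
  obtain d where d: "\<And>x \<nu> s. x \<in> \<Lambda> \<Longrightarrow> poly2 (\<Phi> x) \<nu> s = (\<Sum>j=1..Suc d. poly (coeff (\<Phi> x) j) \<nu> * s ^ j)"
    "\<And>j. smooth_poly_family \<Lambda> (\<lambda>x. coeff (\<Phi> x) j)"
    using smooth_poly2_family_expand[OF smooth_\<Phi> \<Phi>_0] by metis
  have \<Phi>W: "W.Cg k ms (\<lambda>y z. poly2 (\<Phi> (cX z)) (cR z ^ l * cV z) (rt y z))" for k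
  proof -
    have "W.Cg k ms (\<lambda>y z. \<Sum>j=1..Suc d. poly (coeff (\<Phi> (cX z)) j) (cR z ^ l * cV z) * rt y z ^ j)"
    proof (rule W.Cg_sum)
      fix j assume "j \<in> {1..Suc d}"
      then have j: "1 \<le> real j" by simp
      have "0 \<le> ms" using e(3) by (simp add: ms_def)
      then have "1 * ms \<le> real j * ms" using j by (intro mult_right_mono)
      then show "W.Cg k ms (\<lambda>y z. poly (coeff (\<Phi> (cX z)) j) (cR z ^ l * cV z) * rt y z ^ j)"
        by (intro W.Cg_mono[OF W.Cg_mult[OF LW[OF polyL[OF d(2)]] W.Cg_power[OF rtW]]]) simp
    qed auto
    then show ?thesis
      by (rule W.Cg_cong) (metis D(6) N(2,4) d(1) subsetD)
  qed
  have "W.Cg k (- e + ms + - (2 * e)) (\<lambda>y z. T z * poly2 (\<Phi> (cX z)) (cR z ^ l * cV z) (rt y z) * dr y z)"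
    by (intro W.Cg_mult TW \<Phi>W drW)
  then show "graded_Ck (weight_bound (corner_box N) cR) (1 + e) (corner_box N) k (real l * real p - (2 * real q + 4) * e)
      (\<lambda>y z. remainder_rhs (cX z) (cR z ^ l) (cV z) (cY z) y (cA z))"
    by (simp add: remainder_rhs_def T_def rt_def dr_def ms_def c_def D_def algebra_simps)
  show "weight_bound (corner_box N) cR 0 (\<lambda>y z. resonant_term (cX z) (cR z ^ l) (cV z) (cY z) y (cA z))"
    using W.bound_mono[OF W.Cg_bound[OF rtW[of 0]], of 0] e(3) by (simp add: rt_def ms_def D_def)
qed

end

section \<open>Trajectories, the exit section and the compensator\<close>

lemma zero_of_lipschitz_derivative:
  fixes e e' :: "real \<Rightarrow> real"
  assumes "\<And>s. s \<in> {0..T} \<Longrightarrow> (e has_real_derivative e' s) (at s within {0..T})"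
    and "\<And>s. s \<in> {0..T} \<Longrightarrow> \<bar>e' s\<bar> \<le> L * \<bar>e s\<bar>" and "0 \<le> L" "e 0 = 0" "t \<in> {0..T}"
  shows "e t = 0"
proof -
  have "(e t)\<^sup>2 \<le> 0\<^sup>2 * t * exp ((2 * L + 1) * t)"
    by (rule gronwall[OF assms(1), where L = L]) (use assms in auto)
  then show ?thesis by simp
qed

text \<open>
  The first two coordinates of any trajectory are \<open>u e\<^sup>t\<close> and \<open>v e\<^sup>-\<^sup>t\<close>, so the section can only be met at
  \<open>\<tau> = ln (u0 / u)\<close>; the third coordinate is determined up to that time because the equation is Lipschitz
  on bounded sets.
\<close>

lemma hits_exit_section:
  fixes P :: "real \<Rightarrow> real \<Rightarrow> real \<Rightarrow> real" and u v Y u0 v0 Y0 :: real and Yt :: "real \<Rightarrow> real"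
  defines "X \<equiv> (\<lambda>(u, v, Y). (u, - v, P u v Y))" and "\<tau> \<equiv> ln u0 - ln u"
  assumes u: "0 < u" "u < u0" and v: "0 \<le> v" "v \<le> v0"
    and Y0: "Yt 0 = Y"
    and Yt: "\<And>t. t \<in> {0..\<tau>} \<Longrightarrow>
      (Yt has_real_derivative P (u * exp t) (v * exp (- t)) (Yt t)) (at t within {0..\<tau>})"
    and lip: "\<And>R. \<exists>L\<ge>0. \<forall>t\<in>{0..\<tau>}. \<forall>a\<in>{-R..R}. \<forall>b\<in>{-R..R}.
      \<bar>P (u * exp t) (v * exp (- t)) a - P (u * exp t) (v * exp (- t)) b\<bar> \<le> L * \<bar>a - b\<bar>"
    and exit: "\<bar>Yt \<tau>\<bar> \<le> Y0"
  shows "\<exists>!b. hits X (exit_section u0 v0 Y0) (u, v, Y) b"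
    and "transition_map X (exit_section u0 v0 Y0) (u, v, Y) = (Yt \<tau>, u * v)"
proof -
  have \<tau>: "0 < \<tau>" using u by (simp add: \<tau>_def)
  have exp\<tau>: "exp \<tau> = u0 / u" using u by (simp add: \<tau>_def exp_diff)
  let ?S = "exit_section u0 v0 Y0"
  define b where "b = (u0, v * exp (- \<tau>), Yt \<tau>)"
  have "v * exp (- \<tau>) \<le> v * 1" using v \<tau> by (intro mult_left_mono) auto
  then have bS: "b \<in> ?S" using v exit by (auto simp: b_def exit_section_def)
  have hit: "hits X ?S (u, v, Y) b"
    unfolding hits_def
  proof (intro exI[of _ "\<lambda>t. (u * exp t, v * exp (- t), Yt t)"] exI[of _ \<tau>] conjI ballI)
    show "(u * exp 0, v * exp (- 0), Yt 0) = (u, v, Y)" using Y0 by simp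
    show "(u * exp \<tau>, v * exp (- \<tau>), Yt \<tau>) = b" using u by (simp add: b_def exp\<tau>)
    fix t assume t: "t \<in> {0..\<tau>}"
    have "((\<lambda>t. u * exp t) has_vector_derivative u * exp t) (at t within {0..\<tau>})"
      "((\<lambda>t. v * exp (- t)) has_vector_derivative - (v * exp (- t))) (at t within {0..\<tau>})"
      unfolding has_real_derivative_iff_has_vector_derivative[symmetric]
      by (auto intro!: derivative_eq_intros)
    then show "((\<lambda>t. (u * exp t, v * exp (- t), Yt t)) has_vector_derivative X (u * exp t, v * exp (- t), Yt t)) (at t within {0..\<tau>})"
      unfolding X_def prod.case
      by (intro has_vector_derivative_Pair) (use Yt[OF t] in \<open>auto simp: has_real_derivative_iff_has_vector_derivative\<close>)
  next
    fix t assume t: "t \<in> {0..<\<tau>}"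
    then have "u * exp t < u * exp \<tau>" using u by simp
    then show "(u * exp t, v * exp (- t), Yt t) \<notin> ?S" using u by (auto simp: exp\<tau> exit_section_def)
  qed (use \<tau> bS in auto)
  have unique: "b' = b" if hb': "hits X ?S (u, v, Y) b'" for b'
  proof -
    obtain \<gamma> T where T: "0 < T" and \<gamma>0: "\<gamma> 0 = (u, v, Y)" and \<gamma>T: "\<gamma> T = b'" and b'S: "b' \<in> ?S"
      and \<gamma>: "\<And>t. t \<in> {0..T} \<Longrightarrow> (\<gamma> has_vector_derivative X (\<gamma> t)) (at t within {0..T})"
      using hb' unfolding hits_def by blast
    define g1 where "g1 = (\<lambda>t. fst (\<gamma> t))"
    define g2 where "g2 = (\<lambda>t. fst (snd (\<gamma> t)))"
    define g3 where "g3 = (\<lambda>t. snd (snd (\<gamma> t)))"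
    have X\<gamma>: "X (\<gamma> t) = (g1 t, - g2 t, P (g1 t) (g2 t) (g3 t))" for t
      by (simp add: X_def g1_def g2_def g3_def case_prod_beta)
    have d1: "(g1 has_real_derivative g1 t) (at t within {0..T})"
      and d2: "(g2 has_real_derivative - g2 t) (at t within {0..T})"
      and d3: "(g3 has_real_derivative P (g1 t) (g2 t) (g3 t)) (at t within {0..T})" if "t \<in> {0..T}" for t
      using bounded_linear.has_vector_derivative[OF bounded_linear_fst \<gamma>[OF that]]
        bounded_linear.has_vector_derivative[OF bounded_linear_fst bounded_linear.has_vector_derivative[OF bounded_linear_snd \<gamma>[OF that]]]
        bounded_linear.has_vector_derivative[OF bounded_linear_snd bounded_linear.has_vector_derivative[OF bounded_linear_snd \<gamma>[OF that]]]
      unfolding has_real_derivative_iff_has_vector_derivative X\<gamma> g1_def g2_def g3_def by simp_all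
    have init: "g1 0 = u" "g2 0 = v" using \<gamma>0 by (simp_all add: g1_def g2_def)
    have g1: "g1 t = u * exp t" if t: "t \<in> {0..T}" for t
    proof -
      have "g1 t - u * exp t = 0"
        by (rule zero_of_lipschitz_derivative[of T "\<lambda>t. g1 t - u * exp t" "\<lambda>t. g1 t - u * exp t" 1])
          (use t init in \<open>auto intro!: derivative_eq_intros d1\<close>)
      then show ?thesis by simp
    qed
    have g2: "g2 t = v * exp (- t)" if t: "t \<in> {0..T}" for t
    proof -
      have "g2 t - v * exp (- t) = 0"
        by (rule zero_of_lipschitz_derivative[of T "\<lambda>t. g2 t - v * exp (- t)" "\<lambda>t. - (g2 t - v * exp (- t))" 1])
          (use t init in \<open>auto intro!: derivative_eq_intros d2\<close>)
      then show ?thesis by simp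
    qed
    have "u * exp T = u0"
      using b'S \<gamma>T g1[of T] T by (auto simp: exit_section_def g1_def)
    then have "exp T = exp \<tau>" using u by (simp add: exp\<tau> field_simps)
    then have T\<tau>: "T = \<tau>" by simp
    have cont: "continuous_on {0..\<tau>} g3" "continuous_on {0..\<tau>} Yt"
      by (rule DERIV_continuous_on[OF d3[unfolded T\<tau>]], assumption) (rule DERIV_continuous_on[OF Yt])
    have "bounded (g3 ` {0..\<tau>})" "bounded (Yt ` {0..\<tau>})"
      by (intro compact_imp_bounded compact_continuous_image cont compact_Icc)+
    then obtain R1 R2 where R: "\<And>t. t \<in> {0..\<tau>} \<Longrightarrow> \<bar>g3 t\<bar> \<le> R1" "\<And>t. t \<in> {0..\<tau>} \<Longrightarrow> \<bar>Yt t\<bar> \<le> R2"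
      unfolding bounded_iff by (metis imageI real_norm_def)
    define R where "R = max R1 R2"
    have R': "g3 t \<in> {-R..R}" "Yt t \<in> {-R..R}" if "t \<in> {0..\<tau>}" for t
      using R[OF that] by (auto simp: R_def)
    obtain L where L: "L \<ge> 0" "\<And>t a b. t \<in> {0..\<tau>} \<Longrightarrow> a \<in> {-R..R} \<Longrightarrow> b \<in> {-R..R} \<Longrightarrow>
      \<bar>P (u * exp t) (v * exp (- t)) a - P (u * exp t) (v * exp (- t)) b\<bar> \<le> L * \<bar>a - b\<bar>"
      using lip[of R] by metis
    have "g3 \<tau> - Yt \<tau> = 0"
    proof (rule zero_of_lipschitz_derivative[of \<tau> "\<lambda>t. g3 t - Yt t"
          "\<lambda>t. P (u * exp t) (v * exp (- t)) (g3 t) - P (u * exp t) (v * exp (- t)) (Yt t)" L])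
      fix s assume s: "s \<in> {0..\<tau>}"
      show "((\<lambda>t. g3 t - Yt t) has_real_derivative P (u * exp s) (v * exp (- s)) (g3 s) - P (u * exp s) (v * exp (- s)) (Yt s)) (at s within {0..\<tau>})"
        using DERIV_diff[OF d3[unfolded T\<tau>, OF s] Yt[OF s]] g1[of s] g2[of s] s by (simp add: T\<tau>)
      show "\<bar>P (u * exp s) (v * exp (- s)) (g3 s) - P (u * exp s) (v * exp (- s)) (Yt s)\<bar> \<le> L * \<bar>g3 s - Yt s\<bar>"
        by (rule L(2)[OF s R'[OF s]])
    qed (use L(1) \<tau> \<gamma>0 Y0 in \<open>auto simp: g3_def\<close>)
    then have "\<gamma> \<tau> = b"
      using g1[of \<tau>] g2[of \<tau>] \<tau> u by (simp add: T\<tau> b_def g1_def g2_def g3_def prod_eq_iff exp\<tau>)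
    then show ?thesis using \<gamma>T T\<tau> by simp
  qed
  show "\<exists>!b. hits X ?S (u, v, Y) b" using hit unique by blast
  have "(THE b. hits X ?S (u, v, Y) b) = b" using hit unique by (rule the_equality)
  then show "transition_map X ?S (u, v, Y) = (Yt \<tau>, u * v)"
    using u by (simp add: transition_map_def b_def exp_minus exp\<tau>)
qed

text \<open>
  The integral of \<open>exp (a s)\<close> over \<open>0 \<le> s \<le> t\<close>. The drift and the compensator are expressed by this function, and the
  estimate of the remainder rests on its monotonicity in \<open>t\<close>, its symmetry \<open>exp_primitive_minus\<close>
  and its lower bounds.
\<close>

definition exp_primitive :: "real \<Rightarrow> real \<Rightarrow> real" where
  "exp_primitive t a = t * exp_moment 0 (a * t)"

lemma exp_primitive_eq: "exp_primitive t a = (if a = 0 then t else (exp (a * t) - 1) / a)"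
  by (auto simp: exp_primitive_def exp_moment_0)

lemma exp_primitive_0 [simp]: "exp_primitive 0 a = 0"
  by (simp add: exp_primitive_def)

lemma exp_primitive_deriv: "((\<lambda>t. exp_primitive t a) has_real_derivative exp (a * t)) (at t)"
  unfolding exp_primitive_eq by (cases "a = 0") (auto intro!: derivative_eq_intros)

lemma compensator_eq_exp_primitive:
  assumes "0 < u" "0 < u0"
  shows "compensator (u / u0) a = exp_primitive (ln u0 - ln u) a"
  using assms by (simp add: compensator_def exp_primitive_eq powr_def ln_div algebra_simps)

lemma exp_primitive_add: "exp_primitive (s + t) a = exp_primitive s a + exp (a * s) * exp_primitive t a"
  by (cases "a = 0") (auto simp: exp_primitive_eq distrib_left exp_add field_simps)

lemma exp_primitive_nonneg: "0 \<le> t \<Longrightarrow> 0 \<le> exp_primitive t a"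
  by (cases "0 < a") (auto simp: exp_primitive_eq divide_nonpos_neg mult_nonpos_nonneg)

lemma exp_primitive_mono: "0 \<le> s \<Longrightarrow> s \<le> t \<Longrightarrow> exp_primitive s a \<le> exp_primitive t a"
  using exp_primitive_add[of s "t - s" a] exp_primitive_nonneg[of "t - s" a] by simp

lemma exp_primitive_minus: "exp (- (a * t)) * exp_primitive t a = exp_primitive t (- a)"
  by (auto simp: exp_primitive_eq exp_minus field_simps)

lemma exp_primitive_lower:
  assumes "1 \<le> t" "\<bar>a\<bar> \<le> 1"
  shows "exp (- 1) \<le> exp_primitive t a"
proof -
  have "exp_primitive 1 a = integral {0..1} (\<lambda>t. exp (t * a))" by (simp add: exp_primitive_def exp_moment_def)
  moreover have "integral {0..1} (\<lambda>t::real. exp (- 1 :: real)) \<le> integral {0..1} (\<lambda>t. exp (t * a))"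
  proof (rule integral_le)
    fix s :: real assume s: "s \<in> {0..1}"
    have "\<bar>s * a\<bar> \<le> 1" unfolding abs_mult using s assms(2) by (intro mult_le_one) auto
    then show "exp (- 1) \<le> exp (s * a)" by simp
  qed (auto intro!: integrable_continuous_interval continuous_intros)
  ultimately show ?thesis using exp_primitive_mono[of 1 t a] assms(1) by simp
qed

text \<open>
  For \<open>t \<ge> 1\<close> the integral over \<open>[t - 1, t]\<close> alone is at least \<open>exp (a t - 2)\<close>; for \<open>t < 1\<close> the left hand side is
  at most \<open>exp 1\<close> and the integral at least \<open>exp (- 1)\<close>.
\<close>

lemma exp_le_exp_primitive:
  assumes "0 \<le> t" "t \<le> T" "1 \<le> T" "\<bar>a\<bar> \<le> 1"
  shows "exp (a * t) \<le> exp 2 * exp_primitive T a"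
proof (cases "1 \<le> t")
  case True
  have "exp (- 1) * exp (a * (t - 1)) \<le> exp_primitive 1 a * exp (a * (t - 1))"
    using exp_primitive_lower[of 1 a] assms by (intro mult_right_mono) auto
  also have "\<dots> \<le> exp_primitive t a"
    using exp_primitive_add[of "t - 1" 1 a] exp_primitive_nonneg[of "t - 1" a] True by (simp add: mult.commute)
  also have "\<dots> \<le> exp_primitive T a" by (rule exp_primitive_mono) (use assms in auto)
  finally have "exp 2 * (exp (- 1) * exp (a * (t - 1))) \<le> exp 2 * exp_primitive T a" by simp
  moreover have "exp (a * t) \<le> exp 2 * (exp (- 1) * exp (a * (t - 1)))"
    using assms by (simp flip: exp_add add: algebra_simps abs_le_iff)
  ultimately show ?thesis by linarith
next
  case False
  have "\<bar>a * t\<bar> \<le> 1" unfolding abs_mult using False assms by (intro mult_le_one) auto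
  then have "exp (a * t) \<le> exp 2 * exp (- 1)" by (simp flip: exp_add)
  also have "\<dots> \<le> exp 2 * exp_primitive T a" using exp_primitive_lower[of T a] assms by simp
  finally show ?thesis .
qed

lemma poly2_as_poly: "\<exists>Q. \<forall>s. poly2 P \<nu> s = poly Q s"
  by (rule exI[of _ "\<Sum>j\<le>degree P. monom (poly (coeff P j) \<nu>) j"])
    (simp add: poly2_def poly_altdef[of P] poly_sum poly_power poly_monom)

section \<open>Smooth solutions of the remainder equation\<close>

lemma graded_Ck_subset:
  assumes "P \<subseteq> D"
  shows "graded_Ck (weight_bound D \<rho>) c D k m f \<Longrightarrow> graded_Ck (weight_bound P \<rho>) c P k m f"
proof (induction k arbitrary: m f)
  case 0
  then have "continuous_on ({0..1} \<times> P) (\<lambda>p. f (fst p) (snd p))"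
    using assms by (auto intro: continuous_on_subset)
  moreover have "weight_bound P \<rho> m f" using 0 assms unfolding graded_Ck.simps weight_bound_def by blast
  ultimately show ?case by simp
next
  case (Suc k)
  obtain f' where c: "continuous_on ({0..1} \<times> D) (\<lambda>p. f (fst p) (snd p))" and b: "weight_bound D \<rho> m f"
    and f': "\<And>y z. y \<in> {0..1} \<Longrightarrow> z \<in> D \<Longrightarrow> (f y has_derivative f' y z) (at z)"
      "\<And>h. graded_Ck (weight_bound D \<rho>) c D k (m - c) (\<lambda>y z. f' y z h)"
    using Suc.prems unfolding graded_Ck.simps by blast
  have "continuous_on ({0..1} \<times> P) (\<lambda>p. f (fst p) (snd p))"
    by (rule continuous_on_subset[OF c]) (use assms in auto)
  moreover have "weight_bound P \<rho> m f" using b assms unfolding weight_bound_def by blast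
  ultimately show ?case
    using f' Suc.IH assms unfolding graded_Ck.simps by (intro conjI exI[of _ f']) blast+
qed

context resonant_family
begin

definition solves_remainder :: "'m \<times> real \<Rightarrow> real \<Rightarrow> real \<Rightarrow> real \<Rightarrow> (real \<Rightarrow> real) \<Rightarrow> bool" where
  "solves_remainder x u v Y f \<longleftrightarrow> f 0 = 0 \<and> (\<forall>y\<in>{0..1}. \<bar>f y\<bar> \<le> 1 / 2 \<and>
     (f has_real_derivative remainder_rhs x u v Y y (f y)) (at y within {0..1}))"

definition rhs_contracting :: "'m \<times> real \<Rightarrow> real \<Rightarrow> real \<Rightarrow> real \<Rightarrow> bool" where
  "rhs_contracting x u v Y \<longleftrightarrow> (\<forall>y\<in>{0..1}. \<forall>a\<in>{-1<..<1}. \<bar>remainder_rhs x u v Y y a\<bar> \<le> 1 / 2 \<and>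
     (\<forall>b\<in>{-1<..<1}. \<bar>remainder_rhs x u v Y y a - remainder_rhs x u v Y y b\<bar> \<le> \<bar>a - b\<bar> / 2))"

lemma solves_remainder_unique:
  assumes rc: "rhs_contracting x u v Y" and f: "solves_remainder x u v Y f" and g: "solves_remainder x u v Y g"
    and y: "y \<in> {0..1}"
  shows "f y = g y"
proof -
  have "f y - g y = 0"
  proof (rule zero_of_lipschitz_derivative[OF _ _ _ _ y, where L = "1 / 2" and e = "\<lambda>y. f y - g y"
        and e' = "\<lambda>y. remainder_rhs x u v Y y (f y) - remainder_rhs x u v Y y (g y)"])
    fix s :: real assume s: "s \<in> {0..1}"
    show "((\<lambda>y. f y - g y) has_real_derivative remainder_rhs x u v Y s (f s) - remainder_rhs x u v Y s (g s)) (at s within {0..1})"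
      using f g s unfolding solves_remainder_def by (intro DERIV_diff) auto
    have "\<bar>f s\<bar> \<le> 1 / 2" "\<bar>g s\<bar> \<le> 1 / 2" using f g s unfolding solves_remainder_def by auto
    then have "f s \<in> {-1<..<1}" "g s \<in> {-1<..<1}" by auto
    then show "\<bar>remainder_rhs x u v Y s (f s) - remainder_rhs x u v Y s (g s)\<bar> \<le> 1 / 2 * \<bar>f s - g s\<bar>"
      using rc s unfolding rhs_contracting_def by auto
  qed (use f g in \<open>auto simp: solves_remainder_def\<close>)
  then show ?thesis by simp
qed

text \<open>
  The size of \<open>e\<close> for which \<open>l - 2\<close> derivatives are possible: the order
  \<open>l p - (2 q + 4) e\<close> of the right hand side must exceed \<open>(1 + e) (l - 2)\<close>, that is
  \<open>(2 q + l + 2) e < 2 + l (p - 1)\<close>, and here the left hand side is \<open>1\<close>.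
\<close>

definition smoothing_loss :: "nat \<Rightarrow> real" where "smoothing_loss l = 1 / (2 * real q + real l + 2)"

text \<open>
  For \<open>|\<sigma> - \<sigma>0|\<close> below this radius the exponentials of \<open>q \<alpha> \<tau> y\<close> are at most \<open>r powr (- e)\<close> up to a constant.
\<close>

definition sigma_radius :: "nat \<Rightarrow> real" where "sigma_radius l = smoothing_loss l / (real l * real q)"

lemma loss_facts:
  assumes "2 \<le> l"
  shows "0 < smoothing_loss l" "0 < sigma_radius l" "real l * real q * sigma_radius l \<le> smoothing_loss l"
    "(2 * real q + 1) * smoothing_loss l \<le> real l * real p"
    "(1 + smoothing_loss l) * real (l - 2) < real l * real p - (2 * real q + 4) * smoothing_loss l"
proof -
  define e where "e = smoothing_loss l"
  have e: "(2 * real q + real l + 2) * e = 1" by (simp add: e_def smoothing_loss_def)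
  show e0: "0 < smoothing_loss l" by (simp add: smoothing_loss_def)
  then show "0 < sigma_radius l" "real l * real q * sigma_radius l \<le> smoothing_loss l"
    using assms q_pos by (simp_all add: sigma_radius_def)
  have "real l * 1 \<le> real l * real p" using p_pos by (intro mult_left_mono) auto
  then have lp: "real l \<le> real l * real p" by simp
  have e0: "0 < e" using e0 by (simp add: e_def)
  have "(2 * real q + 1) * e \<le> (2 * real q + real l + 2) * e" using e0 by (intro mult_right_mono) auto
  then show "(2 * real q + 1) * smoothing_loss l \<le> real l * real p"
    using lp e assms unfolding e_def[symmetric] by linarith
  have "(1 + e) * real (l - 2) = (1 + e) * (real l - 2)" using assms by simp
  also have "\<dots> = real l - 2 + (2 * real q + real l + 2) * e - (2 * real q + 4) * e" by (simp add: algebra_simps)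
  finally show "(1 + smoothing_loss l) * real (l - 2) < real l * real p - (2 * real q + 4) * smoothing_loss l"
    using lp unfolding e e_def[symmetric] by linarith
qed

text \<open>
  Taking \<open>l = 3\<close> in the graded bounds leaves a positive order for the right hand side and for its first
  derivative, so both are small for small \<open>u\<close>. This is a statement about \<open>u\<close> in which \<open>l\<close> has disappeared, so
  the resulting neighbourhood serves for all \<open>l\<close>.
\<close>

lemma remainder_rhs_small:
  assumes N: "open N" "N \<subseteq> K" "compact K" "K \<subseteq> \<Lambda>" and a0: "\<And>x. x \<in> N \<Longrightarrow> \<bar>snd x - \<sigma>0\<bar> \<le> sigma_radius 3"
  shows "\<exists>\<epsilon>>0. \<forall>x\<in>N. \<forall>u\<in>{0<..<\<epsilon>}. \<forall>v\<in>{-1<..<1}. \<forall>Y\<in>{-1<..<1}. rhs_contracting x u v Y"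
    and "\<exists>S\<ge>1. \<forall>x\<in>N. \<forall>u\<in>{0<..<1}. \<forall>v\<in>{-1<..<1}. \<forall>Y\<in>{-1<..<1}. \<forall>y\<in>{0..1}. \<forall>a\<in>{-1<..<1}.
      \<bar>resonant_term x u v Y y a\<bar> \<le> S"
proof -
  define e where "e = smoothing_loss 3"
  define D :: "'m corner_point set" where "D = corner_box N"
  define m where "m = real 3 * real p - (2 * real q + 4) * e"
  define H where "H = (\<lambda>y (z :: 'm corner_point). remainder_rhs (cX z) (cR z ^ 3) (cV z) (cY z) y (cA z))"
  note lf = loss_facts[of 3, folded e_def, simplified]
  have g: "graded_Ck (weight_bound D cR) (1 + e) D 1 m H"
    and rt: "weight_bound D cR 0 (\<lambda>y z. resonant_term (cX z) (cR z ^ 3) (cV z) (cY z) y (cA z))"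
    using remainder_rhs_graded(1)[OF N a0, where l = 3 and e = e and k = 1]
      remainder_rhs_graded(2)[OF N a0, where l = 3 and e = e] lf by (auto simp: D_def m_def H_def)
  have m: "1 + e < m" "1 \<le> m - (1 + e)"
  proof -
    have "(2 * real q + 5) * e = 1" by (simp add: e_def smoothing_loss_def)
    then have "(2 * real q + 4) * e + e = 1" by (simp add: algebra_simps)
    moreover have "real 3 * real p \<ge> 3" using p_pos by simp
    ultimately show "1 + e < m" "1 \<le> m - (1 + e)" using lf(5) unfolding m_def by (simp, linarith)
  qed
  have m1: "1 \<le> m" using m lf(1) by linarith
  obtain H' where b: "weight_bound D cR m H"
    and H': "\<And>y z. y \<in> {0..1} \<Longrightarrow> z \<in> D \<Longrightarrow> (H y has_derivative H' y z) (at z)"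
      "\<And>h. graded_Ck (weight_bound D cR) (1 + e) D 0 (m - (1 + e)) (\<lambda>y z. H' y z h)"
    using g unfolding One_nat_def graded_Ck.simps(2) by blast
  have H'b: "weight_bound D cR (m - (1 + e)) (\<lambda>y z. H' y z (1, 0))" using H'(2) by simp
  obtain C1 where C1: "C1 \<ge> 0" "\<And>y z. y \<in> {0..1} \<Longrightarrow> z \<in> D \<Longrightarrow> \<bar>H y z\<bar> \<le> C1 * cR z powr m"
    using weight_bound_nonneg[OF b] by metis
  obtain C2 where C2: "C2 \<ge> 0" "\<And>y z. y \<in> {0..1} \<Longrightarrow> z \<in> D \<Longrightarrow> \<bar>H' y z (1, 0)\<bar> \<le> C2 * cR z powr (m - (1 + e))"
    using weight_bound_nonneg[OF H'b] by metis
  define r0 where "r0 = 1 / (2 * (C1 + C2 + 1))"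
  have r0: "0 < r0" "r0 < 1" "C1 * r0 \<le> 1 / 2" "C2 * r0 \<le> 1 / 2"
    using C1(1) C2(1) by (auto simp: r0_def field_simps)
  have mk: "(a, Y, root 3 u, 0, v, x) \<in> D" if "x \<in> N" "u \<in> {0<..<1}" "v \<in> {-1<..<1}" "Y \<in> {-1<..<1}" "a \<in> {-1<..<1}" for x u v Y a
    using that by (auto simp: D_def corner_box_def coord_defs real_root_lt_1_iff)
  have root3: "root 3 u ^ 3 = u" if "u \<in> {0<..<1}" for u using that by (simp add: real_root_pow_pos2)
  have "rhs_contracting x u v Y"
    if x: "x \<in> N" and u: "u \<in> {0<..<r0 ^ 3}" and v: "v \<in> {-1<..<1}" and Y: "Y \<in> {-1<..<1}" for x u v Y
  proof -
    have "r0 ^ 3 < 1" using r0 by (simp add: power_less_one_iff)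
    then have u1: "u \<in> {0<..<1}" using u by auto
    define r where "r = root 3 u"
    have r: "0 < r" "r < r0"
      using u r0(1) real_root_less_mono[of 3 u "r0 ^ 3"] by (auto simp: r_def real_root_power_cancel)
    have r1: "r < 1" using r r0 by linarith
    define z where "z = (\<lambda>a :: real. (a, Y, r, 0 :: real, v, x))"
    have zD: "z a \<in> D" if "a \<in> {-1<..<1}" for a using mk[OF x u1 v Y that] by (simp add: z_def r_def)
    have cRz: "cR (z a) = r" for a by (simp add: z_def cR_def)
    have Hz: "H y (z a) = remainder_rhs x u v Y y a" for y a
      using root3[OF u1] by (simp add: H_def z_def coord_defs r_def)
    have pw: "r powr m \<le> r" "r powr (m - (1 + e)) \<le> r"
      using powr_mono'[of 1 m r] powr_mono'[of 1 "m - (1 + e)" r] m m1 r r1 by auto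
    have 1: "\<bar>remainder_rhs x u v Y y a\<bar> \<le> 1 / 2" if "y \<in> {0..1}" "a \<in> {-1<..<1}" for y a
    proof -
      have "\<bar>H y (z a)\<bar> \<le> C1 * r powr m" using C1(2)[OF that(1) zD[OF that(2)]] by (simp add: cRz)
      also have "\<dots> \<le> C1 * r0" using pw(1) r C1(1) by (intro mult_left_mono) auto
      finally show ?thesis using r0(3) by (simp add: Hz)
    qed
    have 2: "\<bar>remainder_rhs x u v Y y a - remainder_rhs x u v Y y b\<bar> \<le> \<bar>a - b\<bar> / 2"
      if y: "y \<in> {0..1}" and ab: "a \<in> {-1<..<1}" "b \<in> {-1<..<1}" for y a b
    proof -
      have "norm (H y (z a) - H y (z b)) \<le> 1 / 2 * norm (a - b)"
      proof (rule field_differentiable_bound[where S = "{-1<..<1::real}" and f' = "\<lambda>a. H' y (z a) (1, 0)"])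
        fix s :: real assume s: "s \<in> {-1<..<1}"
        have "(z has_derivative (\<lambda>h. (h, 0))) (at s)"
          unfolding z_def by (rule has_derivative_Pair[OF has_derivative_ident has_derivative_const])
        from has_derivative_compose[OF this H'(1)[OF y zD[OF s]]]
        have der: "((\<lambda>a. H y (z a)) has_derivative (\<lambda>h. H' y (z s) (h, 0))) (at s)" .
        have "H' y (z s) (h, 0) = H' y (z s) (1, 0) * h" for h
          using linear_scale[OF has_derivative_linear[OF H'(1)[OF y zD[OF s]]], of h "(1, 0)"] by (simp add: mult.commute)
        then have eq: "(\<lambda>h. H' y (z s) (h, 0)) = (*) (H' y (z s) (1, 0))" by (intro ext)
        show "((\<lambda>a. H y (z a)) has_field_derivative H' y (z s) (1, 0)) (at s within {-1<..<1})"
          unfolding has_field_derivative_def using der unfolding eq by (rule has_derivative_at_withinI)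
        have "\<bar>H' y (z s) (1, 0)\<bar> \<le> C2 * r powr (m - (1 + e))" using C2(2)[OF y zD[OF s]] by (simp add: cRz)
        also have "\<dots> \<le> C2 * r0" using pw(2) r C2(1) by (intro mult_left_mono) auto
        finally show "norm (H' y (z s) (1, 0)) \<le> 1 / 2" using r0(4) by simp
      qed (use ab in auto)
      then show ?thesis by (simp add: Hz)
    qed
    show ?thesis unfolding rhs_contracting_def using 1 2 by blast
  qed
  moreover have "r0 ^ 3 > 0" using r0 by simp
  ultimately show "\<exists>\<epsilon>>0. \<forall>x\<in>N. \<forall>u\<in>{0<..<\<epsilon>}. \<forall>v\<in>{-1<..<1}. \<forall>Y\<in>{-1<..<1}. rhs_contracting x u v Y"
    by blast
  obtain S where S: "\<And>y z. y \<in> {0..1} \<Longrightarrow> z \<in> D \<Longrightarrow>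
      \<bar>resonant_term (cX z) (cR z ^ 3) (cV z) (cY z) y (cA z)\<bar> \<le> S * cR z powr 0"
    using weight_bound_nonneg[OF rt] by metis
  have "\<bar>resonant_term x u v Y y a\<bar> \<le> max S 1"
    if "x \<in> N" "u \<in> {0<..<1}" "v \<in> {-1<..<1}" "Y \<in> {-1<..<1}" "y \<in> {0..1}" "a \<in> {-1<..<1}" for x u v Y y a
    using S[OF that(5) mk[OF that(1-4,6)]] that(2) root3[OF that(2)] by (simp add: coord_defs)
  then show "\<exists>S\<ge>1. \<forall>x\<in>N. \<forall>u\<in>{0<..<1}. \<forall>v\<in>{-1<..<1}. \<forall>Y\<in>{-1<..<1}. \<forall>y\<in>{0..1}. \<forall>a\<in>{-1<..<1}.
      \<bar>resonant_term x u v Y y a\<bar> \<le> S"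
    by (intro exI[of _ "max S 1"]) auto
qed

definition root_domain :: "nat \<Rightarrow> real \<Rightarrow> ('m \<times> real) set \<Rightarrow> (real \<times> real \<times> real \<times> real \<times> 'm \<times> real) set" where
  "root_domain l \<epsilon> N = {-1<..<1} \<times> {..<root l \<epsilon>} \<times> UNIV \<times> {-1<..<1} \<times> N"

text \<open>
  The right hand side extended by zero to \<open>r \<le> 0\<close> satisfies the hypotheses of the abstract equation with parameters. For
  \<open>r > 0\<close> its solution is the solution of the remainder equation at \<open>u = r^l\<close>.
\<close>

lemma smooth_remainder_solution:
  assumes N: "open N" "N \<subseteq> K" "compact K" "K \<subseteq> \<Lambda>" and l: "2 \<le> l"
    and a0: "\<And>x. x \<in> N \<Longrightarrow> \<bar>snd x - \<sigma>0\<bar> \<le> sigma_radius l"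
    and \<epsilon>: "0 < \<epsilon>" "\<epsilon> \<le> 1"
    and rc: "\<And>x u v Y. x \<in> N \<Longrightarrow> u \<in> {0<..<\<epsilon>} \<Longrightarrow> v \<in> {-1<..<1} \<Longrightarrow> Y \<in> {-1<..<1} \<Longrightarrow> rhs_contracting x u v Y"
  shows "open (root_domain l \<epsilon> N)"
    and "\<exists>g. (\<forall>y\<in>{0..1}. Ck_on (l - 2) (root_domain l \<epsilon> N) (g y)) \<and>
      (\<forall>x\<in>N. \<forall>u\<in>{0<..<\<epsilon>}. \<forall>v\<in>{-1<..<1}. \<forall>Y\<in>{-1<..<1}. \<forall>w.
        solves_remainder x u v Y (\<lambda>y. g y (Y, root l u, w, v, x)))"
proof -
  define D where "D = root_domain l \<epsilon> N"
  have opD: "open D" unfolding D_def root_domain_def using N(1) by (intro open_Times) auto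
  have opD': "open ({-1<..<(1::real)} \<times> D)" by (intro open_Times opD) auto
  define e where "e = smoothing_loss l"
  note lf = loss_facts[OF l, folded e_def]
  define m where "m = real l * real p - (2 * real q + 4) * e"
  define H0 where "H0 = (\<lambda>y (z :: 'm corner_point). remainder_rhs (cX z) (cR z ^ l) (cV z) (cY z) y (cA z))"
  define H where "H = (\<lambda>y z. if 0 < cR z then H0 y z else 0)"
  have l0: "0 < l" using l by simp
  have rl: "root l \<epsilon> \<le> 1" using \<epsilon> l0 by (simp add: real_root_le_1_iff)
  have g: "graded_Ck (weight_bound (corner_box N) cR) (1 + e) (corner_box N) (l - 2) m H0"
    unfolding m_def H0_def by (rule remainder_rhs_graded(1)[OF N a0 l0 lf(1,3,4)])
  define P where "P = {z \<in> {-1<..<1} \<times> D. 0 < cR z}"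
  have "P \<subseteq> corner_box N"
    using rl by (auto simp: P_def D_def root_domain_def corner_box_def coord_defs)
  from graded_Ck_subset[OF this g]
  have "graded_Ck (weight_bound P cR) (1 + e) P (l - 2) m H0" .
  from extend_by_zero[OF opD' bounded_linear_coords(3) cR_le_norm _ this[unfolded P_def]] lf(1,5)
  have Ck: "param_Ck ({-1<..<1} \<times> D) (l - 2) H"
    by (simp add: H_def m_def)
  then have Ck0: "param_Ck ({-1<..<1} \<times> D) 0 H"
    unfolding param_Ck_0 by (rule param_Ck_continuous)
  have Hval: "H y (a, Y, r, w, v, x) = (if 0 < r then remainder_rhs x (r ^ l) v Y y a else 0)" for y a Y r w v x
    by (simp add: H_def H0_def coord_defs)
  have pow_lt: "r ^ l \<in> {0<..<\<epsilon>}" if "0 < r" "r < root l \<epsilon>" for r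
    using that \<epsilon>(1) l0 power_strict_mono[of r "root l \<epsilon>" l] by (simp add: real_root_pow_pos2)
  have hc: "half_contraction D H"
    unfolding half_contraction_def
  proof (intro ballI, goal_cases)
    case (1 y z a)
    obtain Y r w v x where z: "z = (Y, r, w, v, x)" by (cases z)
    show ?case
    proof (cases "0 < r")
      case True
      have "rhs_contracting x (r ^ l) v Y"
        using 1(2) True pow_lt by (intro rc) (auto simp: z D_def root_domain_def)
      then show ?thesis using 1 True unfolding z Hval rhs_contracting_def by simp
    qed (simp add: z Hval)
  qed
  obtain \<phi> where sol: "solves_on_unit D H \<phi>" and c0: "param_Ck D 0 \<phi>"
    using solution_exists[OF opD Ck0 hc] .
  have smooth: "param_Ck D (l - 2) \<phi>" by (rule solution_param_Ck[OF opD hc sol c0 Ck])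
  have "solves_remainder x u v Y (\<lambda>y. \<phi> y (Y, root l u, w, v, x))"
    if h: "x \<in> N" "u \<in> {0<..<\<epsilon>}" "v \<in> {-1<..<1}" "Y \<in> {-1<..<1}" for x u v w Y
  proof -
    have r: "0 < root l u" "root l u < root l \<epsilon>" "root l u ^ l = u"
      using h(2) l0 by (simp_all add: real_root_pow_pos2)
    have zD: "(Y, root l u, w, v, x) \<in> D" using h r by (auto simp: D_def root_domain_def)
    show ?thesis
      using sol zD r unfolding solves_on_unit_def solves_remainder_def by (fastforce simp: Hval)
  qed
  moreover have "Ck_on (l - 2) D (\<phi> y)" if "y \<in> {0..1}" for y
    by (rule param_Ck_imp_Ck_on[OF opD that smooth])
  ultimately show "\<exists>g. (\<forall>y\<in>{0..1}. Ck_on (l - 2) (root_domain l \<epsilon> N) (g y)) \<and>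
      (\<forall>x\<in>N. \<forall>u\<in>{0<..<\<epsilon>}. \<forall>v\<in>{-1<..<1}. \<forall>Y\<in>{-1<..<1}. \<forall>w.
        solves_remainder x u v Y (\<lambda>y. g y (Y, root l u, w, v, x)))"
    unfolding D_def by (intro exI[of _ \<phi>]) blast
  show "open (root_domain l \<epsilon> N)" using opD by (simp add: D_def)
qed

end

section \<open>The transition map of a resonant family\<close>

context resonant_family
begin

lemma drift_eq:
  "drift x u v Y y = Y + poly (\<eta> x) (u * v) * v ^ p * exp_primitive (transit_time u * y) (alpha x (u * v))"
  by (simp add: drift_def exp_primitive_def mult_ac)

text \<open>
  If \<open>p / q\<close> in lowest terms is a natural number, then \<open>q = 1\<close>.
\<close>

lemma \<eta>_zero_or_integer:
  assumes "x \<in> \<Lambda>"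
  shows "\<eta> x = 0 \<or> \<sigma>0 = real p"
proof (cases "\<sigma>0 \<in> \<nat>")
  case True
  then obtain n where "\<sigma>0 = real n" unfolding Nats_def by auto
  then have "real p = real (n * q)" using q_pos by (simp add: \<sigma>0_eq field_simps)
  then have "q dvd p" by (metis dvd_triv_right of_nat_eq_iff)
  then have "q = 1" using coprime by (metis coprime_common_divisor_nat dvd_refl nat_dvd_1_iff_1)
  then show ?thesis by (simp add: \<sigma>0_eq)
next
  case False then show ?thesis using \<eta>_0 assms by blast
qed

text \<open>
  Undoing the substitution: \<open>exp (- \<sigma>_bar t) (drift + f)\<close> at \<open>y = t / \<tau>\<close> solves the third equation, by
  \<open>p - q \<sigma>_bar = - q \<alpha>\<close> for the term in \<open>\<Phi>\<close> and by \<open>\<alpha> - \<sigma>_bar = - p\<close>, whenever \<open>\<eta> \<noteq> 0\<close>, for the last one.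
\<close>

lemma normal_form_transition:
  assumes x: "x \<in> \<Lambda>" and u: "0 < u" "u < u0" and v: "0 \<le> v" "v \<le> v0"
    and f: "solves_remainder x u v Y f"
    and exit: "\<bar>(u / u0) powr sigma_bar \<phi> x (u * v) * (drift x u v Y 1 + f 1)\<bar> \<le> Y0"
  shows "\<exists>!b. hits (normal_form_rational p q \<phi> \<Phi> \<eta> x) (exit_section u0 v0 Y0) (u, v, Y) b"
    and "transition_map (normal_form_rational p q \<phi> \<Phi> \<eta> x) (exit_section u0 v0 Y0) (u, v, Y) =
      ((u / u0) powr sigma_bar \<phi> x (u * v) * (drift x u v Y 1 + f 1), u * v)"
proof -
  define \<tau> where "\<tau> = ln u0 - ln u"
  have \<tau>: "0 < \<tau>" using u by (simp add: \<tau>_def)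
  define s where "s = sigma_bar \<phi> x (u * v)"
  define a where "a = alpha x (u * v)"
  have s: "s = \<sigma>0 + a" by (simp add: s_def a_def alpha_def)
  define P where "P = (\<lambda>u v Y. - sigma_bar \<phi> x (u * v) * Y + poly2 (\<Phi> x) (u * v) (u ^ p * Y ^ q) * Y
              + v ^ p * poly (\<eta> x) (u * v))"
  have X: "normal_form_rational p q \<phi> \<Phi> \<eta> x = (\<lambda>(u, v, Y). (u, - v, P u v Y))"
    by (simp add: normal_form_rational_def P_def)
  have uv: "u * exp t * (v * exp (- t)) = u * v" for t by (simp add: exp_minus)
  define Z where "Z = (\<lambda>t. drift x u v Y (t / \<tau>) + f (t / \<tau>))"
  define Yt where "Yt = (\<lambda>t. exp (- s * t) * Z t)"
  have drift_t: "drift x u v Y (t / \<tau>) = Y + poly (\<eta> x) (u * v) * v ^ p * exp_primitive t a" for t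
    using \<tau> by (simp add: drift_eq transit_time_def a_def flip: \<tau>_def)
  have Yt0: "Yt 0 = Y" using f by (simp add: Yt_def Z_def drift_t solves_remainder_def)
  have E: "exp (- s * \<tau>) = (u / u0) powr s" using u u0_pos by (simp add: powr_def \<tau>_def ln_div algebra_simps)
  have Yt\<tau>: "Yt \<tau> = (u / u0) powr s * (drift x u v Y 1 + f 1)"
    using \<tau> E by (simp add: Yt_def Z_def)
  have dYt: "(Yt has_real_derivative P (u * exp t) (v * exp (- t)) (Yt t)) (at t within {0..\<tau>})"
    if t: "t \<in> {0..\<tau>}" for t
  proof -
    define y where "y = t / \<tau>"
    have y: "y \<in> {0..1}" using t \<tau> by (simp add: y_def)
    have ty: "\<tau> * y = t" using \<tau> by (simp add: y_def)
    define R where "R = poly2 (\<Phi> x) (u * v) (resonant_term x u v Y y (f y)) * Z t"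
    have rhs: "remainder_rhs x u v Y y (f y) = \<tau> * R"
      by (simp add: remainder_rhs_def R_def Z_def y_def transit_time_def \<tau>_def)
    have "(f has_real_derivative \<tau> * R) (at y within {0..1})"
      using f y unfolding solves_remainder_def rhs[symmetric] by blast
    then have "(f has_real_derivative \<tau> * R) (at (t / \<tau>) within (\<lambda>t. t / \<tau>) ` {0..\<tau>})"
      unfolding y_def by (rule DERIV_subset) (use \<tau> in auto)
    moreover have "((\<lambda>t. t / \<tau>) has_real_derivative 1 / \<tau>) (at t within {0..\<tau>})"
      by (rule DERIV_cdivide[OF DERIV_ident])
    ultimately have "(f \<circ> (\<lambda>t. t / \<tau>) has_real_derivative \<tau> * R * (1 / \<tau>)) (at t within {0..\<tau>})"
      by (rule DERIV_image_chain)
    then have df: "((\<lambda>t. f (t / \<tau>)) has_real_derivative R) (at t within {0..\<tau>})"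
      using \<tau> by (simp add: o_def)
    have dZ: "(Z has_real_derivative poly (\<eta> x) (u * v) * v ^ p * exp (a * t) + R) (at t within {0..\<tau>})"
      unfolding Z_def drift_t
      by (auto intro!: derivative_eq_intros df has_field_derivative_at_within[OF exp_primitive_deriv])
    have "(Yt has_real_derivative exp (- s * t) * (- s) * Z t + exp (- s * t) * (poly (\<eta> x) (u * v) * v ^ p * exp (a * t) + R)) (at t within {0..\<tau>})"
      unfolding Yt_def by (auto intro!: derivative_eq_intros dZ)
    moreover have "exp (- s * t) * (- s) * Z t + exp (- s * t) * (poly (\<eta> x) (u * v) * v ^ p * exp (a * t) + R)
      = P (u * exp t) (v * exp (- t)) (Yt t)"
    proof -
      have 1: "(u * exp t) ^ p * Yt t ^ q = resonant_term x u v Y y (f y)"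
      proof -
        have "real q * s = real p + real q * a" using q_pos by (simp add: s \<sigma>0_eq field_simps)
        from arg_cong[OF this, of "\<lambda>w. w * t"]
        have "real p * t - real q * (s * t) = - real q * (a * t)" by (simp add: algebra_simps)
        then have e: "exp t ^ p * exp (- s * t) ^ q = exp (- real q * (a * t))"
          by (simp flip: exp_of_nat_mult exp_add add: algebra_simps)
        have "(u * exp t) ^ p * Yt t ^ q = u ^ p * (exp t ^ p * exp (- s * t) ^ q) * Z t ^ q"
          by (simp add: Yt_def power_mult_distrib mult_ac)
        then show ?thesis unfolding e
          using ty by (simp add: resonant_term_def Z_def a_def transit_time_def mult.assoc flip: \<tau>_def y_def)
      qed
      have 2: "exp (- s * t) * (poly (\<eta> x) (u * v) * v ^ p * exp (a * t)) = (v * exp (- t)) ^ p * poly (\<eta> x) (u * v)"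
      proof (cases "\<eta> x = 0")
        case False
        then have "\<sigma>0 = real p" using \<eta>_zero_or_integer[OF x] by blast
        then have "exp (- s * t) * exp (a * t) = exp (- t) ^ p"
          by (simp add: s algebra_simps flip: exp_of_nat_mult exp_add)
        then show ?thesis by (simp add: power_mult_distrib mult_ac)
      qed simp
      show ?thesis
        unfolding P_def uv 1 s_def[symmetric] distrib_left[of "exp (- s * t)"] 2
        by (simp add: R_def Yt_def mult_ac)
    qed
    ultimately show ?thesis by simp
  qed
  have lip: "\<exists>L\<ge>0. \<forall>t\<in>{0..\<tau>}. \<forall>a\<in>{-R..R}. \<forall>b\<in>{-R..R}.
      \<bar>P (u * exp t) (v * exp (- t)) a - P (u * exp t) (v * exp (- t)) b\<bar> \<le> L * \<bar>a - b\<bar>" for R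
  proof -
    obtain Q where Q: "\<And>s. poly2 (\<Phi> x) (u * v) s = poly Q s" using poly2_as_poly by metis
    define g where "g = (\<lambda>(t, y). - s + (poly (pderiv Q) ((u * exp t) ^ p * y ^ q) * ((u * exp t) ^ p * (real q * y ^ (q - 1))) * y
        + poly Q ((u * exp t) ^ p * y ^ q)))"
    have "continuous_on ({0..\<tau>} \<times> {-R..R}) g"
      unfolding g_def case_prod_beta by (intro continuous_intros)
    then have "bounded (g ` ({0..\<tau>} \<times> {-R..R}))"
      by (intro compact_imp_bounded compact_continuous_image compact_Times) auto
    then obtain L where L: "\<forall>w\<in>g ` ({0..\<tau>} \<times> {-R..R}). norm w \<le> L" unfolding bounded_iff by blast
    have "\<bar>P (u * exp t) (v * exp (- t)) a - P (u * exp t) (v * exp (- t)) b\<bar> \<le> \<bar>L\<bar> * \<bar>a - b\<bar>"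
      if t: "t \<in> {0..\<tau>}" and ab: "a \<in> {-R..R}" "b \<in> {-R..R}" for t a b
    proof -
      have "norm (P (u * exp t) (v * exp (- t)) a - P (u * exp t) (v * exp (- t)) b) \<le> \<bar>L\<bar> * norm (a - b)"
      proof (rule field_differentiable_bound[where S = "{-R..R}" and f' = "\<lambda>y. g (t, y)"])
        fix y assume y: "y \<in> {-R..R}"
        show "(P (u * exp t) (v * exp (- t)) has_real_derivative g (t, y)) (at y within {-R..R})"
          unfolding P_def uv Q s_def[symmetric] g_def prod.case
          by (auto intro!: derivative_eq_intros DERIV_chain'[OF _ poly_DERIV] simp: mult_ac)
        show "norm (g (t, y)) \<le> \<bar>L\<bar>" using L t y by (metis SigmaI abs_ge_self image_eqI order.trans)
      qed (use ab in auto)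
      then show ?thesis by simp
    qed
    then show ?thesis by (intro exI[of _ "\<bar>L\<bar>"]) auto
  qed
  have ex: "\<bar>Yt \<tau>\<bar> \<le> Y0" using exit by (simp add: Yt\<tau> s_def)
  note hit = hits_exit_section[where P = P, OF u v Yt0 dYt[unfolded \<tau>_def] lip[unfolded \<tau>_def] ex[unfolded \<tau>_def], folded X]
  show "\<exists>!b. hits (normal_form_rational p q \<phi> \<Phi> \<eta> x) (exit_section u0 v0 Y0) (u, v, Y) b"
    by (rule hit(1))
  show "transition_map (normal_form_rational p q \<phi> \<Phi> \<eta> x) (exit_section u0 v0 Y0) (u, v, Y) =
      ((u / u0) powr sigma_bar \<phi> x (u * v) * (drift x u v Y 1 + f 1), u * v)"
    using hit(2) Yt\<tau> by (simp add: s_def \<tau>_def)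
qed

text \<open>
  The trajectory leaves through the section because \<open>exp (- \<sigma>_bar \<tau>)\<close> beats the growth of the drift. With
  \<open>|\<sigma> - \<sigma>0| \<le> \<sigma>0 / 4\<close> the product is at most a multiple of \<open>(1 + \<tau>) exp (- \<sigma>0 \<tau> / 2)\<close>, and half of the remaining
  exponent absorbs the factor \<open>\<tau>\<close>.
\<close>

lemma exit_bound:
  assumes N: "N \<subseteq> K" "compact K" "K \<subseteq> \<Lambda>" and \<sigma>: "\<And>x. x \<in> N \<Longrightarrow> \<bar>snd x - \<sigma>0\<bar> \<le> \<sigma>0 / 4" and Y0: "0 < Y0"
  shows "\<exists>\<epsilon>>0. \<forall>x\<in>N. \<forall>u\<in>{0<..<\<epsilon>}. \<forall>v\<in>{-1<..<1}. \<forall>Y\<in>{-1<..<1}. \<forall>w\<in>{-1/2..1/2}.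
    \<bar>(u / u0) powr sigma_bar \<phi> x (u * v) * (drift x u v Y 1 + w)\<bar> \<le> Y0"
proof -
  have \<sigma>0: "0 < \<sigma>0" using p_pos q_pos by (simp add: \<sigma>0_eq)
  obtain M where M: "M \<ge> 0" "\<And>x t. x \<in> K \<Longrightarrow> t \<in> {-1..1} \<Longrightarrow> \<bar>poly (\<eta> x) t\<bar> \<le> M"
    using smooth_poly_family_bounded[OF smooth_\<eta> N(2,3)] by metis
  obtain C0 where C0: "C0 \<ge> 0" "\<And>x u v. x \<in> K \<Longrightarrow> u \<in> {0<..<1} \<Longrightarrow> v \<in> {-1..1} \<Longrightarrow>
    \<bar>alpha x (u * v) * transit_time u\<bar> \<le> \<bar>snd x - \<sigma>0\<bar> * (- ln u) + C0"
    using alpha_transit_time_bound[OF N(2,3)] by metis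
  define B where "B = exp (\<sigma>0 / 2 * \<bar>ln u0\<bar> + 2 * C0)"
  define A where "A = B * (2 + M * (4 / \<sigma>0))"
  have A: "0 < A" using M(1) \<sigma>0 by (auto simp: A_def B_def intro!: mult_pos_pos add_pos_nonneg)
  define \<epsilon> where "\<epsilon> = min (min u0 1) (exp (ln u0 - (4 / \<sigma>0) * ln (A / Y0)))"
  have "\<bar>(u / u0) powr sigma_bar \<phi> x (u * v) * (drift x u v Y 1 + w)\<bar> \<le> Y0"
    if x: "x \<in> N" and u: "u \<in> {0<..<\<epsilon>}" and v: "v \<in> {-1<..<1}" and Y: "Y \<in> {-1<..<1}" and w: "w \<in> {-1/2..1/2}" for x u v Y w
  proof -
    define \<tau> where "\<tau> = transit_time u"
    define a where "a = alpha x (u * v)"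
    have u': "0 < u" "u < u0" "u < 1" "ln u < ln u0 - (4 / \<sigma>0) * ln (A / Y0)"
      using u ln_less_cancel_iff[of u "exp (ln u0 - (4 / \<sigma>0) * ln (A / Y0))"] by (auto simp: \<epsilon>_def)
    have \<tau>: "0 \<le> \<tau>" using u' by (simp add: \<tau>_def transit_time_def)
    have uv: "u * v \<in> {-1..1}"
    proof -
      have "\<bar>u * v\<bar> \<le> 1" unfolding abs_mult using u' v by (intro mult_le_one) auto
      then show ?thesis by auto
    qed
    have lnu: "- ln u \<le> \<tau> + \<bar>ln u0\<bar>" by (simp add: \<tau>_def transit_time_def)
    have lnu0: "0 \<le> - ln u" using u' by simp
    have "\<bar>a * \<tau>\<bar> \<le> \<bar>snd x - \<sigma>0\<bar> * (- ln u) + C0"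
      unfolding a_def \<tau>_def by (rule C0(2)) (use x N u' v in auto)
    also have "\<dots> \<le> \<sigma>0 / 4 * (\<tau> + \<bar>ln u0\<bar>) + C0"
      using \<sigma>[OF x] lnu lnu0 \<sigma>0 by (intro add_right_mono mult_mono) auto
    finally have a\<tau>: "2 * \<bar>a * \<tau>\<bar> \<le> \<sigma>0 / 2 * \<tau> + (\<sigma>0 / 2 * \<bar>ln u0\<bar> + 2 * C0)" by (simp add: field_simps)
    have "(u / u0) powr sigma_bar \<phi> x (u * v) = exp (- (\<sigma>0 * \<tau>) - a * \<tau>)"
      using u' u0_pos by (simp add: powr_def ln_div \<tau>_def transit_time_def a_def alpha_def algebra_simps)
    also have "\<dots> \<le> exp (- (\<sigma>0 * \<tau>) + \<bar>a * \<tau>\<bar>)" using abs_ge_minus_self[of "a * \<tau>"] by simp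
    finally have E: "(u / u0) powr sigma_bar \<phi> x (u * v) \<le> exp (- (\<sigma>0 * \<tau>) + \<bar>a * \<tau>\<bar>)" .
    have prim: "\<bar>exp_primitive \<tau> a\<bar> \<le> \<tau> * exp \<bar>a * \<tau>\<bar>"
    proof -
      have "\<bar>exp_primitive \<tau> a\<bar> = \<tau> * \<bar>exp_moment 0 (a * \<tau>)\<bar>"
        using \<tau> by (simp only: exp_primitive_def abs_mult abs_of_nonneg)
      also have "\<dots> \<le> \<tau> * exp \<bar>a * \<tau>\<bar>" by (rule mult_left_mono[OF exp_moment_abs_le \<tau>])
      finally show ?thesis .
    qed
    have "\<bar>v ^ p\<bar> \<le> 1" using v unfolding power_abs by (intro power_le_one) auto
    then have "\<bar>poly (\<eta> x) (u * v) * v ^ p\<bar> \<le> M * 1"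
      unfolding abs_mult using M(2)[OF subsetD[OF N(1) x] uv] M(1) by (intro mult_mono) auto
    then have "\<bar>poly (\<eta> x) (u * v) * v ^ p * exp_primitive \<tau> a\<bar> \<le> M * (\<tau> * exp \<bar>a * \<tau>\<bar>)"
      unfolding abs_mult[of _ "exp_primitive \<tau> a"] using prim M(1) by (intro mult_mono) auto
    then have "\<bar>drift x u v Y 1 + w\<bar> \<le> 2 + M * (\<tau> * exp \<bar>a * \<tau>\<bar>)"
      using Y w by (simp add: drift_eq flip: \<tau>_def a_def) linarith
    also have "\<dots> \<le> 2 * exp \<bar>a * \<tau>\<bar> + M * (\<tau> * exp \<bar>a * \<tau>\<bar>)" by simp
    finally have "\<bar>(u / u0) powr sigma_bar \<phi> x (u * v) * (drift x u v Y 1 + w)\<bar>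
        \<le> exp (- (\<sigma>0 * \<tau>) + \<bar>a * \<tau>\<bar>) * (2 * exp \<bar>a * \<tau>\<bar> + M * (\<tau> * exp \<bar>a * \<tau>\<bar>))"
      unfolding abs_mult[of "(u / u0) powr _"] using E by (intro mult_mono) auto
    also have "\<dots> = exp (- (\<sigma>0 * \<tau>) + 2 * \<bar>a * \<tau>\<bar>) * (2 + M * \<tau>)"
      by (simp add: algebra_simps exp_add mult_exp_exp)
    also have "\<dots> \<le> exp (- (\<sigma>0 / 2 * \<tau>) + (\<sigma>0 / 2 * \<bar>ln u0\<bar> + 2 * C0)) * ((2 + M * (4 / \<sigma>0)) * exp (\<sigma>0 / 4 * \<tau>))"
    proof (rule mult_mono)
      show "exp (- (\<sigma>0 * \<tau>) + 2 * \<bar>a * \<tau>\<bar>) \<le> exp (- (\<sigma>0 / 2 * \<tau>) + (\<sigma>0 / 2 * \<bar>ln u0\<bar> + 2 * C0))"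
        using a\<tau> by (simp add: field_simps)
      have "\<sigma>0 / 4 * \<tau> \<le> exp (\<sigma>0 / 4 * \<tau>)" using exp_ge_add_one_self[of "\<sigma>0 / 4 * \<tau>"] by linarith
      then have "\<tau> \<le> (4 / \<sigma>0) * exp (\<sigma>0 / 4 * \<tau>)" using \<sigma>0 by (simp add: field_simps)
      then have "M * \<tau> \<le> M * ((4 / \<sigma>0) * exp (\<sigma>0 / 4 * \<tau>))" using M(1) by (intro mult_left_mono)
      moreover have "1 \<le> exp (\<sigma>0 / 4 * \<tau>)" using \<sigma>0 \<tau> by simp
      ultimately show "2 + M * \<tau> \<le> (2 + M * (4 / \<sigma>0)) * exp (\<sigma>0 / 4 * \<tau>)"
        by (simp only: distrib_right mult.assoc)
    qed (use M(1) \<tau> in auto)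
    also have "\<dots> = A * exp (- (\<sigma>0 / 4 * \<tau>))"
    proof -
      have e1: "exp (- (\<sigma>0 / 2 * \<tau>)) * exp (\<sigma>0 / 4 * \<tau>) = exp (- (\<sigma>0 / 4 * \<tau>))" by (simp flip: exp_add)
      have e2: "exp (- (\<sigma>0 / 2 * \<tau>) + (\<sigma>0 / 2 * \<bar>ln u0\<bar> + 2 * C0)) = exp (- (\<sigma>0 / 2 * \<tau>)) * B"
        by (simp only: B_def exp_add)
      show ?thesis unfolding e2 A_def e1[symmetric] by (simp only: mult_ac)
    qed
    also have "\<dots> \<le> Y0"
    proof -
      have "(4 / \<sigma>0) * ln (A / Y0) \<le> \<tau>" using u'(4) by (simp add: \<tau>_def transit_time_def)
      then have "ln (A / Y0) \<le> \<sigma>0 / 4 * \<tau>" using \<sigma>0 by (simp add: field_simps)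
      then have "A / Y0 \<le> exp (\<sigma>0 / 4 * \<tau>)" using A Y0 by (metis divide_pos_pos exp_le_cancel_iff exp_ln)
      then show ?thesis using A Y0 by (simp add: exp_minus field_simps)
    qed
    finally show ?thesis .
  qed
  moreover have "\<epsilon> > 0" using u0_pos by (simp add: \<epsilon>_def)
  ultimately show ?thesis by blast
qed

text \<open>
  Write \<open>Z = drift + f\<close> and \<open>\<omega>\<close> for the compensator. Then \<open>|Z| \<le> Cz \<omega>\<close> by monotonicity of the integral of
  \<open>exp (\<alpha> s)\<close>, and \<open>exp (- \<alpha> t) |Z| \<le> Cz G\<close> with \<open>G = exp (- \<alpha> \<tau>) \<omega>\<close> by monotonicity of the integral of
  \<open>exp (- \<alpha> s)\<close>; the constants in \<open>Z\<close> are absorbed by the lower bounds for these integrals. The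
  resonant term is \<open>u^p (exp (- \<alpha> t) Z)^q\<close> and \<open>\<Phi>(\<nu>, s) = O(s)\<close>, so the right hand side is
  \<open>O(\<tau> u^p G^q \<omega>)\<close>; finally \<open>exp (- q \<alpha> \<tau>) = (u / u0) powr (q \<alpha>)\<close> and \<open>\<tau> \<le> 2 |ln u|\<close>.
\<close>

lemma remainder_estimate:
  assumes N: "N \<subseteq> K" "compact K" "K \<subseteq> \<Lambda>" and \<sigma>: "\<And>x. x \<in> N \<Longrightarrow> \<bar>snd x - \<sigma>0\<bar> \<le> 1 / 2"
    and S: "1 \<le> S" "\<And>x u v Y y a. x \<in> N \<Longrightarrow> u \<in> {0<..<1} \<Longrightarrow> v \<in> {-1<..<1} \<Longrightarrow> Y \<in> {-1<..<1} \<Longrightarrow>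
      y \<in> {0..1} \<Longrightarrow> a \<in> {-1<..<1} \<Longrightarrow> \<bar>resonant_term x u v Y y a\<bar> \<le> S"
  shows "\<exists>\<epsilon>>0. \<exists>C. \<forall>x\<in>N. \<forall>u\<in>{0<..<\<epsilon>}. \<forall>v\<in>{-1<..<1}. \<forall>Y\<in>{-1<..<1}. \<forall>f. solves_remainder x u v Y f \<longrightarrow>
    \<bar>f 1\<bar> \<le> C * (u powr (real p + real q * alpha x (u * v)) * compensator (u / u0) (alpha x (u * v)) ^ (q + 1) * \<bar>ln u\<bar>)"
proof -
  obtain M\<phi> where M\<phi>: "M\<phi> \<ge> 0" "\<And>x t. x \<in> K \<Longrightarrow> t \<in> {-1..1} \<Longrightarrow> \<bar>poly (\<phi> x) t\<bar> \<le> M\<phi> * \<bar>t\<bar>"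
    using smooth_poly_family_bounded_linearly[OF smooth_\<phi> N(2,3) \<phi>_0] by metis
  obtain M\<eta> where M\<eta>: "M\<eta> \<ge> 0" "\<And>x t. x \<in> K \<Longrightarrow> t \<in> {-1..1} \<Longrightarrow> \<bar>poly (\<eta> x) t\<bar> \<le> M\<eta>"
    using smooth_poly_family_bounded[OF smooth_\<eta> N(2,3)] by metis
  obtain M\<Phi> where M\<Phi>: "M\<Phi> \<ge> 0" "\<And>x \<nu> s. x \<in> K \<Longrightarrow> \<nu> \<in> {-1..1} \<Longrightarrow> s \<in> {-S..S} \<Longrightarrow> \<bar>poly2 (\<Phi> x) \<nu> s\<bar> \<le> M\<Phi> * \<bar>s\<bar>"
    using smooth_poly2_family_bounded_linearly[OF smooth_\<Phi> \<Phi>_0 N(2,3) S(1)] by metis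
  define Cz where "Cz = 2 * exp 2 + M\<eta>"
  have Cz: "0 \<le> Cz" using M\<eta>(1) by (simp add: Cz_def)
  define C where "C = 2 * M\<Phi> * Cz ^ (q + 1) * exp (real q * \<bar>ln u0\<bar>) * exp 1"
  \<comment> \<open>The bounds on \<open>u\<close> give, in this order: \<open>u < u0\<close>, \<open>u < 1\<close>, \<open>\<tau> \<le> 2 |ln u|\<close>, \<open>1 \<le> \<tau>\<close> and \<open>|\<alpha>| \<le> 1\<close>.\<close>
  define \<epsilon> where "\<epsilon> = min (min u0 1) (min (exp (- \<bar>ln u0\<bar> - 1)) (min (u0 * exp (- 1)) (1 / (2 * (M\<phi> + 1)))))"
  have "\<bar>f 1\<bar> \<le> C * (u powr (real p + real q * alpha x (u * v)) * compensator (u / u0) (alpha x (u * v)) ^ (q + 1) * \<bar>ln u\<bar>)"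
    if x: "x \<in> N" and u: "u \<in> {0<..<\<epsilon>}" and v: "v \<in> {-1<..<1}" and Y: "Y \<in> {-1<..<1}" and f: "solves_remainder x u v Y f" for x u v Y f
  proof -
    define \<tau> where "\<tau> = transit_time u"
    define a where "a = alpha x (u * v)"
    define \<omega> where "\<omega> = compensator (u / u0) a"
    have u': "0 < u" "u < u0" "u < 1" "u < exp (- \<bar>ln u0\<bar> - 1)" "u < u0 * exp (- 1)" "u < 1 / (2 * (M\<phi> + 1))"
      using u by (auto simp: \<epsilon>_def)
    have uv: "\<bar>u * v\<bar> \<le> u" unfolding abs_mult using u' v by (intro mult_left_le[of "\<bar>v\<bar>", simplified] order.trans[OF mult_left_le]) auto
    then have uv1: "u * v \<in> {-1..1}" using u' by auto
    have xK: "x \<in> K" using x N(1) by blast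
    have a1: "\<bar>a\<bar> \<le> 1"
    proof -
      have "\<bar>poly (\<phi> x) (u * v)\<bar> \<le> M\<phi> * u"
        using M\<phi>(2)[OF xK uv1] mult_left_mono[OF uv M\<phi>(1)] by linarith
      also have "\<dots> \<le> (M\<phi> + 1) * u" using u' by simp
      also have "\<dots> \<le> 1 / 2" using u'(6) M\<phi>(1) by (simp add: field_simps)
      finally show ?thesis using \<sigma>[OF x] unfolding a_def alpha_eq by linarith
    qed
    have lnu: "ln u < - \<bar>ln u0\<bar> - 1"
      using u'(1,4) ln_less_cancel_iff[of u "exp (- \<bar>ln u0\<bar> - 1)"] by simp
    have "ln u < ln (u0 * exp (- 1))" using u'(1,5) by (intro ln_less_cancel_iff[THEN iffD2]) auto
    then have \<tau>1: "1 \<le> \<tau>" using u0_pos by (simp add: \<tau>_def transit_time_def ln_mult)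
    have \<tau>2: "\<tau> \<le> 2 * \<bar>ln u\<bar>" using lnu by (simp add: \<tau>_def transit_time_def)
    have \<omega>: "\<omega> = exp_primitive \<tau> a"
      unfolding \<omega>_def \<tau>_def transit_time_def by (rule compensator_eq_exp_primitive[OF u'(1) u0_pos])
    have \<omega>0: "0 \<le> \<omega>" using exp_primitive_nonneg[of \<tau> a] \<tau>1 by (simp add: \<omega>)
    have one: "1 \<le> exp 2 * \<omega>" using exp_le_exp_primitive[of 0 \<tau> a] \<tau>1 a1 by (simp add: \<omega>)
    define G where "G = exp (- (a * \<tau>)) * \<omega>"
    have G: "G = exp_primitive \<tau> (- a)" by (simp add: G_def \<omega> exp_primitive_minus)
    have G0: "0 \<le> G" using \<omega>0 by (simp add: G_def)
    have vp: "\<bar>poly (\<eta> x) (u * v) * v ^ p\<bar> \<le> M\<eta>"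
    proof -
      have "\<bar>v ^ p\<bar> \<le> 1" using v unfolding power_abs by (intro power_le_one) auto
      then have "\<bar>poly (\<eta> x) (u * v) * v ^ p\<bar> \<le> M\<eta> * 1"
        unfolding abs_mult using M\<eta>(2)[OF xK uv1] M\<eta>(1) by (intro mult_mono) auto
      then show ?thesis by simp
    qed
    have rhs: "\<bar>remainder_rhs x u v Y y (f y)\<bar> \<le> \<tau> * (M\<Phi> * (u ^ p * (Cz * G) ^ q)) * (Cz * \<omega>)" if y: "y \<in> {0..1}" for y
    proof -
      define t where "t = \<tau> * y"
      have t: "0 \<le> t" "t \<le> \<tau>" using y \<tau>1 by (auto simp: t_def intro: mult_left_le)
      have fy: "\<bar>f y\<bar> \<le> 1 / 2" using f y unfolding solves_remainder_def by blast
      define Z where "Z = drift x u v Y y + f y"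
      have "\<bar>poly (\<eta> x) (u * v) * v ^ p * exp_primitive t a\<bar> \<le> M\<eta> * exp_primitive t a"
        unfolding abs_mult[of _ "exp_primitive t a"] using vp exp_primitive_nonneg[OF t(1), of a]
        by (simp add: mult_right_mono)
      then have Z: "\<bar>Z\<bar> \<le> 2 + M\<eta> * exp_primitive t a"
        using fy Y unfolding Z_def drift_eq \<tau>_def[symmetric] t_def[symmetric] a_def[symmetric] by (simp add: abs_le_iff) linarith
      also have "\<dots> \<le> 2 * (exp 2 * \<omega>) + M\<eta> * \<omega>"
        using exp_primitive_mono[OF t, of a] one M\<eta>(1) unfolding \<omega> by (intro add_mono mult_left_mono) auto
      finally have Z1: "\<bar>Z\<bar> \<le> Cz * \<omega>" by (simp add: Cz_def algebra_simps)
      have "exp (- (a * t)) * \<bar>Z\<bar> \<le> exp (- (a * t)) * (2 + M\<eta> * exp_primitive t a)"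
        using Z by (intro mult_left_mono) auto
      also have "\<dots> = 2 * exp (- a * t) + M\<eta> * exp_primitive t (- a)"
        by (simp add: algebra_simps flip: exp_primitive_minus)
      also have "\<dots> \<le> 2 * (exp 2 * G) + M\<eta> * G"
        using exp_primitive_mono[OF t, of "- a"] exp_le_exp_primitive[OF t \<tau>1, of "- a"] a1 M\<eta>(1)
        unfolding G by (intro add_mono mult_left_mono) auto
      finally have Z2: "exp (- (a * t)) * \<bar>Z\<bar> \<le> Cz * G" by (simp add: Cz_def algebra_simps)
      have "resonant_term x u v Y y (f y) = u ^ p * (exp (- (a * t)) * Z) ^ q"
      proof -
        have "exp (- real q * (a * t)) = exp (- (a * t)) ^ q" by (simp flip: exp_of_nat_mult)
        then show ?thesis
          by (simp add: resonant_term_def Z_def t_def \<tau>_def a_def power_mult_distrib mult_ac)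
      qed
      then have "\<bar>resonant_term x u v Y y (f y)\<bar> = u ^ p * (exp (- (a * t)) * \<bar>Z\<bar>) ^ q"
        using u' by (simp add: abs_mult power_abs)
      also have "\<dots> \<le> u ^ p * (Cz * G) ^ q"
        using Z2 u' by (intro mult_left_mono power_mono) auto
      finally have r: "\<bar>resonant_term x u v Y y (f y)\<bar> \<le> u ^ p * (Cz * G) ^ q" .
      have "resonant_term x u v Y y (f y) \<in> {-S..S}"
      proof -
        have "u \<in> {0<..<1}" "f y \<in> {-1<..<1}" using u' fy by auto
        from S(2)[OF x this(1) v Y y this(2)] show ?thesis by auto
      qed
      from M\<Phi>(2)[OF xK uv1 this]
      have "\<bar>poly2 (\<Phi> x) (u * v) (resonant_term x u v Y y (f y))\<bar> \<le> M\<Phi> * (u ^ p * (Cz * G) ^ q)"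
        using mult_left_mono[OF r M\<Phi>(1)] by linarith
      then have "\<bar>\<tau> * poly2 (\<Phi> x) (u * v) (resonant_term x u v Y y (f y)) * Z\<bar> \<le> \<tau> * (M\<Phi> * (u ^ p * (Cz * G) ^ q)) * (Cz * \<omega>)"
        unfolding abs_mult using Z1 \<tau>1 M\<Phi>(1) Cz G0 u' by (intro mult_mono) auto
      then show ?thesis by (simp add: remainder_rhs_def Z_def \<tau>_def)
    qed
    have "\<bar>f 1\<bar> \<le> (\<tau> * (M\<Phi> * (u ^ p * (Cz * G) ^ q)) * (Cz * \<omega>)) * exp (0 + 1)"
      by (rule gronwall_unit[where e' = "\<lambda>y. remainder_rhs x u v Y y (f y)" and L = 0])
        (use f rhs \<tau>1 M\<Phi>(1) Cz G0 \<omega>0 u' in \<open>auto simp: solves_remainder_def\<close>)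
    also have "\<dots> = \<tau> * (M\<Phi> * Cz ^ (q + 1) * exp 1 * (u ^ p * exp (- (a * \<tau>)) ^ q * \<omega> ^ (q + 1)))"
      by (simp add: G_def power_mult_distrib mult_ac)
    also have "\<dots> \<le> (2 * \<bar>ln u\<bar>) * (M\<Phi> * Cz ^ (q + 1) * exp 1 * ((u powr (real p + real q * a) * exp (real q * \<bar>ln u0\<bar>)) * \<omega> ^ (q + 1)))"
    proof (rule mult_mono[OF \<tau>2 mult_left_mono[OF mult_right_mono]])
      have "exp (- (a * \<tau>)) ^ q = exp (- real q * (a * \<tau>))" by (simp flip: exp_of_nat_mult)
      also have "- real q * (a * \<tau>) = real q * a * ln u + real q * (- a * ln u0)" by (simp add: \<tau>_def transit_time_def algebra_simps)
      also have "exp \<dots> = u powr (real q * a) * exp (real q * (- a * ln u0))" using u' by (simp only: exp_add powr_def) simp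
      also have "\<dots> \<le> u powr (real q * a) * exp (real q * \<bar>ln u0\<bar>)"
      proof -
        have "- a * ln u0 \<le> \<bar>a\<bar> * \<bar>ln u0\<bar>" by (metis abs_ge_self abs_minus_cancel abs_mult)
        also have "\<dots> \<le> 1 * \<bar>ln u0\<bar>" using a1 by (intro mult_right_mono) auto
        finally have "real q * (- a * ln u0) \<le> real q * \<bar>ln u0\<bar>" by (intro mult_left_mono) auto
        then show ?thesis by (intro mult_left_mono) auto
      qed
      finally have "u ^ p * exp (- (a * \<tau>)) ^ q \<le> u ^ p * (u powr (real q * a) * exp (real q * \<bar>ln u0\<bar>))"
        using u' by (intro mult_left_mono) auto
      then show "u ^ p * exp (- (a * \<tau>)) ^ q \<le> u powr (real p + real q * a) * exp (real q * \<bar>ln u0\<bar>)"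
        using u' by (simp add: powr_add powr_realpow mult.assoc)
    qed (use M\<Phi>(1) Cz \<omega>0 u' in auto)
    also have "\<dots> = C * (u powr (real p + real q * a) * \<omega> ^ (q + 1) * \<bar>ln u\<bar>)" by (simp add: C_def mult_ac)
    finally show ?thesis by (simp only: \<omega>_def a_def)
  qed
  moreover have "\<epsilon> > 0" using u0_pos M\<phi>(1) by (simp add: \<epsilon>_def)
  ultimately show ?thesis by blast
qed

end

section \<open>The transition maps in a neighbourhood of the corner\<close>

lemma openin_quadrant_box:
  "openin (top_of_set quadrant) (quadrant \<inter> ({..<a} \<times> {..<b} \<times> {-c<..<c}))"
  by (intro openin_open_Int open_Times) auto

text \<open>
  The neighbourhoods \<open>W\<close> and \<open>N\<close> are chosen once, so that the remainder equation is contracting, trajectories leave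
  through the section and the estimate holds; \<open>\<psi>\<close> is the end value of the solution obtained for \<open>l = 3\<close>, the value for
  which the smallness was established. For each \<open>l\<close> only the neighbourhood of \<open>(\<mu>0, \<sigma>0)\<close> shrinks, and uniqueness
  of solutions identifies \<open>\<psi>\<close> with the smooth solution in the root of order \<open>l\<close>.
\<close>

lemma (in resonant_family) resonant_transition:
  assumes x0: "(\<mu>0, \<sigma>0) \<in> \<Lambda>" and "0 < v0" "0 < Y0"
  defines "X \<equiv> normal_form_rational p q \<phi> \<Phi> \<eta>"
    and "S \<equiv> exit_section u0 v0 Y0"
    and "\<omega> \<equiv> (\<lambda>x u v. compensator (u / u0) (alpha x (u * v)))"
  shows "\<exists>W N (\<psi> :: 'm \<times> real \<Rightarrow> real \<Rightarrow> real \<Rightarrow> real \<Rightarrow> real) (C::real).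
           openin (top_of_set quadrant) W \<and> (0, 0, 0) \<in> W \<and>
           open N \<and> (\<mu>0, \<sigma>0) \<in> N \<and> N \<subseteq> \<Lambda> \<and>
           (\<forall>x\<in>N. \<forall>(u, v, Y)\<in>W. u > 0 \<longrightarrow>
              (\<exists>!b. hits (X x) S (u, v, Y) b) \<and>
              transition_map (X x) S (u, v, Y) =
                (poly (\<eta> x) (u * v) * v ^ p * (u / u0) powr sigma_bar \<phi> x (u * v) * \<omega> x u v
                   + (u / u0) powr sigma_bar \<phi> x (u * v) * (Y + \<psi> x Y u v),
                 u * v) \<and>
              \<bar>\<psi> x Y u v\<bar> \<le>
                C * (u powr (real p + real q * alpha x (u * v)) * \<omega> x u v ^ (q + 1) * \<bar>ln u\<bar>)) \<and>
           (\<forall>l\<ge>2. \<exists>N' D (\<Psi> :: real \<times> real \<times> real \<times> real \<times> 'm \<times> real \<Rightarrow> real).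
              open N' \<and> (\<mu>0, \<sigma>0) \<in> N' \<and> N' \<subseteq> N \<and>
              open D \<and> Ck_on (l - 2) D \<Psi> \<and>
              (\<forall>(\<mu>, \<sigma>)\<in>N'. \<forall>(u, v, Y)\<in>W.
                 (Y, root l u, root l u * \<omega> (\<mu>, \<sigma>) u v, v, \<mu>, \<sigma>) \<in> D \<and>
                 (u > 0 \<longrightarrow>
                    \<psi> (\<mu>, \<sigma>) Y u v = \<Psi> (Y, root l u, root l u * \<omega> (\<mu>, \<sigma>) u v, v, \<mu>, \<sigma>))))"
proof -
  have \<sigma>0: "0 < \<sigma>0" using p_pos q_pos by (simp add: \<sigma>0_eq)
  obtain d where d: "0 < d" "cball (\<mu>0, \<sigma>0) d \<subseteq> \<Lambda>"
    using open_params x0 open_contains_cball by blast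
  define K where "K = cball (\<mu>0, \<sigma>0) d"
  have K: "compact K" "K \<subseteq> \<Lambda>" using d by (simp_all add: K_def)
  define \<delta> where "\<delta> = min d (min (sigma_radius 3) (min (\<sigma>0 / 4) (1 / 2)))"
  define N where "N = ball (\<mu>0, \<sigma>0) \<delta>"
  have sr3: "0 < sigma_radius 3" by (rule loss_facts) simp
  have \<delta>: "0 < \<delta>" using d sr3 \<sigma>0 by (simp add: \<delta>_def)
  have N: "open N" "N \<subseteq> K" "(\<mu>0, \<sigma>0) \<in> N" using \<delta> by (auto simp: N_def K_def \<delta>_def)
  have near: "\<bar>snd x - \<sigma>0\<bar> \<le> r" if "x \<in> ball (\<mu>0, \<sigma>0) r" for x r
    using that dist_snd_le[of "(\<mu>0, \<sigma>0)" x] by (simp add: dist_real_def abs_minus_commute)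
  have near3: "\<bar>snd x - \<sigma>0\<bar> \<le> sigma_radius 3" "\<bar>snd x - \<sigma>0\<bar> \<le> \<sigma>0 / 4" "\<bar>snd x - \<sigma>0\<bar> \<le> 1 / 2" if "x \<in> N" for x
    using near[of x \<delta>] that by (auto simp: N_def \<delta>_def)
  obtain \<epsilon>1 where \<epsilon>1: "\<epsilon>1 > 0" "\<And>x u v Y. x \<in> N \<Longrightarrow> u \<in> {0<..<\<epsilon>1} \<Longrightarrow> v \<in> {-1<..<1} \<Longrightarrow> Y \<in> {-1<..<1} \<Longrightarrow> rhs_contracting x u v Y"
    using remainder_rhs_small(1)[OF N(1,2) K near3(1)] by metis
  obtain R where R: "R \<ge> 1" "\<And>x u v Y y a. x \<in> N \<Longrightarrow> u \<in> {0<..<1} \<Longrightarrow> v \<in> {-1<..<1} \<Longrightarrow> Y \<in> {-1<..<1} \<Longrightarrow>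
      y \<in> {0..1} \<Longrightarrow> a \<in> {-1<..<1} \<Longrightarrow> \<bar>resonant_term x u v Y y a\<bar> \<le> R"
    using remainder_rhs_small(2)[OF N(1,2) K near3(1)] by metis
  obtain \<epsilon>2 where \<epsilon>2: "\<epsilon>2 > 0" "\<And>x u v Y w. x \<in> N \<Longrightarrow> u \<in> {0<..<\<epsilon>2} \<Longrightarrow> v \<in> {-1<..<1} \<Longrightarrow> Y \<in> {-1<..<1} \<Longrightarrow> w \<in> {-1/2..1/2} \<Longrightarrow>
    \<bar>(u / u0) powr sigma_bar \<phi> x (u * v) * (drift x u v Y 1 + w)\<bar> \<le> Y0"
    using exit_bound[OF N(2) K near3(2) \<open>0 < Y0\<close>] by metis
  obtain \<epsilon>3 where "\<epsilon>3 > 0" and "\<exists>C. \<forall>x\<in>N. \<forall>u\<in>{0<..<\<epsilon>3}. \<forall>v\<in>{-1<..<1}. \<forall>Y\<in>{-1<..<1}. \<forall>f. solves_remainder x u v Y f \<longrightarrow>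
    \<bar>f 1\<bar> \<le> C * (u powr (real p + real q * alpha x (u * v)) * compensator (u / u0) (alpha x (u * v)) ^ (q + 1) * \<bar>ln u\<bar>)"
    using remainder_estimate[OF N(2) K near3(3) R] by blast
  then obtain C where \<epsilon>3: "\<epsilon>3 > 0" "\<forall>x\<in>N. \<forall>u\<in>{0<..<\<epsilon>3}. \<forall>v\<in>{-1<..<1}. \<forall>Y\<in>{-1<..<1}. \<forall>f. solves_remainder x u v Y f \<longrightarrow>
    \<bar>f 1\<bar> \<le> C * (u powr (real p + real q * alpha x (u * v)) * compensator (u / u0) (alpha x (u * v)) ^ (q + 1) * \<bar>ln u\<bar>)"
    by blast
  define \<epsilon> where "\<epsilon> = min (min u0 1) (min \<epsilon>1 (min \<epsilon>2 \<epsilon>3))"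
  have \<epsilon>: "0 < \<epsilon>" "\<epsilon> \<le> 1" using u0_pos \<epsilon>1(1) \<epsilon>2(1) \<epsilon>3(1) by (simp_all add: \<epsilon>_def)
  have rc: "rhs_contracting x u v Y" if "x \<in> N" "u \<in> {0<..<\<epsilon>}" "v \<in> {-1<..<1}" "Y \<in> {-1<..<1}" for x u v Y
    by (rule \<epsilon>1(2)) (use that in \<open>auto simp: \<epsilon>_def\<close>)
  define W where "W = quadrant \<inter> ({..<\<epsilon>} \<times> {..<min 1 v0} \<times> {-1<..<1})"
  have W: "openin (top_of_set quadrant) W" "(0, 0, 0) \<in> W"
    unfolding W_def using \<epsilon>(1) \<open>0 < v0\<close> openin_quadrant_box[of \<epsilon> "min 1 v0" 1] by (auto simp: quadrant_def)
  have Wm: "u \<in> {0<..<\<epsilon>}" "v \<in> {-1<..<1}" "Y \<in> {-1<..<1}" "0 \<le> v" "v \<le> v0" if "(u, v, Y) \<in> W" "0 < u" for u v Y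
    using that by (auto simp: W_def quadrant_def)
  have l3: "2 \<le> (3 :: nat)" by simp
  have "\<exists>g. \<forall>x\<in>N. \<forall>u\<in>{0<..<\<epsilon>}. \<forall>v\<in>{-1<..<1}. \<forall>Y\<in>{-1<..<1}. \<forall>w::real.
       solves_remainder x u v Y (\<lambda>y. g y (Y, root 3 u, w, v, x))"
    using smooth_remainder_solution(2)[where l = 3, OF N(1,2) K l3 near3(1) \<epsilon> rc] by blast
  then obtain g where g: "\<forall>x\<in>N. \<forall>u\<in>{0<..<\<epsilon>}. \<forall>v\<in>{-1<..<1}. \<forall>Y\<in>{-1<..<1}. \<forall>w::real.
       solves_remainder x u v Y (\<lambda>y. g y (Y, root 3 u, w, v, x))" ..
  define \<psi> where "\<psi> = (\<lambda>x Y u v. g 1 (Y, root 3 u, 0 :: real, v, x))"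
  have trans: "(\<exists>!b. hits (X x) S (u, v, Y) b) \<and>
              transition_map (X x) S (u, v, Y) =
                (poly (\<eta> x) (u * v) * v ^ p * (u / u0) powr sigma_bar \<phi> x (u * v) * \<omega> x u v
                   + (u / u0) powr sigma_bar \<phi> x (u * v) * (Y + \<psi> x Y u v),
                 u * v) \<and>
              \<bar>\<psi> x Y u v\<bar> \<le> C * (u powr (real p + real q * alpha x (u * v)) * \<omega> x u v ^ (q + 1) * \<bar>ln u\<bar>)"
    if x: "x \<in> N" and uvY: "(u, v, Y) \<in> W" and u: "0 < u" for x u v Y
  proof -
    note m = Wm[OF uvY u]
    define f where "f = (\<lambda>y. g y (Y, root 3 u, 0 :: real, v, x))"
    have f: "solves_remainder x u v Y f" unfolding f_def by (rule g[rule_format, OF x m(1-3)])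
    have f1: "f 1 = \<psi> x Y u v" by (simp add: f_def \<psi>_def)
    have "\<bar>f 1\<bar> \<le> 1 / 2" using f unfolding solves_remainder_def by simp
    then have f1': "f 1 \<in> {-1/2..1/2}" unfolding atLeastAtMost_iff by linarith
    have x\<Lambda>: "x \<in> \<Lambda>" using x N(2) K(2) by blast
    have uu: "u < u0" "u \<in> {0<..<\<epsilon>2}" "u \<in> {0<..<\<epsilon>3}" using m(1) by (auto simp: \<epsilon>_def)
    have ex: "\<bar>(u / u0) powr sigma_bar \<phi> x (u * v) * (drift x u v Y 1 + f 1)\<bar> \<le> Y0"
      by (rule \<epsilon>2(2)[OF x uu(2) m(2,3) f1'])
    note t = normal_form_transition[OF x\<Lambda> u uu(1) m(4,5) f ex]
    have "drift x u v Y 1 = Y + poly (\<eta> x) (u * v) * v ^ p * \<omega> x u v"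
      by (simp add: drift_eq \<omega>_def transit_time_def compensator_eq_exp_primitive[OF u u0_pos])
    then have eq: "(u / u0) powr sigma_bar \<phi> x (u * v) * (drift x u v Y 1 + f 1) =
        poly (\<eta> x) (u * v) * v ^ p * (u / u0) powr sigma_bar \<phi> x (u * v) * \<omega> x u v
                   + (u / u0) powr sigma_bar \<phi> x (u * v) * (Y + \<psi> x Y u v)"
      by (simp add: f1 algebra_simps)
    show ?thesis
      using t(1) t(2)[unfolded eq] \<epsilon>3(2)[rule_format, OF x uu(3) m(2,3) f] unfolding X_def S_def \<omega>_def f1 by blast
  qed
  have smooth: "\<exists>N' D (\<Psi> :: real \<times> real \<times> real \<times> real \<times> 'm \<times> real \<Rightarrow> real).
              open N' \<and> (\<mu>0, \<sigma>0) \<in> N' \<and> N' \<subseteq> N \<and>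
              open D \<and> Ck_on (l - 2) D \<Psi> \<and>
              (\<forall>(\<mu>, \<sigma>)\<in>N'. \<forall>(u, v, Y)\<in>W.
                 (Y, root l u, root l u * \<omega> (\<mu>, \<sigma>) u v, v, \<mu>, \<sigma>) \<in> D \<and>
                 (u > 0 \<longrightarrow>
                    \<psi> (\<mu>, \<sigma>) Y u v = \<Psi> (Y, root l u, root l u * \<omega> (\<mu>, \<sigma>) u v, v, \<mu>, \<sigma>)))"
    if l: "2 \<le> l" for l
  proof -
    define N' where "N' = N \<inter> ball (\<mu>0, \<sigma>0) (sigma_radius l)"
    have N': "open N'" "N' \<subseteq> K" "N' \<subseteq> N" "(\<mu>0, \<sigma>0) \<in> N'"
      using N loss_facts(2)[OF l] by (auto simp: N'_def)
    have near': "\<bar>snd x - \<sigma>0\<bar> \<le> sigma_radius l" if "x \<in> N'" for x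
      using near that by (auto simp: N'_def)
    define D where "D = root_domain l \<epsilon> N'"
    have rc': "rhs_contracting x u v Y" if "x \<in> N'" "u \<in> {0<..<\<epsilon>}" "v \<in> {-1<..<1}" "Y \<in> {-1<..<1}" for x u v Y
      using rc[OF subsetD[OF N'(3) that(1)] that(2-4)] .
    note sol = smooth_remainder_solution[OF N'(1,2) K l near' \<epsilon> rc']
    have opD: "open D" unfolding D_def by (rule sol(1))
    obtain h where h: "\<forall>y\<in>{0..1}. Ck_on (l - 2) D (h y)"
      "\<forall>x\<in>N'. \<forall>u\<in>{0<..<\<epsilon>}. \<forall>v\<in>{-1<..<1}. \<forall>Y\<in>{-1<..<1}. \<forall>w.
       solves_remainder x u v Y (\<lambda>y. h y (Y, root l u, w, v, x))"
      using sol(2) unfolding D_def by blast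
    have h1: "Ck_on (l - 2) D (h 1)" by (rule bspec[OF h(1)]) simp
    have "(Y, root l u, root l u * \<omega> (\<mu>, \<sigma>) u v, v, \<mu>, \<sigma>) \<in> D \<and>
       (u > 0 \<longrightarrow> \<psi> (\<mu>, \<sigma>) Y u v = h 1 (Y, root l u, root l u * \<omega> (\<mu>, \<sigma>) u v, v, \<mu>, \<sigma>))"
      if x: "(\<mu>, \<sigma>) \<in> N'" and uvY: "(u, v, Y) \<in> W" for \<mu> \<sigma> u v Y
    proof (intro conjI impI)
      have "root l u < root l \<epsilon>" using uvY l by (simp add: W_def)
      then show "(Y, root l u, root l u * \<omega> (\<mu>, \<sigma>) u v, v, \<mu>, \<sigma>) \<in> D"
        using x uvY by (auto simp: D_def root_domain_def W_def quadrant_def)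
      assume u: "0 < u"
      note m = Wm[OF uvY u]
      have xN: "(\<mu>, \<sigma>) \<in> N" using x N'(3) by blast
      show "\<psi> (\<mu>, \<sigma>) Y u v = h 1 (Y, root l u, root l u * \<omega> (\<mu>, \<sigma>) u v, v, \<mu>, \<sigma>)"
        unfolding \<psi>_def
        by (rule solves_remainder_unique[OF rc[OF xN m(1-3)] g[rule_format, OF xN m(1-3)] h(2)[rule_format, OF x m(1-3)]]) simp
    qed
    then have "\<forall>(\<mu>, \<sigma>)\<in>N'. \<forall>(u, v, Y)\<in>W. (Y, root l u, root l u * \<omega> (\<mu>, \<sigma>) u v, v, \<mu>, \<sigma>) \<in> D \<and>
       (u > 0 \<longrightarrow> \<psi> (\<mu>, \<sigma>) Y u v = h 1 (Y, root l u, root l u * \<omega> (\<mu>, \<sigma>) u v, v, \<mu>, \<sigma>))"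
      by (intro ballI case_prodI2) blast
    then show ?thesis using opD h1 N' by blast
  qed
  show ?thesis
  proof (intro exI conjI)
    show "\<forall>x\<in>N. \<forall>(u, v, Y)\<in>W. u > 0 \<longrightarrow>
              (\<exists>!b. hits (X x) S (u, v, Y) b) \<and>
              transition_map (X x) S (u, v, Y) =
                (poly (\<eta> x) (u * v) * v ^ p * (u / u0) powr sigma_bar \<phi> x (u * v) * \<omega> x u v
                   + (u / u0) powr sigma_bar \<phi> x (u * v) * (Y + \<psi> x Y u v),
                 u * v) \<and>
              \<bar>\<psi> x Y u v\<bar> \<le>
                C * (u powr (real p + real q * alpha x (u * v)) * \<omega> x u v ^ (q + 1) * \<bar>ln u\<bar>)"
      by (intro ballI case_prodI2 impI, rule trans) simp_all
    show "openin (top_of_set quadrant) W" "(0, 0, 0) \<in> W" using W .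
    show "open N" "(\<mu>0, \<sigma>0) \<in> N" using N(1,3) .
    show "N \<subseteq> \<Lambda>" using N(2) K(2) by blast
  qed (intro allI impI, rule smooth)
qed

text \<open>
  The third equation is linear with the constant coefficient \<open>- \<sigma>_bar\<close> along the trajectory, and \<open>\<sigma>_bar \<ge> 0\<close> near the corner,
  so \<open>|Y|\<close> does not grow before the exit.
\<close>

lemma irrational_transition:
  fixes \<mu>0 :: "'m::euclidean_space"
  assumes "open \<Lambda>" and x0: "(\<mu>0, \<sigma>0) \<in> \<Lambda>" and \<sigma>0: "\<sigma>0 > 0"
    and u0: "u0 > 0" and v0: "v0 > 0" and Y0: "Y0 > 0"
    and smooth: "smooth_poly_family \<Lambda> \<phi>" and \<phi>_0: "\<And>x. x \<in> \<Lambda> \<Longrightarrow> poly (\<phi> x) 0 = 0"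
  shows "\<exists>W N. openin (top_of_set quadrant) W \<and> (0, 0, 0) \<in> W \<and>
          open N \<and> (\<mu>0, \<sigma>0) \<in> N \<and> N \<subseteq> \<Lambda> \<and>
          (\<forall>x\<in>N. \<forall>(u, v, Y)\<in>W. u > 0 \<longrightarrow>
             (\<exists>!b. hits (normal_form_irrational \<phi> x) (exit_section u0 v0 Y0) (u, v, Y) b) \<and>
             transition_map (normal_form_irrational \<phi> x) (exit_section u0 v0 Y0) (u, v, Y) =
               ((u / u0) powr sigma_bar \<phi> x (u * v) * Y, u * v))"
proof -
  obtain d where d: "0 < d" "cball (\<mu>0, \<sigma>0) d \<subseteq> \<Lambda>"
    using assms(1) x0 open_contains_cball by blast
  obtain M where M: "M \<ge> 0" "\<And>x t. x \<in> cball (\<mu>0, \<sigma>0) d \<Longrightarrow> t \<in> {-1..1} \<Longrightarrow> \<bar>poly (\<phi> x) t\<bar> \<le> M * \<bar>t\<bar>"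
    using smooth_poly_family_bounded_linearly[OF smooth compact_cball d(2) \<phi>_0] by metis
  define N where "N = ball (\<mu>0, \<sigma>0) (min d (\<sigma>0 / 2))"
  define \<epsilon> where "\<epsilon> = min (min u0 1) (\<sigma>0 / (2 * (M + 1)))"
  have \<epsilon>: "0 < \<epsilon>" using u0 \<sigma>0 M(1) by (simp add: \<epsilon>_def)
  define W where "W = quadrant \<inter> ({..<\<epsilon>} \<times> {..<min 1 v0} \<times> {-Y0<..<Y0})"
  have trans: "(\<exists>!b. hits (normal_form_irrational \<phi> x) (exit_section u0 v0 Y0) (u, v, Y) b) \<and>
             transition_map (normal_form_irrational \<phi> x) (exit_section u0 v0 Y0) (u, v, Y) =
               ((u / u0) powr sigma_bar \<phi> x (u * v) * Y, u * v)"
    if x: "x \<in> N" and uvY: "(u, v, Y) \<in> W" and u: "0 < u" for x u v Y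
  proof -
    have u': "u < u0" "u < 1" "u < \<sigma>0 / (2 * (M + 1))" and v: "0 \<le> v" "v \<le> v0" "v \<le> 1" and Y: "\<bar>Y\<bar> < Y0"
      using uvY by (auto simp: W_def \<epsilon>_def quadrant_def)
    define s where "s = sigma_bar \<phi> x (u * v)"
    have s: "0 \<le> s"
    proof -
      have uv: "0 \<le> u * v" "u * v \<le> u" using u v by (auto intro: mult_left_le)
      have "\<bar>poly (\<phi> x) (u * v)\<bar> \<le> M * \<bar>u * v\<bar>"
        by (rule M(2)) (use x uv u' in \<open>auto simp: N_def\<close>)
      also have "\<dots> \<le> M * u" using uv M(1) by (intro mult_left_mono) auto
      also have "\<dots> \<le> (M + 1) * u" using u by simp
      also have "\<dots> \<le> \<sigma>0 / 2" using u'(3) M(1) by (simp add: field_simps)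
      finally have "\<bar>poly (\<phi> x) (u * v)\<bar> \<le> \<sigma>0 / 2" .
      moreover have "\<bar>snd x - \<sigma>0\<bar> \<le> \<sigma>0 / 2"
        using x dist_snd_le[of "(\<mu>0, \<sigma>0)" x] by (simp add: N_def dist_real_def abs_minus_commute)
      ultimately show ?thesis unfolding s_def sigma_bar_def by linarith
    qed
    define \<tau> where "\<tau> = ln u0 - ln u"
    have \<tau>: "0 < \<tau>" using u u'(1) by (simp add: \<tau>_def)
    define Yt where "Yt = (\<lambda>t. exp (- s * t) * Y)"
    define P where "P = (\<lambda>u v Y. - sigma_bar \<phi> x (u * v) * Y)"
    have X: "normal_form_irrational \<phi> x = (\<lambda>(u, v, Y). (u, - v, P u v Y))"
      by (simp add: normal_form_irrational_def P_def)
    have uv: "u * exp t * (v * exp (- t)) = u * v" for t by (simp add: exp_minus)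
    have Yt\<tau>: "Yt \<tau> = (u / u0) powr s * Y"
      using u u0 by (simp add: Yt_def powr_def \<tau>_def ln_div algebra_simps)
    have "exp (- s * \<tau>) * \<bar>Y\<bar> \<le> 1 * \<bar>Y\<bar>" using s \<tau> by (intro mult_right_mono) auto
    then have ex: "\<bar>Yt \<tau>\<bar> \<le> Y0" using Y by (simp add: Yt_def abs_mult)
    have d: "(Yt has_real_derivative P (u * exp t) (v * exp (- t)) (Yt t)) (at t within {0..\<tau>})" for t
      unfolding P_def uv s_def[symmetric] Yt_def by (auto intro!: derivative_eq_intros)
    have lip: "\<exists>L\<ge>0. \<forall>t\<in>{0..\<tau>}. \<forall>a\<in>{-R..R}. \<forall>b\<in>{-R..R}.
      \<bar>P (u * exp t) (v * exp (- t)) a - P (u * exp t) (v * exp (- t)) b\<bar> \<le> L * \<bar>a - b\<bar>" for R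
      by (rule exI[of _ s]) (use s in \<open>auto simp: P_def uv s_def[symmetric] abs_mult abs_minus_commute simp flip: right_diff_distrib\<close>)
    note hit = hits_exit_section[where P = P and Yt = Yt, OF u u'(1) v(1,2) _ d[unfolded \<tau>_def] lip[unfolded \<tau>_def] ex[unfolded \<tau>_def], folded X]
    show ?thesis using hit[of Y] Yt\<tau> by (simp add: Yt_def s_def \<tau>_def)
  qed
  have "\<forall>x\<in>N. \<forall>(u, v, Y)\<in>W. u > 0 \<longrightarrow>
             (\<exists>!b. hits (normal_form_irrational \<phi> x) (exit_section u0 v0 Y0) (u, v, Y) b) \<and>
             transition_map (normal_form_irrational \<phi> x) (exit_section u0 v0 Y0) (u, v, Y) =
               ((u / u0) powr sigma_bar \<phi> x (u * v) * Y, u * v)"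
    by (intro ballI case_prodI2 impI, rule trans) simp_all
  moreover have "openin (top_of_set quadrant) W" "(0, 0, 0) \<in> W"
    unfolding W_def using \<epsilon> v0 Y0 openin_quadrant_box[of \<epsilon> "min 1 v0" Y0] by (auto simp: quadrant_def)
  moreover have "open N" "(\<mu>0, \<sigma>0) \<in> N" "N \<subseteq> \<Lambda>"
    using d \<sigma>0 by (auto simp: N_def)
  ultimately show ?thesis by blast
qed

theorem theorem4p5:
  fixes \<mu>0 :: "'m::euclidean_space" and \<sigma>0 u0 v0 Y0 :: real
    and \<Lambda> :: "('m \<times> real) set"
    and \<phi> :: "'m \<times> real \<Rightarrow> real poly"
  assumes "open \<Lambda>" and "(\<mu>0, \<sigma>0) \<in> \<Lambda>" and "\<sigma>0 > 0"
    and "u0 > 0" and "v0 > 0" and "Y0 > 0"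
    and "smooth_poly_family \<Lambda> \<phi>"
    and "\<And>x. x \<in> \<Lambda> \<Longrightarrow> poly (\<phi> x) 0 = 0"
  shows
    "(\<sigma>0 \<notin> \<rat> \<longrightarrow>
       (\<exists>W N. openin (top_of_set quadrant) W \<and> (0, 0, 0) \<in> W \<and>
          open N \<and> (\<mu>0, \<sigma>0) \<in> N \<and> N \<subseteq> \<Lambda> \<and>
          (\<forall>x\<in>N. \<forall>(u, v, Y)\<in>W. u > 0 \<longrightarrow>
             (\<exists>!b. hits (normal_form_irrational \<phi> x) (exit_section u0 v0 Y0) (u, v, Y) b) \<and>
             transition_map (normal_form_irrational \<phi> x) (exit_section u0 v0 Y0) (u, v, Y) =
               ((u / u0) powr sigma_bar \<phi> x (u * v) * Y, u * v))))
     \<and>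
     (\<forall>(p::nat) (q::nat) (\<Phi> :: 'm \<times> real \<Rightarrow> real poly poly) (\<eta> :: 'm \<times> real \<Rightarrow> real poly).
        q > 0 \<and> coprime p q \<and> \<sigma>0 = real p / real q \<and>
        smooth_poly2_family \<Lambda> \<Phi> \<and> (\<forall>x\<in>\<Lambda>. \<forall>\<nu>. poly2 (\<Phi> x) \<nu> 0 = 0) \<and>
        smooth_poly_family \<Lambda> \<eta> \<and> (\<sigma>0 \<notin> \<nat> \<longrightarrow> (\<forall>x\<in>\<Lambda>. \<eta> x = 0)) \<longrightarrow>
        (let X = normal_form_rational p q \<phi> \<Phi> \<eta>;
             S = exit_section u0 v0 Y0;
             \<alpha> = (\<lambda>x \<nu>. sigma_bar \<phi> x \<nu> - \<sigma>0);
             \<omega> = (\<lambda>x u v. compensator (u / u0) (\<alpha> x (u * v)))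
         in
         \<exists>W N (\<psi> :: 'm \<times> real \<Rightarrow> real \<Rightarrow> real \<Rightarrow> real \<Rightarrow> real) (C::real).
           openin (top_of_set quadrant) W \<and> (0, 0, 0) \<in> W \<and>
           open N \<and> (\<mu>0, \<sigma>0) \<in> N \<and> N \<subseteq> \<Lambda> \<and>
           (\<forall>x\<in>N. \<forall>(u, v, Y)\<in>W. u > 0 \<longrightarrow>
              (\<exists>!b. hits (X x) S (u, v, Y) b) \<and>
              transition_map (X x) S (u, v, Y) =
                (poly (\<eta> x) (u * v) * v ^ p * (u / u0) powr sigma_bar \<phi> x (u * v) * \<omega> x u v
                   + (u / u0) powr sigma_bar \<phi> x (u * v) * (Y + \<psi> x Y u v),
                 u * v) \<and>
              \<bar>\<psi> x Y u v\<bar> \<le>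
                C * (u powr (real p + real q * \<alpha> x (u * v)) * \<omega> x u v ^ (q + 1) * \<bar>ln u\<bar>)) \<and>
           (\<forall>l\<ge>2. \<exists>N' D (\<Psi> :: real \<times> real \<times> real \<times> real \<times> 'm \<times> real \<Rightarrow> real).
              open N' \<and> (\<mu>0, \<sigma>0) \<in> N' \<and> N' \<subseteq> N \<and>
              open D \<and> Ck_on (l - 2) D \<Psi> \<and>
              (\<forall>(\<mu>, \<sigma>)\<in>N'. \<forall>(u, v, Y)\<in>W.
                 (Y, root l u, root l u * \<omega> (\<mu>, \<sigma>) u v, v, \<mu>, \<sigma>) \<in> D \<and>
                 (u > 0 \<longrightarrow>
                    \<psi> (\<mu>, \<sigma>) Y u v = \<Psi> (Y, root l u, root l u * \<omega> (\<mu>, \<sigma>) u v, v, \<mu>, \<sigma>))))))"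
proof (intro conjI impI allI, goal_cases)
  case 1
  show ?case by (rule irrational_transition[OF assms])
next
  case (2 p q \<Phi> \<eta>)
  then have "p \<noteq> 0" using \<open>\<sigma>0 > 0\<close> by (intro notI) simp
  interpret resonant_family \<Lambda> \<phi> \<eta> \<Phi> p q \<sigma>0 u0
    by unfold_locales (use 2 assms \<open>p \<noteq> 0\<close> in auto)
  show ?case
    using resonant_transition[OF \<open>(\<mu>0, \<sigma>0) \<in> \<Lambda>\<close> \<open>v0 > 0\<close> \<open>Y0 > 0\<close>]
    unfolding Let_def alpha_def .
qed

end
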